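(* The bounded $1$-dimensional representations of $\widetilde{\mathcal H}(L)$ are the maps $\psi_{I,\mathsf v}$ where $\mathsf v=(\mathsf v_\alpha)_{\alpha\in\Phi}$ is a weighted $I$-parameter system appearing in the list below. (1) If $\Phi$ is simply laced then $\mathsf v_\alpha=-\mathsf q^{-b}$ for all $\alpha\in\Phi$, where $b=L(s_i)$ for any $i\in I$. (2) If $\Phi$ is reduced and not simply laced then the possible values of $(\mathsf v_{\mathrm{sh}},\mathsf v_{\mathrm{lo}})$ are as follows, with the stated constraints on $a,b$: - $(-\mathsf q^{-a},-\mathsf q^{-b})$: $a,b\ge1$ in each of the types $B_n,C_n,F_4,G_2$; - $(\mathsf q^{a},-\mathsf q^{-b})$: $a/b\le n-1$ for $B_n$; $a/b\le1/(n-1)$ for $C_n$; $a/b\le6/5$ for $F_4$; $a/b\le3/2$ for $G_2$; - $(-\mathsf q^{-a},\mathsf q^{b})$: $a/b\ge2(n-1)$ for $B_n$; $a/b\ge2/(n-1)$ for $C_n$; $a/b\ge5/3$ for $F_4$; $a/b\ge2$ for $G_2$. (3) If $\Phi$ is of type $BC_n$ then the possible values of $(\mathsf v_{\alpha_1},\mathsf v_{\alpha_n}\mathsf v_{2\alpha_n},\mathsf v_{2\alpha_n})$ are as follows, with the stated constraints on $a=L(s_n)$, $b=L(s_1)$, $c=L(s_0)$ (where $L(s_n)\ge L(s_0)$): - $(-\mathsf q^{-b},-\mathsf q^{-a},-\mathsf q^{-c})$: $a,b,c\ge1$; - $(-\mathsf q^{-b},-\mathsf q^{-a},\mathsf q^{c})$: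 $a,b,c\ge1$; - $(\mathsf q^{b},-\mathsf q^{-a},-\mathsf q^{-c})$: $a/b+c/b\ge2(n-1)$; - $(\mathsf q^{b},-\mathsf q^{-a},\mathsf q^{c})$: $a/b-c/b\ge2(n-1)$; - $(-\mathsf q^{-b},\mathsf q^{a},-\mathsf q^{-c})$: $a/b-c/b\le n-1$; - $(-\mathsf q^{-b},\mathsf q^{a},\mathsf q^{c})$: $a/b+c/b\le n-1$.
   Context: $\Phi$ is an irreducible, not necessarily reduced, crystallographic root system of rank $n$ in an $n$-dimensional Euclidean space $V$, with simple roots $\alpha_i$, $i\in I=\{1,\dots,n\}$ (Bourbaki labelling), positive roots $\Phi^+$, highest root $\varphi$, $\alpha^\vee=2\alpha/\langle\alpha,\alpha\rangle$. If $\Phi$ is not reduced it is of type $BC_n$: $V=\mathbb R^n$, $\alpha_j=e_j-e_{j+1}$ ($j<n$), $\alpha_n=e_n$, $\Phi^+=\{e_i\pm e_j\ (i<j),\ e_k,\ 2e_k\}$. Let $\omega_i\in V$ satisfy $\langle\omega_i,\alpha_j\rangle=\delta_{ij}$, $P=\bigoplus_i\mathbb Z\omega_i$, $Q=\mathbb Z\Phi^\vee\subseteq P$. $H_{\alpha,k}=\{x:\langle x,\alpha\rangle=k\}$, $s_{\alpha,k}(x)=x-(\langle x,\alpha\rangle-k)\alpha^\vee$, $s_i=s_{\alpha_i,0}$ for $i\in I$, $s_0=s_{\varphi,1}$, $W_0=\langle s_1,\dots,s_n\rangle$, $W=Q\rtimes W_0$ (Coxeter group on $s_0,\dots,s_n$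 with length $\ell$), $\widetilde W=P\rtimes W_0$ with translations $t_\lambda$, $A_0=\{x:0\le\langle x,\alpha\rangle\le1\ \forall\alpha\in\Phi^+\}$, $\Sigma$ the stabiliser of $A_0$ in $\widetilde W$, $\widetilde W=W\rtimes\Sigma$, $\ell(w\sigma)=\ell(w)$ for $w\in W$, $\sigma\in\Sigma$. $L:W\to\mathbb N$ is a positive weight function: $L(w)>0$ for $w\ne e$ and $L(uv)=L(u)+L(v)$ whenever $\ell(uv)=\ell(u)+\ell(v)$; moreover $L(s_i)=L(s_j)$ if $s_i,s_j$ are conjugate in $\widetilde W$ (so $L(s_0)=L(s_1)$ for $\Phi=A_1$, and $L(s_0)=L(s_n)$ for $\Phi=C_n$), $\gcd(L(s_0),\dots,L(s_n))=1$, and $L(s_n)\ge L(s_0)$ if $\Phi=BC_n$. $\mathsf q$ is an invertible indeterminate, $\mathsf q_i=\mathsf q^{L(s_i)}$, $\mathsf R=\mathbb Z[\mathsf q^{\pm1}]$. $\widetilde{\mathcal H}(L)$ is the $\mathsf R$-algebra with basis $\{T_w:w\in\widetilde W\}$, $T_wT_v=T_{wv}$ if $\ell(wv)=\ell(w)+\ell(v)$, $T_wT_{s_i}=T_{ws_i}+(\mathsf q_i-\mathsf q_i^{-1})T_w$ if $\ell(ws_i)=\ell(w)-1$; $T_i=T_{s_i}$. For any expression $w=s_{i_1}\cdots s_{i_\ell}\sigma$ ($\sigma\in\Sigma$), $X_w=T_{i_1}^{\epsilon_1}\cdots T_{i_\ell}^{\epsilon_\ell}T_\sigma$ (independent of the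 expression), where $\epsilon_k=+1$ if $s_{i_1}\cdots s_{i_k}A_0$ lies in the half-space $\{\langle x,\alpha\rangle\ge m\}$, $H_{\alpha,m}$ with $\alpha\in\Phi^+$ being the hyperplane separating $s_{i_1}\cdots s_{i_{k-1}}A_0$ and $s_{i_1}\cdots s_{i_k}A_0$, and $\epsilon_k=-1$ otherwise; $X^\lambda=X_{t_\lambda}$. A weighted $I$-parameter system is a family $\mathsf v=(\mathsf v_\alpha)_{\alpha\in\Phi}$ in $\mathsf R^\times$, constant on $W_0$-orbits, with $\mathsf v_{\alpha_j}\in\{\mathsf q^{L(s_j)},-\mathsf q^{-L(s_j)}\}$ whenever $2\alpha_j\notin\Phi$, and, if $\Phi=BC_n$, $\mathsf v_{2\alpha_n}\in\{\mathsf q^{L(s_0)},-\mathsf q^{-L(s_0)}\}$ and $\mathsf v_{\alpha_n}\mathsf v_{2\alpha_n}\in\{\mathsf q^{L(s_n)},-\mathsf q^{-L(s_n)}\}$; $\mathsf v_{\alpha}=1$ for $\alpha\notin\Phi$. $\mathsf v^\lambda=\prod_{\alpha\in\Phi^+}\mathsf v_\alpha^{\langle\lambda,\alpha\rangle}$ for $\lambda\in P$. If $\Phi$ is reduced with two root lengths, $\mathsf v_{\mathrm{sh}}$, $\mathsf v_{\mathrm{lo}}$ are the values of $\mathsf v$ on short and long roots, $a=L(s_j)$ for $\alpha_j$ short and $b=L(s_j)$ for $\alpha_j$ long; so $\mathsf v_{\mathrm{sh}}\in\{\mathsf q^a,-\mathsf q^{-a}\}$, $\mathsf v_{\mathrm{lo}}\in\{\mathsf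 q^b,-\mathsf q^{-b}\}$. $\mathsf R[\zeta_I]$ is the group ring of $P/Q$ over $\mathsf R$, with $\zeta_I^\lambda$ the class of $\lambda\in P$. For a weighted $I$-parameter system $\mathsf v$, $\psi_{I,\mathsf v}:\widetilde{\mathcal H}(L)\to\mathsf R[\zeta_I]$ is the one-dimensional representation with $\psi_{I,\mathsf v}(T_i)=\mathsf v_{\alpha_i}\mathsf v_{2\alpha_i}$ ($i\in I$) and $\psi_{I,\mathsf v}(X^\lambda)=\mathsf v^\lambda\zeta_I^\lambda$ ($\lambda\in P$); the $1$-dimensional representations under consideration are these maps. Such a representation is bounded if $\deg\psi_{I,\mathsf v}(T_w)$ (degree in $\mathsf q$) is bounded above over all $w\in\widetilde W$.
   Formalization: For Φ of type BC_1 (n=1, so α_1=α_n) the first entry v_{α_1} of the triple in (3) imposes no condition; read literally, every row in (3) would be inconsistent and the list empty, although bounded representations exist. *)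

theory Defs
  imports
    "HOL-Analysis.Analysis"
    "HOL-Library.Poly_Mapping"
    "HOL-Algebra.Module"
    "HOL-Algebra.Coset"
    "HOL-Algebra.Algebraic_Closure_Type"
begin

text \<open>
  The Euclidean space \<open>V\<close> is the whole type \<open>'a :: euclidean_space\<close>, so the rank \<open>n\<close> is
  \<open>DIM('a)\<close> and \<open>I = {1..DIM('a)}\<close>.  A root system is given by the set \<open>\<Phi>\<close> of roots together with
  the labelled simple roots \<open>\<alpha> 1, \<dots>, \<alpha> n\<close>.
\<close>

section \<open>Root systems\<close>

definition coroot :: "'a::euclidean_space \<Rightarrow> 'a" where
  "coroot \<beta> = (2 / (\<beta> \<bullet> \<beta>)) *\<^sub>R \<beta>"

definition aff_refl :: "'a::euclidean_space \<Rightarrow> int \<Rightarrow> 'a \<Rightarrow> 'a" where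
  "aff_refl \<beta> k x = x - (x \<bullet> \<beta> - of_int k) *\<^sub>R coroot \<beta>"

definition crystallographic_root_system :: "'a::euclidean_space set \<Rightarrow> bool" where
  "crystallographic_root_system \<Phi> \<longleftrightarrow>
     finite \<Phi> \<and> span \<Phi> = UNIV \<and> 0 \<notin> \<Phi> \<and>
     (\<forall>\<beta>\<in>\<Phi>. aff_refl \<beta> 0 ` \<Phi> = \<Phi>) \<and>
     (\<forall>\<beta>\<in>\<Phi>. \<forall>\<gamma>\<in>\<Phi>. \<gamma> \<bullet> coroot \<beta> \<in> \<int>)"

definition irreducible_roots :: "'a::euclidean_space set \<Rightarrow> bool" where
  "irreducible_roots \<Phi> \<longleftrightarrow>
     \<Phi> \<noteq> {} \<and>
     \<not> (\<exists>A B. A \<noteq> {} \<and> B \<noteq> {} \<and> A \<union> B = \<Phi> \<and> (\<forall>\<beta>\<in>A. \<forall>\<gamma>\<in>B. \<beta> \<bullet> \<gamma> = 0))"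

definition reduced_roots :: "'a::euclidean_space set \<Rightarrow> bool" where
  "reduced_roots \<Phi> \<longleftrightarrow> (\<forall>\<beta>\<in>\<Phi>. \<forall>c. c *\<^sub>R \<beta> \<in> \<Phi> \<longrightarrow> c = 1 \<or> c = - 1)"

definition simply_laced :: "'a::euclidean_space set \<Rightarrow> bool" where
  "simply_laced \<Phi> \<longleftrightarrow> reduced_roots \<Phi> \<and> (\<forall>\<beta>\<in>\<Phi>. \<forall>\<gamma>\<in>\<Phi>. norm \<beta> = norm \<gamma>)"

definition short_root :: "'a::euclidean_space set \<Rightarrow> 'a \<Rightarrow> bool" where
  "short_root \<Phi> \<beta> \<longleftrightarrow> \<beta> \<in> \<Phi> \<and> (\<forall>\<gamma>\<in>\<Phi>. norm \<beta> \<le> norm \<gamma>)"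

definition pos_cone :: "(nat \<Rightarrow> 'a::euclidean_space) \<Rightarrow> 'a set" where
  "pos_cone \<alpha> = {(\<Sum>i=1..DIM('a). of_nat (c i) *\<^sub>R \<alpha> i) | c :: nat \<Rightarrow> nat. True}"

definition simple_system :: "'a::euclidean_space set \<Rightarrow> (nat \<Rightarrow> 'a) \<Rightarrow> bool" where
  "simple_system \<Phi> \<alpha> \<longleftrightarrow>
     \<alpha> ` {1..DIM('a)} \<subseteq> \<Phi> \<and> inj_on \<alpha> {1..DIM('a)} \<and> independent (\<alpha> ` {1..DIM('a)}) \<and>
     (\<forall>\<beta>\<in>\<Phi>. \<beta> \<in> pos_cone \<alpha> \<or> - \<beta> \<in> pos_cone \<alpha>)"

definition pos_roots :: "'a::euclidean_space set \<Rightarrow> (nat \<Rightarrow> 'a) \<Rightarrow> 'a set" where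
  "pos_roots \<Phi> \<alpha> = \<Phi> \<inter> pos_cone \<alpha>"

definition highest_root :: "'a::euclidean_space set \<Rightarrow> (nat \<Rightarrow> 'a) \<Rightarrow> 'a" where
  "highest_root \<Phi> \<alpha> = (THE \<phi>. \<phi> \<in> \<Phi> \<and> (\<forall>\<beta>\<in>\<Phi>. \<phi> - \<beta> \<in> pos_cone \<alpha>))"

subsection \<open>Types and the Bourbaki labelling\<close>

datatype root_type = Ty_A | Ty_B | Ty_C | Ty_D | Ty_E | Ty_F | Ty_G | Ty_BC

text \<open>The ranks occurring in the Bourbaki plates, so that \<open>B\<^sub>2\<close>, \<open>C\<^sub>2\<close> (and \<open>A\<^sub>3\<close>, \<open>D\<^sub>3\<close>) are
  two labellings of one root system.\<close>

fun type_rank :: "root_type \<Rightarrow> nat \<Rightarrow> bool" where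
  "type_rank Ty_A n \<longleftrightarrow> n \<ge> 1"
| "type_rank Ty_B n \<longleftrightarrow> n \<ge> 2"
| "type_rank Ty_C n \<longleftrightarrow> n \<ge> 2"
| "type_rank Ty_D n \<longleftrightarrow> n \<ge> 3"
| "type_rank Ty_E n \<longleftrightarrow> n \<in> {6, 7, 8}"
| "type_rank Ty_F n \<longleftrightarrow> n = 4"
| "type_rank Ty_G n \<longleftrightarrow> n = 2"
| "type_rank Ty_BC n \<longleftrightarrow> n \<ge> 1"

text \<open>The nodes of the Dynkin diagram joined by an edge, for \<open>i < j\<close>.\<close>

fun dynkin_edge :: "root_type \<Rightarrow> nat \<Rightarrow> nat \<Rightarrow> nat \<Rightarrow> bool" where
  "dynkin_edge Ty_D n i j \<longleftrightarrow> (j = i + 1 \<and> j < n) \<or> (i + 2 = n \<and> j = n)"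
| "dynkin_edge Ty_E n i j \<longleftrightarrow> (i, j) \<in> {(1,3), (2,4), (3,4), (4,5), (5,6), (6,7), (7,8)}"
| "dynkin_edge _ n i j \<longleftrightarrow> j = i + 1"

text \<open>The Cartan integers \<open>\<langle>\<alpha>\<^sub>i, \<alpha>\<^sub>j\<^sup>\<or>\<rangle>\<close> of the reduced types.\<close>

definition cartan_int :: "root_type \<Rightarrow> nat \<Rightarrow> nat \<Rightarrow> nat \<Rightarrow> int" where
  "cartan_int \<tau> n i j =
     (if i = j then 2
      else if \<tau> = Ty_B \<and> (i, j) = (n - 1, n) then - 2
      else if \<tau> = Ty_C \<and> (i, j) = (n, n - 1) then - 2
      else if \<tau> = Ty_F \<and> (i, j) = (2, 3) then - 2
      else if \<tau> = Ty_G \<and> (i, j) = (2, 1) then - 3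
      else if dynkin_edge \<tau> n (min i j) (max i j) then - 1
      else 0)"

text \<open>For \<open>BC\<close> the model in \<open>\<real>\<^sup>n\<close> is transported along an orthonormal basis \<open>e 1, \<dots>, e n\<close>.\<close>

definition BC_model :: "'a::euclidean_space set \<Rightarrow> (nat \<Rightarrow> 'a) \<Rightarrow> bool" where
  "BC_model \<Phi> \<alpha> \<longleftrightarrow>
     (\<exists>e :: nat \<Rightarrow> 'a.
        (\<forall>i\<in>{1..DIM('a)}. \<forall>j\<in>{1..DIM('a)}. e i \<bullet> e j = (if i = j then 1 else 0)) \<and>
        (\<forall>j\<in>{1..<DIM('a)}. \<alpha> j = e j - e (j + 1)) \<and>
        \<alpha> DIM('a) = e DIM('a) \<and>
        pos_roots \<Phi> \<alpha> =
          {e i - e j | i j. 1 \<le> i \<and> i < j \<and> j \<le> DIM('a)} \<union>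
          {e i + e j | i j. 1 \<le> i \<and> i < j \<and> j \<le> DIM('a)} \<union>
          {e k | k. 1 \<le> k \<and> k \<le> DIM('a)} \<union>
          {2 *\<^sub>R e k | k. 1 \<le> k \<and> k \<le> DIM('a)})"

definition bourbaki_labelled :: "root_type \<Rightarrow> 'a::euclidean_space set \<Rightarrow> (nat \<Rightarrow> 'a) \<Rightarrow> bool" where
  "bourbaki_labelled \<tau> \<Phi> \<alpha> \<longleftrightarrow>
     type_rank \<tau> DIM('a) \<and>
     (if \<tau> = Ty_BC then BC_model \<Phi> \<alpha>
      else reduced_roots \<Phi> \<and>
           (\<forall>i\<in>{1..DIM('a)}. \<forall>j\<in>{1..DIM('a)}.
              \<alpha> i \<bullet> coroot (\<alpha> j) = of_int (cartan_int \<tau> DIM('a) i j)))"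

section \<open>Affine Weyl groups\<close>

definition fund_coweight :: "(nat \<Rightarrow> 'a::euclidean_space) \<Rightarrow> nat \<Rightarrow> 'a" where
  "fund_coweight \<alpha> i = (THE x. \<forall>j\<in>{1..DIM('a)}. x \<bullet> \<alpha> j = (if i = j then 1 else 0))"

definition coweight_lattice :: "(nat \<Rightarrow> 'a::euclidean_space) \<Rightarrow> 'a set" where
  "coweight_lattice \<alpha> =
     {(\<Sum>i=1..DIM('a). of_int (k i) *\<^sub>R fund_coweight \<alpha> i) | k :: nat \<Rightarrow> int. True}"

definition coroot_lattice :: "'a::euclidean_space set \<Rightarrow> 'a set" where
  "coroot_lattice \<Phi> = {(\<Sum>\<beta>\<in>\<Phi>. of_int (k \<beta>) *\<^sub>R coroot \<beta>) | k :: 'a \<Rightarrow> int. True}"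

definition transl :: "'a::euclidean_space \<Rightarrow> 'a \<Rightarrow> 'a" where
  "transl \<mu> x = x + \<mu>"

definition gen_refl :: "'a::euclidean_space set \<Rightarrow> (nat \<Rightarrow> 'a) \<Rightarrow> nat \<Rightarrow> 'a \<Rightarrow> 'a" where
  "gen_refl \<Phi> \<alpha> i = (if i = 0 then aff_refl (highest_root \<Phi> \<alpha>) 1 else aff_refl (\<alpha> i) 0)"

definition word_map :: "'a::euclidean_space set \<Rightarrow> (nat \<Rightarrow> 'a) \<Rightarrow> nat list \<Rightarrow> 'a \<Rightarrow> 'a" where
  "word_map \<Phi> \<alpha> is = foldr (\<lambda>i g. gen_refl \<Phi> \<alpha> i \<circ> g) is id"

text \<open>The generators are involutions, so the group they generate consists of the words in them.\<close>

definition finite_weyl :: "'a::euclidean_space set \<Rightarrow> (nat \<Rightarrow> 'a) \<Rightarrow> ('a \<Rightarrow> 'a) set" where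
  "finite_weyl \<Phi> \<alpha> = {word_map \<Phi> \<alpha> is | is. set is \<subseteq> {1..DIM('a)}}"

definition affine_weyl :: "'a::euclidean_space set \<Rightarrow> (nat \<Rightarrow> 'a) \<Rightarrow> ('a \<Rightarrow> 'a) set" where
  "affine_weyl \<Phi> \<alpha> = {transl \<mu> \<circ> g | \<mu> g. \<mu> \<in> coroot_lattice \<Phi> \<and> g \<in> finite_weyl \<Phi> \<alpha>}"

definition ext_affine_weyl :: "'a::euclidean_space set \<Rightarrow> (nat \<Rightarrow> 'a) \<Rightarrow> ('a \<Rightarrow> 'a) set" where
  "ext_affine_weyl \<Phi> \<alpha> = {transl \<mu> \<circ> g | \<mu> g. \<mu> \<in> coweight_lattice \<alpha> \<and> g \<in> finite_weyl \<Phi> \<alpha>}"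

definition fund_alcove :: "'a::euclidean_space set \<Rightarrow> (nat \<Rightarrow> 'a) \<Rightarrow> 'a set" where
  "fund_alcove \<Phi> \<alpha> = {x. \<forall>\<beta>\<in>pos_roots \<Phi> \<alpha>. 0 \<le> x \<bullet> \<beta> \<and> x \<bullet> \<beta> \<le> 1}"

definition alcove_stab :: "'a::euclidean_space set \<Rightarrow> (nat \<Rightarrow> 'a) \<Rightarrow> ('a \<Rightarrow> 'a) set" where
  "alcove_stab \<Phi> \<alpha> = {g \<in> ext_affine_weyl \<Phi> \<alpha>. g ` fund_alcove \<Phi> \<alpha> = fund_alcove \<Phi> \<alpha>}"

definition expression :: "'a::euclidean_space set \<Rightarrow> (nat \<Rightarrow> 'a) \<Rightarrow> nat list \<Rightarrow> ('a \<Rightarrow> 'a) \<Rightarrow> ('a \<Rightarrow> 'a) \<Rightarrow> bool" where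
  "expression \<Phi> \<alpha> is \<sigma> w \<longleftrightarrow>
     set is \<subseteq> {0..DIM('a)} \<and> \<sigma> \<in> alcove_stab \<Phi> \<alpha> \<and> w = word_map \<Phi> \<alpha> is \<circ> \<sigma>"

text \<open>
  The length on the extended group: the decomposition \<open>w = w' \<circ> \<sigma>\<close> with \<open>w'\<close> in the affine Weyl
  group and \<open>\<sigma>\<close> in \<open>alcove_stab\<close> is unique, so this is the Coxeter length of \<open>w'\<close>.
\<close>

definition wlen :: "'a::euclidean_space set \<Rightarrow> (nat \<Rightarrow> 'a) \<Rightarrow> ('a \<Rightarrow> 'a) \<Rightarrow> nat" where
  "wlen \<Phi> \<alpha> w = (LEAST k. \<exists>is \<sigma>. expression \<Phi> \<alpha> is \<sigma> w \<and> length is = k)"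

definition positive_weight_function ::
  "root_type \<Rightarrow> 'a::euclidean_space set \<Rightarrow> (nat \<Rightarrow> 'a) \<Rightarrow> (('a \<Rightarrow> 'a) \<Rightarrow> nat) \<Rightarrow> bool" where
  "positive_weight_function \<tau> \<Phi> \<alpha> L \<longleftrightarrow>
     (\<forall>w\<in>affine_weyl \<Phi> \<alpha>. w \<noteq> id \<longrightarrow> L w > 0) \<and>
     (\<forall>u\<in>affine_weyl \<Phi> \<alpha>. \<forall>w\<in>affine_weyl \<Phi> \<alpha>.
        wlen \<Phi> \<alpha> (u \<circ> w) = wlen \<Phi> \<alpha> u + wlen \<Phi> \<alpha> w \<longrightarrow> L (u \<circ> w) = L u + L w) \<and>
     (\<forall>i\<in>{0..DIM('a)}. \<forall>j\<in>{0..DIM('a)}.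
        (\<exists>g\<in>ext_affine_weyl \<Phi> \<alpha>. gen_refl \<Phi> \<alpha> i = g \<circ> gen_refl \<Phi> \<alpha> j \<circ> Hilbert_Choice.inv g) \<longrightarrow>
        L (gen_refl \<Phi> \<alpha> i) = L (gen_refl \<Phi> \<alpha> j)) \<and>
     Gcd ((\<lambda>i. L (gen_refl \<Phi> \<alpha> i)) ` {0..DIM('a)}) = 1 \<and>
     (\<tau> = Ty_BC \<longrightarrow> L (gen_refl \<Phi> \<alpha> DIM('a)) \<ge> L (gen_refl \<Phi> \<alpha> 0))"

section \<open>Laurent polynomials and the group ring of \<open>P/Q\<close>\<close>

text \<open>\<open>\<int>[q, q\<^sup>-\<^sup>1]\<close> is the monoid algebra of the additive group \<open>\<int>\<close>, with convolution product.\<close>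

type_synonym laurent = "int \<Rightarrow>\<^sub>0 int"

definition qpow :: "int \<Rightarrow> laurent" where
  "qpow k = Poly_Mapping.single k 1"

abbreviation laurent_ring :: "laurent ring" where
  "laurent_ring \<equiv> ring_of_type_algebra"

text \<open>The group ring of \<open>\<G>\<close> over the ring \<open>'r\<close>, as finitely supported functions.\<close>

definition group_ring :: "('g, 'm) monoid_scheme \<Rightarrow> ('r::comm_ring_1, 'g \<Rightarrow>\<^sub>0 'r) module" where
  "group_ring \<G> =
     \<lparr> carrier = {f. Poly_Mapping.keys f \<subseteq> carrier \<G>},
       monoid.mult = (\<lambda>f h. \<Sum>x\<in>Poly_Mapping.keys f. \<Sum>y\<in>Poly_Mapping.keys h.
          Poly_Mapping.single (x \<otimes>\<^bsub>\<G>\<^esub> y) (Poly_Mapping.lookup f x * Poly_Mapping.lookup h y)),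
       one = Poly_Mapping.single \<one>\<^bsub>\<G>\<^esub> 1,
       ring.zero = 0,
       add = (+),
       smult = (\<lambda>r. Poly_Mapping.map ((*) r)) \<rparr>"

definition coweight_group :: "(nat \<Rightarrow> 'a::euclidean_space) \<Rightarrow> 'a monoid" where
  "coweight_group \<alpha> = \<lparr> carrier = coweight_lattice \<alpha>, monoid.mult = (+), one = 0 \<rparr>"

type_synonym 'a zeta_elt = "'a set \<Rightarrow>\<^sub>0 laurent"

definition zeta_ring :: "'a::euclidean_space set \<Rightarrow> (nat \<Rightarrow> 'a) \<Rightarrow> (laurent, 'a zeta_elt) module" where
  "zeta_ring \<Phi> \<alpha> = group_ring (coweight_group \<alpha> Mod coroot_lattice \<Phi>)"

definition zeta :: "'a::euclidean_space set \<Rightarrow> (nat \<Rightarrow> 'a) \<Rightarrow> 'a \<Rightarrow> 'a zeta_elt" where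
  "zeta \<Phi> \<alpha> \<mu> = Poly_Mapping.single (coroot_lattice \<Phi> #>\<^bsub>coweight_group \<alpha>\<^esub> \<mu>) 1"

text \<open>The degree in \<open>q\<close> of a nonzero element of the group ring.\<close>

definition qdeg :: "'a zeta_elt \<Rightarrow> int" where
  "qdeg f = Max (\<Union>x\<in>Poly_Mapping.keys f. Poly_Mapping.keys (Poly_Mapping.lookup f x))"

section \<open>The extended affine Hecke algebra\<close>

text \<open>
  \<open>H\<close> is an associative unital algebra over the Laurent polynomials with basis \<open>T w\<close> and the stated
  multiplication rules, which determine it up to a unique isomorphism preserving the \<open>T w\<close>.
\<close>

definition affine_hecke_algebra ::
  "'a::euclidean_space set \<Rightarrow> (nat \<Rightarrow> 'a) \<Rightarrow> (('a \<Rightarrow> 'a) \<Rightarrow> nat) \<Rightarrow>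
   (laurent, 'h) module \<Rightarrow> (('a \<Rightarrow> 'a) \<Rightarrow> 'h) \<Rightarrow> bool" where
  "affine_hecke_algebra \<Phi> \<alpha> L H T \<longleftrightarrow>
     Ring.ring H \<and> Module.module laurent_ring H \<and>
     (\<forall>r. \<forall>x\<in>carrier H. \<forall>y\<in>carrier H.
        (r \<odot>\<^bsub>H\<^esub> x) \<otimes>\<^bsub>H\<^esub> y = r \<odot>\<^bsub>H\<^esub> (x \<otimes>\<^bsub>H\<^esub> y) \<and>
        x \<otimes>\<^bsub>H\<^esub> (r \<odot>\<^bsub>H\<^esub> y) = r \<odot>\<^bsub>H\<^esub> (x \<otimes>\<^bsub>H\<^esub> y)) \<and>
     (\<forall>w\<in>ext_affine_weyl \<Phi> \<alpha>. T w \<in> carrier H) \<and>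
     (\<forall>x\<in>carrier H. \<exists>!c :: ('a \<Rightarrow> 'a) \<Rightarrow>\<^sub>0 laurent.
        Poly_Mapping.keys c \<subseteq> ext_affine_weyl \<Phi> \<alpha> \<and>
        x = (\<Oplus>\<^bsub>H\<^esub>w\<in>Poly_Mapping.keys c. Poly_Mapping.lookup c w \<odot>\<^bsub>H\<^esub> T w)) \<and>
     (\<forall>w\<in>ext_affine_weyl \<Phi> \<alpha>. \<forall>u\<in>ext_affine_weyl \<Phi> \<alpha>.
        wlen \<Phi> \<alpha> (w \<circ> u) = wlen \<Phi> \<alpha> w + wlen \<Phi> \<alpha> u \<longrightarrow> T w \<otimes>\<^bsub>H\<^esub> T u = T (w \<circ> u)) \<and>
     (\<forall>w\<in>ext_affine_weyl \<Phi> \<alpha>. \<forall>i\<in>{0..DIM('a)}.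
        wlen \<Phi> \<alpha> w = wlen \<Phi> \<alpha> (w \<circ> gen_refl \<Phi> \<alpha> i) + 1 \<longrightarrow>
        T w \<otimes>\<^bsub>H\<^esub> T (gen_refl \<Phi> \<alpha> i) =
          T (w \<circ> gen_refl \<Phi> \<alpha> i) \<oplus>\<^bsub>H\<^esub>
          (qpow (int (L (gen_refl \<Phi> \<alpha> i))) - qpow (- int (L (gen_refl \<Phi> \<alpha> i)))) \<odot>\<^bsub>H\<^esub> T w)"

text \<open>
  The sign of the crossing from the alcove \<open>u A\<^sub>0\<close> to the adjacent alcove \<open>u s\<^sub>i A\<^sub>0\<close>.  Alcoves are
  closed and share a facet, so only the hyperplane spanned by this facet separates them weakly.
\<close>

definition crossing_sign :: "'a::euclidean_space set \<Rightarrow> (nat \<Rightarrow> 'a) \<Rightarrow> ('a \<Rightarrow> 'a) \<Rightarrow> nat \<Rightarrow> int" where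
  "crossing_sign \<Phi> \<alpha> u i =
     (if \<exists>\<beta>\<in>pos_roots \<Phi> \<alpha>. \<exists>m :: int.
           u ` fund_alcove \<Phi> \<alpha> \<subseteq> {x. x \<bullet> \<beta> \<le> of_int m} \<and>
           (u \<circ> gen_refl \<Phi> \<alpha> i) ` fund_alcove \<Phi> \<alpha> \<subseteq> {x. x \<bullet> \<beta> \<ge> of_int m}
      then 1 else - 1)"

text \<open>The first map argument is the product of the letters already read.\<close>

fun X_expr_from ::
  "'a::euclidean_space set \<Rightarrow> (nat \<Rightarrow> 'a) \<Rightarrow> (laurent, 'h) module \<Rightarrow> (('a \<Rightarrow> 'a) \<Rightarrow> 'h) \<Rightarrow>
   ('a \<Rightarrow> 'a) \<Rightarrow> nat list \<Rightarrow> ('a \<Rightarrow> 'a) \<Rightarrow> 'h" where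
  "X_expr_from \<Phi> \<alpha> H T u [] \<sigma> = T \<sigma>"
| "X_expr_from \<Phi> \<alpha> H T u (i # is) \<sigma> =
     (T (gen_refl \<Phi> \<alpha> i) [^]\<^bsub>H\<^esub> crossing_sign \<Phi> \<alpha> u i)
       \<otimes>\<^bsub>H\<^esub> X_expr_from \<Phi> \<alpha> H T (u \<circ> gen_refl \<Phi> \<alpha> i) is \<sigma>"

definition X_expr ::
  "'a::euclidean_space set \<Rightarrow> (nat \<Rightarrow> 'a) \<Rightarrow> (laurent, 'h) module \<Rightarrow> (('a \<Rightarrow> 'a) \<Rightarrow> 'h) \<Rightarrow>
   nat list \<Rightarrow> ('a \<Rightarrow> 'a) \<Rightarrow> 'h" where
  "X_expr \<Phi> \<alpha> H T is \<sigma> = X_expr_from \<Phi> \<alpha> H T id is \<sigma>"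

section \<open>Parameter systems and one-dimensional representations\<close>

definition weighted_parameter_system ::
  "root_type \<Rightarrow> 'a::euclidean_space set \<Rightarrow> (nat \<Rightarrow> 'a) \<Rightarrow> (('a \<Rightarrow> 'a) \<Rightarrow> nat) \<Rightarrow> ('a \<Rightarrow> laurent) \<Rightarrow> bool" where
  "weighted_parameter_system \<tau> \<Phi> \<alpha> L v \<longleftrightarrow>
     (\<forall>\<beta>\<in>\<Phi>. v \<beta> \<in> Units laurent_ring) \<and>
     (\<forall>\<beta>. \<beta> \<notin> \<Phi> \<longrightarrow> v \<beta> = 1) \<and>
     (\<forall>g\<in>finite_weyl \<Phi> \<alpha>. \<forall>\<beta>\<in>\<Phi>. v (g \<beta>) = v \<beta>) \<and>
     (\<forall>j\<in>{1..DIM('a)}. 2 *\<^sub>R \<alpha> j \<notin> \<Phi> \<longrightarrow>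
        v (\<alpha> j) \<in> {qpow (int (L (gen_refl \<Phi> \<alpha> j))), - qpow (- int (L (gen_refl \<Phi> \<alpha> j)))}) \<and>
     (\<tau> = Ty_BC \<longrightarrow>
        v (2 *\<^sub>R \<alpha> DIM('a)) \<in>
          {qpow (int (L (gen_refl \<Phi> \<alpha> 0))), - qpow (- int (L (gen_refl \<Phi> \<alpha> 0)))} \<and>
        v (\<alpha> DIM('a)) * v (2 *\<^sub>R \<alpha> DIM('a)) \<in>
          {qpow (int (L (gen_refl \<Phi> \<alpha> DIM('a)))), - qpow (- int (L (gen_refl \<Phi> \<alpha> DIM('a))))})"

text \<open>For \<open>\<mu>\<close> in the coweight lattice the exponents are integers, so the floor is exact.\<close>

definition v_power ::
  "'a::euclidean_space set \<Rightarrow> (nat \<Rightarrow> 'a) \<Rightarrow> ('a \<Rightarrow> laurent) \<Rightarrow> 'a \<Rightarrow> laurent" where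
  "v_power \<Phi> \<alpha> v \<mu> = (\<Prod>\<beta>\<in>pos_roots \<Phi> \<alpha>. v \<beta> [^]\<^bsub>laurent_ring\<^esub> \<lfloor>\<mu> \<bullet> \<beta>\<rfloor>)"

text \<open>
  \<open>X_expr\<close> depends only on the group element expressed, so the last condition, imposed on all
  expressions of the translation by \<open>\<mu>\<close>, prescribes the value at the single element \<open>X\<^sup>\<mu>\<close>.
  Extensionality makes \<open>\<psi>\<close> unique as a HOL function.
\<close>

definition is_psi ::
  "'a::euclidean_space set \<Rightarrow> (nat \<Rightarrow> 'a) \<Rightarrow> (laurent, 'h) module \<Rightarrow> (('a \<Rightarrow> 'a) \<Rightarrow> 'h) \<Rightarrow>
   ('a \<Rightarrow> laurent) \<Rightarrow> ('h \<Rightarrow> 'a zeta_elt) \<Rightarrow> bool" where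
  "is_psi \<Phi> \<alpha> H T v \<psi> \<longleftrightarrow>
     \<psi> \<in> extensional (carrier H) \<and>
     \<psi> \<in> ring_hom H (zeta_ring \<Phi> \<alpha>) \<and>
     (\<forall>r. \<forall>x\<in>carrier H. \<psi> (r \<odot>\<^bsub>H\<^esub> x) = r \<odot>\<^bsub>zeta_ring \<Phi> \<alpha>\<^esub> \<psi> x) \<and>
     (\<forall>i\<in>{1..DIM('a)}.
        \<psi> (T (gen_refl \<Phi> \<alpha> i)) =
          (v (\<alpha> i) * v (2 *\<^sub>R \<alpha> i)) \<odot>\<^bsub>zeta_ring \<Phi> \<alpha>\<^esub> \<one>\<^bsub>zeta_ring \<Phi> \<alpha>\<^esub>) \<and>
     (\<forall>\<mu>\<in>coweight_lattice \<alpha>. \<forall>is \<sigma>. expression \<Phi> \<alpha> is \<sigma> (transl \<mu>) \<longrightarrow>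
        \<psi> (X_expr \<Phi> \<alpha> H T is \<sigma>) = v_power \<Phi> \<alpha> v \<mu> \<odot>\<^bsub>zeta_ring \<Phi> \<alpha>\<^esub> zeta \<Phi> \<alpha> \<mu>)"

definition psi ::
  "'a::euclidean_space set \<Rightarrow> (nat \<Rightarrow> 'a) \<Rightarrow> (laurent, 'h) module \<Rightarrow> (('a \<Rightarrow> 'a) \<Rightarrow> 'h) \<Rightarrow>
   ('a \<Rightarrow> laurent) \<Rightarrow> 'h \<Rightarrow> 'a zeta_elt" where
  "psi \<Phi> \<alpha> H T v = (THE \<psi>. is_psi \<Phi> \<alpha> H T v \<psi>)"

definition one_dim_reps ::
  "root_type \<Rightarrow> 'a::euclidean_space set \<Rightarrow> (nat \<Rightarrow> 'a) \<Rightarrow> (('a \<Rightarrow> 'a) \<Rightarrow> nat) \<Rightarrow>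
   (laurent, 'h) module \<Rightarrow> (('a \<Rightarrow> 'a) \<Rightarrow> 'h) \<Rightarrow> ('h \<Rightarrow> 'a zeta_elt) set" where
  "one_dim_reps \<tau> \<Phi> \<alpha> L H T = {psi \<Phi> \<alpha> H T v | v. weighted_parameter_system \<tau> \<Phi> \<alpha> L v}"

text \<open>The elements \<open>\<psi> (T w)\<close> are units, so \<open>qdeg\<close> is applied to nonzero elements only.\<close>

definition bounded_rep ::
  "'a::euclidean_space set \<Rightarrow> (nat \<Rightarrow> 'a) \<Rightarrow> (('a \<Rightarrow> 'a) \<Rightarrow> 'h) \<Rightarrow> ('h \<Rightarrow> 'a zeta_elt) \<Rightarrow> bool" where
  "bounded_rep \<Phi> \<alpha> T \<psi> \<longleftrightarrow> (\<exists>N. \<forall>w\<in>ext_affine_weyl \<Phi> \<alpha>. qdeg (\<psi> (T w)) \<le> N)"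

section \<open>The list of parameter systems\<close>

definition in_list_simply_laced ::
  "'a::euclidean_space set \<Rightarrow> (nat \<Rightarrow> 'a) \<Rightarrow> (('a \<Rightarrow> 'a) \<Rightarrow> nat) \<Rightarrow> ('a \<Rightarrow> laurent) \<Rightarrow> bool" where
  "in_list_simply_laced \<Phi> \<alpha> L v \<longleftrightarrow>
     (\<forall>i\<in>{1..DIM('a)}. \<forall>\<beta>\<in>\<Phi>. v \<beta> = - qpow (- int (L (gen_refl \<Phi> \<alpha> i))))"

definition short_long_values ::
  "'a::euclidean_space set \<Rightarrow> ('a \<Rightarrow> 'b) \<Rightarrow> 'b \<Rightarrow> 'b \<Rightarrow> bool" where
  "short_long_values \<Phi> v x y \<longleftrightarrow> (\<forall>\<beta>\<in>\<Phi>. v \<beta> = (if short_root \<Phi> \<beta> then x else y))"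

definition in_list_two_lengths ::
  "root_type \<Rightarrow> 'a::euclidean_space set \<Rightarrow> (nat \<Rightarrow> 'a) \<Rightarrow> (('a \<Rightarrow> 'a) \<Rightarrow> nat) \<Rightarrow> ('a \<Rightarrow> laurent) \<Rightarrow> bool" where
  "in_list_two_lengths \<tau> \<Phi> \<alpha> L v \<longleftrightarrow>
     (\<exists>a b :: nat.
        (\<forall>j\<in>{1..DIM('a)}. L (gen_refl \<Phi> \<alpha> j) = (if short_root \<Phi> (\<alpha> j) then a else b)) \<and>
        (let n = real DIM('a); r = real a / real b in
          short_long_values \<Phi> v (- qpow (- int a)) (- qpow (- int b)) \<and>
            \<tau> \<in> {Ty_B, Ty_C, Ty_F, Ty_G} \<and> a \<ge> 1 \<and> b \<ge> 1 \<or>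
          short_long_values \<Phi> v (qpow (int a)) (- qpow (- int b)) \<and>
            (\<tau> = Ty_B \<and> r \<le> n - 1 \<or> \<tau> = Ty_C \<and> r \<le> 1 / (n - 1) \<or> \<tau> = Ty_F \<and> r \<le> 6 / 5 \<or> \<tau> = Ty_G \<and> r \<le> 3 / 2) \<or>
          short_long_values \<Phi> v (- qpow (- int a)) (qpow (int b)) \<and>
            (\<tau> = Ty_B \<and> r \<ge> 2 * (n - 1) \<or> \<tau> = Ty_C \<and> r \<ge> 2 / (n - 1) \<or> \<tau> = Ty_F \<and> r \<ge> 5 / 3 \<or> \<tau> = Ty_G \<and> r \<ge> 2)))"

text \<open>
  The first value is the one on the middle-length roots \<open>\<plusminus> e i \<plusminus> e j\<close>; for \<open>n = 1\<close> there are none,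
  and \<open>\<alpha> 1\<close> is the root \<open>\<alpha> n\<close>, so no condition is imposed.
\<close>

definition BC_values ::
  "(nat \<Rightarrow> 'a::euclidean_space) \<Rightarrow> ('a \<Rightarrow> laurent) \<Rightarrow> laurent \<Rightarrow> laurent \<Rightarrow> laurent \<Rightarrow> bool" where
  "BC_values \<alpha> v x y z \<longleftrightarrow>
     (DIM('a) \<ge> 2 \<longrightarrow> v (\<alpha> 1) = x) \<and>
     v (\<alpha> DIM('a)) * v (2 *\<^sub>R \<alpha> DIM('a)) = y \<and>
     v (2 *\<^sub>R \<alpha> DIM('a)) = z"

definition in_list_BC ::
  "'a::euclidean_space set \<Rightarrow> (nat \<Rightarrow> 'a) \<Rightarrow> (('a \<Rightarrow> 'a) \<Rightarrow> nat) \<Rightarrow> ('a \<Rightarrow> laurent) \<Rightarrow> bool" where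
  "in_list_BC \<Phi> \<alpha> L v \<longleftrightarrow>
     (let a = L (gen_refl \<Phi> \<alpha> DIM('a)); b = L (gen_refl \<Phi> \<alpha> 1); c = L (gen_refl \<Phi> \<alpha> 0);
          n = real DIM('a);
          ab = real a / real b; cb = real c / real b;
          plus = (\<lambda>k. qpow (int k)); minus = (\<lambda>k. - qpow (- int k))
      in
        BC_values \<alpha> v (minus b) (minus a) (minus c) \<and> a \<ge> 1 \<and> b \<ge> 1 \<and> c \<ge> 1 \<or>
        BC_values \<alpha> v (minus b) (minus a) (plus c) \<and> a \<ge> 1 \<and> b \<ge> 1 \<and> c \<ge> 1 \<or>
        BC_values \<alpha> v (plus b) (minus a) (minus c) \<and> ab + cb \<ge> 2 * (n - 1) \<or>
        BC_values \<alpha> v (plus b) (minus a) (plus c) \<and> ab - cb \<ge> 2 * (n - 1) \<or>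
        BC_values \<alpha> v (minus b) (plus a) (minus c) \<and> ab - cb \<le> n - 1 \<or>
        BC_values \<alpha> v (minus b) (plus a) (plus c) \<and> ab + cb \<le> n - 1)"

definition in_list ::
  "root_type \<Rightarrow> 'a::euclidean_space set \<Rightarrow> (nat \<Rightarrow> 'a) \<Rightarrow> (('a \<Rightarrow> 'a) \<Rightarrow> nat) \<Rightarrow> ('a \<Rightarrow> laurent) \<Rightarrow> bool" where
  "in_list \<tau> \<Phi> \<alpha> L v \<longleftrightarrow>
     (simply_laced \<Phi> \<longrightarrow> in_list_simply_laced \<Phi> \<alpha> L v) \<and>
     (reduced_roots \<Phi> \<and> \<not> simply_laced \<Phi> \<longrightarrow> in_list_two_lengths \<tau> \<Phi> \<alpha> L v) \<and>
     (\<tau> = Ty_BC \<longrightarrow> in_list_BC \<Phi> \<alpha> L v)"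

end

theory Submission
  imports Defs
begin

text \<open>
  A one-dimensional representation sends \<open>T\<^sub>w\<close> to a monomial \<open>\<plusminus> q\<^sup>k\<close> times a class of \<open>P / Q\<close>, and
  the degree \<open>k\<close> is a sum over the hyperplanes that separate the fundamental alcove \<open>A\<^sub>0\<close> from
  \<open>w A\<^sub>0\<close>, each contributing the degree of the parameter of its root.  If \<open>w\<close> is a translation by \<open>\<lambda>\<close>
  after an element of the finite group, about \<open>\<bar>\<langle>\<lambda>, \<beta>\<rangle>\<bar>\<close> hyperplanes are crossed in the direction of
  \<open>\<beta>\<close>, so up to an error bounded independently of \<open>w\<close> the degree is the sum of
  \<open>deg v\<^sub>\<beta> \<bar>\<langle>\<lambda>, \<beta>\<rangle>\<bar>\<close> over the positive roots.  This function of \<open>\<lambda>\<close> is homogeneous, invariant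
  under the finite Weyl group, and linear on the dominant cone.  Hence the representation is
  bounded if and only if the function is nonpositive at the fundamental coweights, that is, if and only
  if the sum \<open>2 \<rho>\<^sub>v\<close> of the positive roots \<open>\<beta>\<close>, weighted by \<open>deg v\<^sub>\<beta>\<close>, has nonpositive coordinates with
  respect to the simple roots (\<open>bounded_iff\<close>).

  As for the usual \<open>2 \<rho>\<close>, the simple reflection at \<open>\<alpha>\<^sub>j\<close> permutes the positive roots off the line of
  \<open>\<alpha>\<^sub>j\<close>, so the products of \<open>2 \<rho>\<^sub>v\<close> with the simple coroots are known and the coordinates solve a
  linear system with the Cartan matrix (\<open>two_rho_system\<close>).  No enumeration of roots is
  involved: the solutions for \<open>B\<^sub>n\<close>, \<open>C\<^sub>n\<close>, \<open>F\<^sub>4\<close> and \<open>G\<^sub>2\<close> give the inequalities of the list, type \<open>BC\<^sub>n\<close>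
  shares the matrix of \<open>B\<^sub>n\<close>, and in the simply laced case all degrees are equal.

  The formula for \<open>\<psi> (T\<^sub>w)\<close> presupposes that the representation attached to a parameter system exists
  and is unique.  Alcoves are replaced by generic points, and the hyperplanes separating two points by
  the set \<open>crossings\<close> of pairs \<open>(\<beta>, m)\<close> with \<open>\<beta>\<close> in the whole root system.  These sets are equivariant
  under the extended affine Weyl group, and they add up along paths that do not cross a hyperplane
  twice.  They compute the length (\<open>wlen_eq\<close>), the signs in the definition of \<open>X\<^sup>\<mu>\<close>
  (\<open>crossing_sign_wall\<close>) and the scalars of the representation (\<open>T_value\<close>).  When \<open>\<beta>\<close> and \<open>2 \<beta>\<close> are
  both roots, a hyperplane of \<open>\<beta>\<close> occurs twice and receives the parameter \<open>v\<^sub>\<beta> v\<^sub>2\<^sub>\<beta>\<close>; in this way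
  the non-reduced systems are treated together with the reduced ones.

  Existence (\<open>Psi_is_psi\<close>): the values on the basis respect the multiplication rules because one more or
  one fewer hyperplane separates after multiplication by a generator, and the value at \<open>X\<^sup>\<mu>\<close>
  telescopes along the path of alcoves.  Uniqueness (\<open>is_psi_unique\<close>): the subalgebra on which two
  candidates agree contains every generator.
\<close>

section \<open>Root systems and the finite Weyl group\<close>

(* The nodes are numbered from 1, so interval bounds are kept in the form 1. *)
declare One_nat_def [simp del]

locale based_root_system =
  fixes \<Phi> :: "'a::euclidean_space set" and \<alpha> :: "nat \<Rightarrow> 'a"
  assumes crystallographic: "crystallographic_root_system \<Phi>"
    and irreducible: "irreducible_roots \<Phi>"
    and simple: "simple_system \<Phi> \<alpha>"
begin

abbreviation \<omega> :: "nat \<Rightarrow> 'a" where "\<omega> \<equiv> fund_coweight \<alpha>"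
abbreviation pos :: "'a set" where "pos \<equiv> pos_roots \<Phi> \<alpha>"
abbreviation refl :: "'a \<Rightarrow> 'a \<Rightarrow> 'a" where "refl \<beta> \<equiv> aff_refl \<beta> 0"

lemma simple_root: "i \<in> {1..DIM('a)} \<Longrightarrow> \<alpha> i \<in> \<Phi>"
  using simple unfolding simple_system_def by auto

lemma finite_roots: "finite \<Phi>" and zero_not_root: "0 \<notin> \<Phi>"
  using crystallographic unfolding crystallographic_root_system_def by auto

lemma root_nonzero: "\<beta> \<in> \<Phi> \<Longrightarrow> \<beta> \<noteq> 0" using zero_not_root by auto

lemma span_simple: "span (\<alpha> ` {1..DIM('a)}) = UNIV"
proof -
  have ind: "independent (\<alpha> ` {1..DIM('a)})" and inj: "inj_on \<alpha> {1..DIM('a)}"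
    using simple unfolding simple_system_def by auto
  have "card (\<alpha> ` {1..DIM('a)}) = DIM('a)" using inj by (simp add: card_image)
  then have "UNIV \<subseteq> span (\<alpha> ` {1..DIM('a)})"
    by (intro card_ge_dim_independent ind) (auto simp: dim_UNIV)
  then show ?thesis by auto
qed

lemma eq_if_inner_simple:
  assumes "\<And>j. j \<in> {1..DIM('a)} \<Longrightarrow> x \<bullet> \<alpha> j = y \<bullet> \<alpha> j"
  shows "x = y"
proof -
  have "orthogonal (x - y) z" if "z \<in> span (\<alpha> ` {1..DIM('a)})" for z
    using that by (rule orthogonal_to_span) (use assms in \<open>auto simp: orthogonal_def inner_diff_left\<close>)
  then have "orthogonal (x - y) (x - y)" by (simp add: span_simple)
  then show ?thesis by (simp add: orthogonal_self)
qed

lemma fund_coweight_simple: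
  assumes "j \<in> {1..DIM('a)}"
  shows "\<omega> i \<bullet> \<alpha> j = (if i = j then 1 else 0)"
proof -
  have ind: "independent (\<alpha> ` {1..DIM('a)})" and inj: "inj_on \<alpha> {1..DIM('a)}"
    using simple unfolding simple_system_def by auto
  obtain g :: "'a \<Rightarrow> real" where g: "linear g"
    and g': "\<forall>x\<in>\<alpha> ` {1..DIM('a)}. g x = (if i = the_inv_into {1..DIM('a)} \<alpha> x then 1 else 0)"
    using linear_independent_extend[OF ind, of "\<lambda>x. if i = the_inv_into {1..DIM('a)} \<alpha> x then 1 else 0"] by blast
  have ex: "\<forall>j\<in>{1..DIM('a)}. adjoint g 1 \<bullet> \<alpha> j = (if i = j then 1 else 0)"
    using g' adjoint_works[OF g, of _ 1] the_inv_into_f_f[OF inj]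
    by (auto simp: inner_commute)
  have "\<exists>!x. \<forall>j\<in>{1..DIM('a)}. x \<bullet> \<alpha> j = (if i = j then 1 else 0)"
  proof (rule ex1I[of _ "adjoint g 1"], rule ex)
    fix x assume "\<forall>j\<in>{1..DIM('a)}. x \<bullet> \<alpha> j = (if i = j then 1 else 0)"
    then show "x = adjoint g 1" using ex by (intro eq_if_inner_simple) auto
  qed
  from theI'[OF this] show ?thesis using assms unfolding fund_coweight_def by blast
qed

lemma coordinates: "x = (\<Sum>i\<in>{1..DIM('a)}. (\<omega> i \<bullet> x) *\<^sub>R \<alpha> i)"
proof -
  let ?f = "\<lambda>x. (\<Sum>i\<in>{1..DIM('a)}. (\<omega> i \<bullet> x) *\<^sub>R \<alpha> i)"
  have lin: "linear ?f"
    by (rule linearI) (simp_all add: inner_add_right scaleR_add_left sum.distrib scaleR_sum_right)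
  have "?f b = id b" if "b \<in> \<alpha> ` {1..DIM('a)}" for b
  proof -
    obtain j where j: "j \<in> {1..DIM('a)}" "b = \<alpha> j" using \<open>b \<in> _\<close> by blast
    have "?f (\<alpha> j) = (\<Sum>i\<in>{1..DIM('a)}. if i = j then \<alpha> j else 0)"
      by (intro sum.cong) (auto simp: fund_coweight_simple[OF j(1)])
    then show ?thesis using j by simp
  qed
  then have "?f x = id x"
    by (rule linear_eq_on_span[OF lin linear_id, of "\<alpha> ` {1..DIM('a)}"]) (simp_all only: span_simple UNIV_I)
  then show ?thesis by simp
qed

text \<open>Because the fundamental coweights are dual to the simple roots, membership in the positive cone
  is a condition on each coordinate separately.  All later positivity arguments use this form.\<close>

lemma pos_cone_iff: "x \<in> pos_cone \<alpha> \<longleftrightarrow> (\<forall>i\<in>{1..DIM('a)}. \<omega> i \<bullet> x \<in> \<nat>)"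
proof
  assume "x \<in> pos_cone \<alpha>"
  then obtain c :: "nat \<Rightarrow> nat" where x: "x = (\<Sum>i=1..DIM('a). of_nat (c i) *\<^sub>R \<alpha> i)"
    unfolding pos_cone_def by auto
  show "\<forall>i\<in>{1..DIM('a)}. \<omega> i \<bullet> x \<in> \<nat>"
  proof
    fix i assume i: "i \<in> {1..DIM('a)}"
    have "\<omega> i \<bullet> x = (\<Sum>j\<in>{1..DIM('a)}. of_nat (c j) * (if i = j then 1 else 0))"
      unfolding x by (simp add: inner_sum_right fund_coweight_simple)
    also have "\<dots> = (\<Sum>j\<in>{1..DIM('a)}. if j = i then of_nat (c j) else 0)"
      by (intro sum.cong) auto
    finally have "\<omega> i \<bullet> x = (\<Sum>j\<in>{1..DIM('a)}. if j = i then of_nat (c j) else 0)" .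
    then show "\<omega> i \<bullet> x \<in> \<nat>" using i by simp
  qed
next
  assume "\<forall>i\<in>{1..DIM('a)}. \<omega> i \<bullet> x \<in> \<nat>"
  then have "\<forall>i\<in>{1..DIM('a)}. \<exists>k. \<omega> i \<bullet> x = of_nat k" by (auto elim: Nats_cases)
  then obtain c where "\<forall>i\<in>{1..DIM('a)}. \<omega> i \<bullet> x = of_nat (c i)" by metis
  then have "x = (\<Sum>i=1..DIM('a). of_nat (c i) *\<^sub>R \<alpha> i)"
    by (subst coordinates[of x]) (auto intro!: sum.cong)
  then show "x \<in> pos_cone \<alpha>" unfolding pos_cone_def by auto
qed

lemma pos_cone_nonneg: "x \<in> pos_cone \<alpha> \<Longrightarrow> i \<in> {1..DIM('a)} \<Longrightarrow> 0 \<le> \<omega> i \<bullet> x"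
  by (auto simp: pos_cone_iff elim!: Nats_cases dest!: bspec)

lemma pos_cone_add: "x \<in> pos_cone \<alpha> \<Longrightarrow> y \<in> pos_cone \<alpha> \<Longrightarrow> x + y \<in> pos_cone \<alpha>"
  by (auto simp: pos_cone_iff inner_add_right)

lemma eq_if_inner_coweight:
  assumes "\<And>i. i \<in> {1..DIM('a)} \<Longrightarrow> \<omega> i \<bullet> x = \<omega> i \<bullet> y"
  shows "x = y"
  by (subst coordinates[of x], subst coordinates[of y]) (auto simp: assms intro!: sum.cong)

lemma pos_cone_antisym:
  assumes "x \<in> pos_cone \<alpha>" "- x \<in> pos_cone \<alpha>"
  shows "x = 0"
proof (rule eq_if_inner_coweight)
  fix i assume "i \<in> {1..DIM('a)}"
  then show "\<omega> i \<bullet> x = \<omega> i \<bullet> 0" using pos_cone_nonneg[OF assms(1)] pos_cone_nonneg[OF assms(2)] by fastforce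
qed

definition height :: "'a \<Rightarrow> real" where "height x = (\<Sum>i\<in>{1..DIM('a)}. \<omega> i) \<bullet> x"

lemma height_sum: "height x = (\<Sum>i\<in>{1..DIM('a)}. \<omega> i \<bullet> x)"
  by (simp add: height_def inner_sum_left)

lemma height_simple: "i \<in> {1..DIM('a)} \<Longrightarrow> height (\<alpha> i) = 1"
  by (simp add: height_sum fund_coweight_simple)

lemma height_diff: "height (x - y) = height x - height y"
  and height_minus: "height (- x) = - height x"
  and height_scale: "height (c *\<^sub>R x) = c * height x"
  by (simp_all add: height_def inner_add_right inner_diff_right)

lemma height_nat:
  assumes "x \<in> pos_cone \<alpha>" shows "height x \<in> \<nat>"
proof -
  have "sum f A \<in> \<nat>" if "\<forall>i\<in>A. f i \<in> \<nat>" for A :: "nat set" and f :: "nat \<Rightarrow> real"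
    using that by (induction A rule: infinite_finite_induct) auto
  from this[OF assms[unfolded pos_cone_iff]] show ?thesis unfolding height_sum .
qed

lemma height_pos:
  assumes "x \<in> pos_cone \<alpha>" "x \<noteq> 0"
  shows "height x \<ge> 1"
proof -
  have "height x \<noteq> 0"
  proof
    assume "height x = 0"
    then have "\<forall>i\<in>{1..DIM('a)}. \<omega> i \<bullet> x = 0"
      unfolding height_sum using pos_cone_nonneg[OF assms(1)] by (subst (asm) sum_nonneg_eq_0_iff) auto
    then show False using eq_if_inner_coweight[of x 0] assms(2) by auto
  qed
  then show ?thesis using height_nat[OF assms(1)] by (auto elim!: Nats_cases)
qed

lemma refl_alt: "refl \<beta> x = x - (x \<bullet> coroot \<beta>) *\<^sub>R \<beta>"
  by (simp add: aff_refl_def coroot_def)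

lemma coroot_inner_self: "\<beta> \<noteq> 0 \<Longrightarrow> \<beta> \<bullet> coroot \<beta> = 2"
  by (simp add: coroot_def)

lemma refl_linear: "linear (refl \<beta>)"
  by (rule linearI) (simp_all add: refl_alt inner_add_left algebra_simps)

lemma refl_self: "\<beta> \<noteq> 0 \<Longrightarrow> refl \<beta> \<beta> = - \<beta>"
  by (simp add: refl_alt coroot_inner_self scaleR_2)

lemma refl_involution: "refl \<beta> (refl \<beta> x) = x"
  by (cases "\<beta> = 0") (simp_all add: refl_alt coroot_inner_self inner_diff_left algebra_simps scaleR_2)

lemma refl_adjoint: "refl \<beta> x \<bullet> y = x \<bullet> refl \<beta> y"
  by (simp add: aff_refl_def coroot_def inner_diff_left inner_diff_right inner_commute)

lemma refl_isometry: "refl \<beta> x \<bullet> refl \<beta> y = x \<bullet> y"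
  by (simp add: refl_adjoint refl_involution)

lemma refl_scale: "c \<noteq> 0 \<Longrightarrow> refl (c *\<^sub>R \<beta>) = refl \<beta>"
  by (rule ext) (simp add: aff_refl_def coroot_def)

lemma refl_root: "\<beta> \<in> \<Phi> \<Longrightarrow> \<gamma> \<in> \<Phi> \<Longrightarrow> refl \<beta> \<gamma> \<in> \<Phi>"
  using crystallographic unfolding crystallographic_root_system_def by blast

lemma cartan_Ints: "\<beta> \<in> \<Phi> \<Longrightarrow> \<gamma> \<in> \<Phi> \<Longrightarrow> \<gamma> \<bullet> coroot \<beta> \<in> \<int>"
  using crystallographic unfolding crystallographic_root_system_def by blast

lemma root_minus: "\<beta> \<in> \<Phi> \<Longrightarrow> - \<beta> \<in> \<Phi>"
  using refl_root[of \<beta> \<beta>] refl_self[of \<beta>] root_nonzero[of \<beta>] by simp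

lemma pos_rootD: "\<beta> \<in> pos \<Longrightarrow> \<beta> \<in> \<Phi>" "\<beta> \<in> pos \<Longrightarrow> \<beta> \<in> pos_cone \<alpha>"
  by (auto simp: pos_roots_def)

lemma finite_pos: "finite pos" using finite_roots by (simp add: pos_roots_def)

lemma root_cases: "\<beta> \<in> \<Phi> \<Longrightarrow> \<beta> \<in> pos \<or> - \<beta> \<in> pos"
  using simple root_minus unfolding simple_system_def pos_roots_def by blast

lemma simple_pos: "i \<in> {1..DIM('a)} \<Longrightarrow> \<alpha> i \<in> pos"
  using simple_root by (auto simp: pos_roots_def pos_cone_iff fund_coweight_simple)

lemma root_coordinate_Ints: "\<beta> \<in> \<Phi> \<Longrightarrow> i \<in> {1..DIM('a)} \<Longrightarrow> \<omega> i \<bullet> \<beta> \<in> \<int>"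
  using root_cases[of \<beta>] by (auto simp: pos_roots_def pos_cone_iff dest!: bspec[of "{1..DIM('a)}" _ i] Nats_subset_Ints[THEN subsetD])
 
text \<open>The coordinate of a root along a simple root is an integer, which gives \<open>c \<in> \<int>\<close>, and the Cartan
  integer of \<open>\<alpha> i\<close> against \<open>c \<alpha> i\<close> is \<open>2 / c\<close>; so \<open>c\<close> divides \<open>2\<close>.\<close>

lemma simple_multiple_root:
  assumes i: "i \<in> {1..DIM('a)}" and r: "c *\<^sub>R \<alpha> i \<in> \<Phi>" and "c > 0"
  shows "c = 1 \<or> c = 2"
proof -
  have "\<omega> i \<bullet> (c *\<^sub>R \<alpha> i) \<in> \<int>" using root_coordinate_Ints[OF r i] .
  then have c: "c \<in> \<int>" by (simp add: fund_coweight_simple[OF i])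
  then obtain k :: int where k: "c = of_int k" by (auto elim: Ints_cases)
  have nz: "\<alpha> i \<noteq> 0" using root_nonzero simple_root i by blast
  have "\<alpha> i \<bullet> coroot (c *\<^sub>R \<alpha> i) \<in> \<int>" using cartan_Ints[OF r simple_root[OF i]] .
  then have "2 / c \<in> \<int>" using nz \<open>c > 0\<close> by (simp add: coroot_def)
  then obtain l :: int where l: "2 / c = of_int l" by (auto elim: Ints_cases)
  then have "(2::real) = of_int (k * l)" using \<open>c > 0\<close> k by (auto simp: field_simps)
  then have kl: "k * l = 2" by linarith
  have "k > 0" using k \<open>c > 0\<close> by simp
  moreover have "k \<le> 2" using kl by (intro zdvd_imp_le dvdI[of _ _ l]) auto
  ultimately show ?thesis using k by (auto simp: le_less)
qed

text \<open>The reflection changes only the \<open>i\<close>-th coordinate.  A positive root outside the line of \<open>\<alpha> i\<close> has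
  another positive coordinate, which survives and decides the sign of the image.\<close>

lemma refl_simple_pos:
  assumes i: "i \<in> {1..DIM('a)}" and b: "\<beta> \<in> pos" and n: "\<And>c. \<beta> \<noteq> c *\<^sub>R \<alpha> i"
  shows "refl (\<alpha> i) \<beta> \<in> pos"
proof -
  have r: "refl (\<alpha> i) \<beta> \<in> \<Phi>" using refl_root simple_root i b pos_rootD by blast
  obtain j where j: "j \<in> {1..DIM('a)}" "j \<noteq> i" "\<omega> j \<bullet> \<beta> \<noteq> 0"
  proof (rule ccontr)
    assume "\<not> thesis"
    then have z: "\<forall>j\<in>{1..DIM('a)}. j \<noteq> i \<longrightarrow> \<omega> j \<bullet> \<beta> = 0" using that by blast
    have "\<beta> = (\<omega> i \<bullet> \<beta>) *\<^sub>R \<alpha> i"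
      by (rule eq_if_inner_coweight) (use z i in \<open>auto simp: fund_coweight_simple\<close>)
    then show False using n by blast
  qed
  have "\<omega> j \<bullet> \<beta> > 0" using pos_cone_nonneg[OF pos_rootD(2)[OF b] j(1)] j(3) by simp
  then have "\<omega> j \<bullet> refl (\<alpha> i) \<beta> > 0"
    using j i by (simp add: refl_alt inner_diff_right fund_coweight_simple)
  then have "- refl (\<alpha> i) \<beta> \<notin> pos_cone \<alpha>" using pos_cone_nonneg[OF _ j(1)] by fastforce
  then show ?thesis using root_cases[OF r] by (auto simp: pos_roots_def)
qed

text \<open>The product of the two Cartan integers is at most \<open>4\<close> by the Cauchy--Schwarz inequality.  Both are
  positive, so unless one of them is \<open>1\<close> both are \<open>2\<close>, and then the roots coincide.\<close>

lemma acute_roots: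
  assumes b: "\<beta> \<in> \<Phi>" and g: "\<gamma> \<in> \<Phi>" and "\<beta> \<bullet> \<gamma> > 0"
  shows "\<beta> = \<gamma> \<or> \<beta> \<bullet> coroot \<gamma> = 1 \<or> \<gamma> \<bullet> coroot \<beta> = 1"
proof -
  have nz: "\<beta> \<noteq> 0" "\<gamma> \<noteq> 0" using b g root_nonzero by auto
  then have ps: "\<beta> \<bullet> \<beta> > 0" "\<gamma> \<bullet> \<gamma> > 0" by auto
  obtain k l :: int where k: "\<beta> \<bullet> coroot \<gamma> = of_int k" and l: "\<gamma> \<bullet> coroot \<beta> = of_int l"
    using cartan_Ints[OF g b] cartan_Ints[OF b g] by (auto elim!: Ints_cases)
  have k': "2 * (\<beta> \<bullet> \<gamma>) = k * (\<gamma> \<bullet> \<gamma>)" and l': "2 * (\<beta> \<bullet> \<gamma>) = l * (\<beta> \<bullet> \<beta>)"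
    using k l nz by (auto simp: coroot_def field_simps inner_commute)
  have "k > 0" "l > 0" using k' l' assms(3) ps by (smt (verit) mult_nonpos_nonneg of_int_nonneg of_int_0_le_iff of_int_le_0_iff)+
  have "(k * l) * ((\<beta> \<bullet> \<beta>) * (\<gamma> \<bullet> \<gamma>)) = (k * (\<gamma> \<bullet> \<gamma>)) * (l * (\<beta> \<bullet> \<beta>))" by simp
  also have "\<dots> = 4 * (\<beta> \<bullet> \<gamma>)\<^sup>2"
    unfolding k'[symmetric] l'[symmetric] by (simp add: power2_eq_square)
  also have "\<dots> \<le> 4 * ((\<beta> \<bullet> \<beta>) * (\<gamma> \<bullet> \<gamma>))" using Cauchy_Schwarz_ineq[of \<beta> \<gamma>] by simp
  finally have "real_of_int (k * l) \<le> 4" using ps by (simp add: mult_le_cancel_right)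
  then have kl: "k * l \<le> 4" by linarith
  show ?thesis
  proof (cases "k = 1 \<or> l = 1")
    case True then show ?thesis using k l by auto
  next
    case False
    then have "k \<ge> 2" "l \<ge> 2" using \<open>k > 0\<close> \<open>l > 0\<close> by auto
    have "2 * l \<le> k * l" using \<open>k \<ge> 2\<close> \<open>l > 0\<close> by (intro mult_right_mono) auto
    then have "l = 2" using kl \<open>l \<ge> 2\<close> by linarith
    moreover have "k = 2" using kl \<open>k \<ge> 2\<close> unfolding \<open>l = 2\<close> by linarith
    ultimately have "(\<beta> - \<gamma>) \<bullet> (\<beta> - \<gamma>) = 0"
      using k' l' by (simp add: inner_diff_left inner_diff_right inner_commute)
    then show ?thesis by simp
  qed
qed

lemma acute_roots_diff:
  assumes b: "\<beta> \<in> \<Phi>" and g: "\<gamma> \<in> \<Phi>" and "\<beta> \<bullet> \<gamma> > 0"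
  shows "\<beta> = \<gamma> \<or> \<beta> - \<gamma> \<in> \<Phi>"
proof -
  have "\<beta> - \<gamma> \<in> \<Phi>" if "\<beta> \<bullet> coroot \<gamma> = 1"
    using refl_root[OF g b] that by (simp add: refl_alt)
  moreover have "\<beta> - \<gamma> \<in> \<Phi>" if "\<gamma> \<bullet> coroot \<beta> = 1"
    using root_minus[OF refl_root[OF b g]] that by (simp add: refl_alt)
  ultimately show ?thesis using acute_roots[OF assms] by blast
qed

lemma word_map_simps [simp]: "word_map \<Phi> \<alpha> [] = id"
  "word_map \<Phi> \<alpha> (i # is) = gen_refl \<Phi> \<alpha> i \<circ> word_map \<Phi> \<alpha> is"
  by (simp_all add: word_map_def)

lemma word_map_append: "word_map \<Phi> \<alpha> (is @ js) = word_map \<Phi> \<alpha> is \<circ> word_map \<Phi> \<alpha> js"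
  by (induction "is") (auto simp: comp_assoc)

abbreviation W0 :: "('a \<Rightarrow> 'a) set" where "W0 \<equiv> finite_weyl \<Phi> \<alpha>"

lemma gen_refl_node: "i \<in> {1..DIM('a)} \<Longrightarrow> gen_refl \<Phi> \<alpha> i = refl (\<alpha> i)"
  by (simp add: gen_refl_def)

lemma W0_induct [consumes 1, case_names id refl]:
  assumes "g \<in> W0" "P id" "\<And>g i. g \<in> W0 \<Longrightarrow> P g \<Longrightarrow> i \<in> {1..DIM('a)} \<Longrightarrow> P (refl (\<alpha> i) \<circ> g)"
  shows "P g"
proof -
  obtain "is" where "is": "set is \<subseteq> {1..DIM('a)}" "g = word_map \<Phi> \<alpha> is" using assms(1) unfolding finite_weyl_def by auto
  have "set is \<subseteq> {1..DIM('a)} \<Longrightarrow> P (word_map \<Phi> \<alpha> is)" for "is"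
  proof (induction "is")
    case Nil then show ?case using assms(2) unfolding word_map_simps by blast
  next
    case (Cons i "is")
    have "word_map \<Phi> \<alpha> is \<in> W0" using Cons.prems unfolding finite_weyl_def by auto
    then have "P (refl (\<alpha> i) \<circ> word_map \<Phi> \<alpha> is)" using Cons by (intro assms(3)) auto
    moreover have "i \<in> {1..DIM('a)}" using Cons.prems by simp
    ultimately show ?case by (simp only: word_map_simps gen_refl_node)
  qed
  then show ?thesis using "is" by simp
qed

lemma W0_id: "id \<in> W0" unfolding finite_weyl_def by (intro CollectI exI[of _ "[]"]) simp

lemma W0_comp: "g \<in> W0 \<Longrightarrow> h \<in> W0 \<Longrightarrow> g \<circ> h \<in> W0"
  unfolding finite_weyl_def
proof clarify
  fix "is" js assume "set is \<subseteq> {1..DIM('a)}" "set js \<subseteq> {1..DIM('a)}"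
  then show "\<exists>ks. word_map \<Phi> \<alpha> is \<circ> word_map \<Phi> \<alpha> js = word_map \<Phi> \<alpha> ks \<and> set ks \<subseteq> {1..DIM('a)}"
    by (intro exI[of _ "is @ js"]) (auto simp: word_map_append)
qed

lemma W0_simple: "i \<in> {1..DIM('a)} \<Longrightarrow> refl (\<alpha> i) \<in> W0"
  unfolding finite_weyl_def by (intro CollectI exI[of _ "[i]"]) (simp add: gen_refl_node)

lemma W0_inverse: "g \<in> W0 \<Longrightarrow> \<exists>h\<in>W0. h \<circ> g = id \<and> g \<circ> h = id"
proof (induction rule: W0_induct)
  case id show ?case using W0_id by (intro bexI[of _ id]) (simp_all only: comp_id)
next
  case (refl g i)
  then obtain h where h: "h \<in> W0" "h \<circ> g = id" "g \<circ> h = id" by blast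
  have "(h \<circ> refl (\<alpha> i)) \<circ> (refl (\<alpha> i) \<circ> g) = id" "(refl (\<alpha> i) \<circ> g) \<circ> (h \<circ> refl (\<alpha> i)) = id"
    using h by (auto simp: fun_eq_iff refl_involution)
  then show ?case using W0_comp[OF h(1) W0_simple[OF refl.hyps(2)]] by blast
qed

lemma W0_linear: "g \<in> W0 \<Longrightarrow> linear g"
proof (induction rule: W0_induct)
  case id show ?case by (rule linear_id)
next
  case (refl g i) show ?case by (rule linear_compose[OF refl.IH refl_linear])
qed

lemma W0_isometry: "g \<in> W0 \<Longrightarrow> g x \<bullet> g y = x \<bullet> y"
  by (induction arbitrary: x y rule: W0_induct) (auto simp: refl_isometry)

lemma W0_root: "g \<in> W0 \<Longrightarrow> \<beta> \<in> \<Phi> \<Longrightarrow> g \<beta> \<in> \<Phi>"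
  by (induction rule: W0_induct) (auto intro!: refl_root simple_root)

lemma W0_bij: "g \<in> W0 \<Longrightarrow> bij g"
  using W0_inverse o_bij by blast

lemma W0_root_iff: "g \<in> W0 \<Longrightarrow> g \<beta> \<in> \<Phi> \<longleftrightarrow> \<beta> \<in> \<Phi>"
  using W0_inverse[of g] W0_root by (metis comp_apply id_apply)

lemma W0_coroot: "g \<in> W0 \<Longrightarrow> g (coroot \<beta>) = coroot (g \<beta>)"
  by (simp add: coroot_def linear_cmul[OF W0_linear] W0_isometry)

text \<open>Induction on the height: a positive root off the simple lines has positive inner product with some
  simple root, because its square length is positive, and the corresponding reflection lowers the
  height while keeping the root positive.  The factor \<open>2\<close> accounts for non-reduced systems.\<close>

lemma root_conjugate_simple:
  assumes "\<beta> \<in> \<Phi>"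
  shows "\<exists>g\<in>W0. \<exists>i\<in>{1..DIM('a)}. \<exists>c\<in>{1,2}. \<beta> = g (c *\<^sub>R \<alpha> i)"
proof -
  have pos: "\<exists>g\<in>W0. \<exists>i\<in>{1..DIM('a)}. \<exists>c\<in>{1,2}. \<beta> = g (c *\<^sub>R \<alpha> i)" if "\<beta> \<in> pos" "height \<beta> \<le> real k" for \<beta> k
    using that
  proof (induction k arbitrary: \<beta>)
    case 0
    then show ?case using height_pos[OF pos_rootD(2) root_nonzero[OF pos_rootD(1)], of \<beta>] by auto
  next
    case (Suc k)
    show ?case
    proof (cases "\<exists>i\<in>{1..DIM('a)}. \<exists>c. \<beta> = c *\<^sub>R \<alpha> i")
      case True
      then obtain i c where ic: "i \<in> {1..DIM('a)}" "\<beta> = c *\<^sub>R \<alpha> i" by blast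
      have "0 \<le> c" using pos_cone_nonneg[OF pos_rootD(2)[OF Suc.prems(1)] ic(1)] ic by (simp add: fund_coweight_simple[OF ic(1)])
      moreover have "c \<noteq> 0" using ic root_nonzero[OF pos_rootD(1)[OF Suc.prems(1)]] by auto
      ultimately have "c \<in> {1,2}" using simple_multiple_root[OF ic(1), of c] ic pos_rootD(1)[OF Suc.prems(1)] by auto
      then show ?thesis using ic W0_id by (metis id_apply)
    next
      case False
      have "\<exists>i\<in>{1..DIM('a)}. \<beta> \<bullet> \<alpha> i > 0"
      proof (rule ccontr)
        assume neg: "\<not> ?thesis"
        have "\<beta> \<bullet> \<beta> = (\<Sum>i\<in>{1..DIM('a)}. (\<omega> i \<bullet> \<beta>) * (\<beta> \<bullet> \<alpha> i))"
          by (subst (2) coordinates[of \<beta>]) (simp add: inner_sum_right)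
        also have "\<dots> \<le> 0" using neg pos_cone_nonneg[OF pos_rootD(2)[OF Suc.prems(1)]]
          by (intro sum_nonpos mult_nonneg_nonpos) (simp_all add: not_less)
        finally show False using root_nonzero[OF pos_rootD(1)[OF Suc.prems(1)]] by (metis inner_gt_zero_iff not_less)
      qed
      then obtain i where i: "i \<in> {1..DIM('a)}" "\<beta> \<bullet> \<alpha> i > 0" by auto
      let ?\<gamma> = "refl (\<alpha> i) \<beta>"
      have r: "?\<gamma> \<in> pos" using refl_simple_pos[OF i(1) Suc.prems(1)] False i(1) by blast
      have ip: "\<alpha> i \<bullet> \<alpha> i > 0" using root_nonzero[OF simple_root[OF i(1)]] by simp
      have "\<beta> \<bullet> coroot (\<alpha> i) > 0" using i ip by (simp add: coroot_def)
      moreover have "\<beta> \<bullet> coroot (\<alpha> i) \<in> \<int>" using cartan_Ints simple_root i pos_rootD Suc.prems(1) by blast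
      ultimately have "\<beta> \<bullet> coroot (\<alpha> i) \<ge> 1" by (auto elim!: Ints_cases)
      then have "height ?\<gamma> \<le> real k" using Suc.prems(2)
        by (simp add: refl_alt height_diff height_scale height_simple[OF i(1)])
      from Suc.IH[OF r this] obtain g j c where g: "g \<in> W0" "j \<in> {1..DIM('a)}" "c \<in> {1,2}" "?\<gamma> = g (c *\<^sub>R \<alpha> j)" by blast
      have "\<beta> = (refl (\<alpha> i) \<circ> g) (c *\<^sub>R \<alpha> j)" using g(4) refl_involution[of "\<alpha> i" \<beta>] by (metis comp_apply)
      then show ?thesis using W0_comp[OF W0_simple[OF i(1)] g(1)] g by blast
    qed
  qed
  have unb: "\<exists>k. height \<beta> \<le> real k" for \<beta> by (rule real_arch_simple)
  show ?thesis
  proof (cases "\<beta> \<in> pos")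
    case True then show ?thesis using pos unb by blast
  next
    case False
    then have "- \<beta> \<in> pos" using root_cases assms by blast
    then obtain g i c where g: "g \<in> W0" "i \<in> {1..DIM('a)}" "c \<in> {1,2}" "- \<beta> = g (c *\<^sub>R \<alpha> i)" using pos unb by blast
    have "refl (\<alpha> i) (c *\<^sub>R \<alpha> i) = - (c *\<^sub>R \<alpha> i)"
      using refl_self[OF root_nonzero[OF simple_root[OF g(2)]]] by (simp add: linear_cmul[OF refl_linear])
    then have "\<beta> = (g \<circ> refl (\<alpha> i)) (c *\<^sub>R \<alpha> i)" using g(4) linear_neg[OF W0_linear[OF g(1)]] by (metis comp_apply minus_minus)
    then show ?thesis using W0_comp[OF g(1) W0_simple[OF g(2)]] g by blast
  qed
qed

lemma refl_conj: "g \<in> W0 \<Longrightarrow> refl (g \<beta>) (g x) = g (refl \<beta> x)"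
  by (simp add: refl_alt linear_diff[OF W0_linear] linear_cmul[OF W0_linear] W0_coroot[symmetric] W0_isometry)

lemma W0_refl_root:
  assumes "\<beta> \<in> \<Phi>" shows "refl \<beta> \<in> W0"
proof -
  obtain g i c where g: "g \<in> W0" "i \<in> {1..DIM('a)}" "c \<in> {1,2}" "\<beta> = g (c *\<^sub>R \<alpha> i)"
    using root_conjugate_simple[OF assms] by blast
  obtain h where h: "h \<in> W0" "h \<circ> g = id" "g \<circ> h = id" using W0_inverse[OF g(1)] by auto
  have c: "c \<noteq> 0" using g(3) by auto
  have "refl \<beta> x = g (refl (\<alpha> i) (h x))" for x
    using refl_conj[OF g(1), of "c *\<^sub>R \<alpha> i" "h x"] h(3) g(4) refl_scale[OF c, of "\<alpha> i"] by (simp add: fun_eq_iff)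
  then have "refl \<beta> = g \<circ> (refl (\<alpha> i) \<circ> h)" by (auto simp: fun_eq_iff)
  then show ?thesis using W0_comp g(1) h(1) W0_simple[OF g(2)] by metis
qed

text \<open>The roots orthogonal to the whole orbit of \<open>\<beta>\<close> are orthogonal to all the other roots, since reflecting
  an orbit element in a root of the other kind stays in the orbit.  Irreducibility leaves only one
  kind.\<close>

lemma W0_nonorthogonal:
  assumes b: "\<beta> \<in> \<Phi>" and g: "\<gamma> \<in> \<Phi>"
  shows "\<exists>w\<in>W0. w \<beta> \<bullet> \<gamma> > 0"
proof -
  define A where "A = {\<delta>\<in>\<Phi>. \<forall>w\<in>W0. w \<beta> \<bullet> \<delta> = 0}"
  define B where "B = \<Phi> - A"
  have "\<zeta> \<bullet> \<delta> = 0" if "\<zeta> \<in> A" "\<delta> \<in> B" for \<zeta> \<delta>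
  proof -
    obtain w where w: "w \<in> W0" "w \<beta> \<bullet> \<delta> \<noteq> 0" using \<open>\<delta> \<in> B\<close> unfolding A_def B_def by blast
    have d: "\<delta> \<in> \<Phi>" using that by (auto simp: B_def)
    have "(refl \<delta> \<circ> w) \<beta> \<bullet> \<zeta> = 0" "w \<beta> \<bullet> \<zeta> = 0" using that W0_comp[OF W0_refl_root[OF d] w(1)] w(1) by (auto simp: A_def)
    then have "(w \<beta> \<bullet> coroot \<delta>) * (\<delta> \<bullet> \<zeta>) = 0" by (simp add: refl_alt inner_diff_left)
    moreover have "w \<beta> \<bullet> coroot \<delta> \<noteq> 0" using w root_nonzero[OF d] by (simp add: coroot_def)
    ultimately show ?thesis by (simp add: inner_commute)
  qed
  moreover have "A \<union> B = \<Phi>" by (auto simp: A_def B_def)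
  ultimately have "A = {} \<or> B = {}" using irreducible unfolding irreducible_roots_def by blast
  moreover have "\<beta> \<in> B" using b root_nonzero[OF b] W0_id by (auto simp: A_def B_def intro!: bexI[of _ id])
  ultimately have "\<gamma> \<in> B" using g by (auto simp: B_def)
  then obtain w where w: "w \<in> W0" "w \<beta> \<bullet> \<gamma> \<noteq> 0" unfolding A_def B_def by blast
  show ?thesis
  proof (cases "w \<beta> \<bullet> \<gamma> > 0")
    case True then show ?thesis using w by auto
  next
    case False
    then have "(refl \<gamma> \<circ> w) \<beta> \<bullet> \<gamma> > 0" using w refl_self[OF root_nonzero[OF g]] by (simp add: refl_adjoint)
    then show ?thesis using W0_comp[OF W0_refl_root[OF g] w(1)] by blast
  qed
qed

text \<open>After moving \<open>\<beta>\<close> within its orbit it makes an acute angle with \<open>\<gamma>\<close>.  The two Cartan integers are then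
  equal, hence both \<open>1\<close>, and three reflections in the rank-two system exchange the roots.  It follows
  that parameters are constant on the roots of a given length.\<close>

lemma equal_norm_conjugate:
  assumes b: "\<beta> \<in> \<Phi>" and g: "\<gamma> \<in> \<Phi>" and n: "norm \<beta> = norm \<gamma>"
  shows "\<exists>w\<in>W0. w \<beta> = \<gamma>"
proof -
  obtain w where w: "w \<in> W0" "w \<beta> \<bullet> \<gamma> > 0" using W0_nonorthogonal[OF b g] by blast
  let ?b = "w \<beta>"
  have bb: "?b \<bullet> ?b = \<gamma> \<bullet> \<gamma>" using n by (simp add: W0_isometry[OF w(1)] norm_eq)
  have br: "?b \<in> \<Phi>" using W0_root w b by blast
  show ?thesis
  proof (cases "?b = \<gamma>")
    case False
    have "?b \<bullet> coroot \<gamma> = \<gamma> \<bullet> coroot ?b" using bb by (simp add: coroot_def inner_commute)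
    then have k: "?b \<bullet> coroot \<gamma> = 1" "\<gamma> \<bullet> coroot ?b = 1" using acute_roots[OF br g w(2)] False by auto
    have "refl \<gamma> (refl ?b (refl \<gamma> ?b)) = \<gamma>"
      using k root_nonzero[OF g] root_nonzero[OF br]
      by (simp add: refl_alt inner_diff_left coroot_inner_self algebra_simps scaleR_2)
    then have "(refl \<gamma> \<circ> (refl ?b \<circ> (refl \<gamma> \<circ> w))) \<beta> = \<gamma>" by simp
    then show ?thesis using W0_comp W0_refl_root g br w(1) by blast
  qed (use w in blast)
qed

text \<open>An orthogonal partition of the simple roots would give two orthogonal subspaces stable under every
  simple reflection.  Every root is conjugate to a multiple of a simple root, so each root would
  lie in one of them, against irreducibility.\<close>

lemma nodes_connected:
  assumes K: "K \<subseteq> {1..DIM('a)}" "K \<noteq> {}" and orth: "\<And>i j. i \<in> K \<Longrightarrow> j \<in> {1..DIM('a)} - K \<Longrightarrow> \<alpha> i \<bullet> \<alpha> j = 0"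
  shows "K = {1..DIM('a)}"
proof (rule ccontr)
  assume "K \<noteq> {1..DIM('a)}"
  then have ne: "{1..DIM('a)} - K \<noteq> {}" using K by auto
  define A where "A = span (\<alpha> ` K)"
  define B where "B = span (\<alpha> ` ({1..DIM('a)} - K))"
  have AB: "x \<bullet> y = 0" if "x \<in> A" "y \<in> B" for x y
  proof -
    have 1: "orthogonal x (\<alpha> j)" if j: "j \<in> {1..DIM('a)} - K" for j
    proof -
      have "orthogonal (\<alpha> j) x" using \<open>x \<in> A\<close> unfolding A_def
        by (rule orthogonal_to_span) (use orth j in \<open>force simp: orthogonal_def inner_commute\<close>)
      then show ?thesis by (simp add: orthogonal_commute)
    qed
    have "orthogonal x y" using \<open>y \<in> B\<close> unfolding B_def
      by (rule orthogonal_to_span) (use 1 in auto)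
    then show ?thesis by (simp add: orthogonal_def)
  qed
  have refl_in: "refl (\<alpha> i) x \<in> span (\<alpha> ` M)" if "i \<in> {1..DIM('a)}" "x \<in> span (\<alpha> ` M)" and M: "M = K \<or> M = {1..DIM('a)} - K" for i x M
  proof (cases "i \<in> M")
    case True then show ?thesis unfolding refl_alt using that by (intro span_diff span_scale) (auto intro: span_base)
  next
    case False
    have "x \<bullet> \<alpha> i = 0"
      using M
    proof
      assume "M = K"
      then have "x \<in> A" "\<alpha> i \<in> B" using that False by (auto simp: A_def B_def intro: span_base)
      then show ?thesis using AB by blast
    next
      assume "M = {1..DIM('a)} - K"
      then have "x \<in> B" "\<alpha> i \<in> A" using that False by (auto simp: A_def B_def intro: span_base)
      then show ?thesis using AB inner_commute by metis
    qed
    then show ?thesis using that by (simp add: aff_refl_def)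
  qed
  have W0_in: "w x \<in> span (\<alpha> ` M)" if "w \<in> W0" "x \<in> span (\<alpha> ` M)" "M = K \<or> M = {1..DIM('a)} - K" for w x M
    using that(1) by (induction rule: W0_induct) (use that refl_in in auto)
  have cover: "\<beta> \<in> A \<or> \<beta> \<in> B" if "\<beta> \<in> \<Phi>" for \<beta>
  proof -
    obtain w i c where w: "w \<in> W0" "i \<in> {1..DIM('a)}" "\<beta> = w (c *\<^sub>R \<alpha> i)" using root_conjugate_simple[OF \<open>\<beta> \<in> \<Phi>\<close>] by blast
    have "c *\<^sub>R \<alpha> i \<in> A \<or> c *\<^sub>R \<alpha> i \<in> B" using w(2) unfolding A_def B_def by (cases "i \<in> K") (auto intro!: span_scale intro: span_base)
    then show ?thesis using W0_in[OF w(1)] w(3) unfolding A_def B_def by blast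
  qed
  have "\<Phi> \<inter> A \<noteq> {}"
  proof -
    obtain j where "j \<in> K" using K by blast
    then have "\<alpha> j \<in> \<Phi> \<inter> A" using simple_root K(1) by (auto simp: A_def intro: span_base)
    then show ?thesis by blast
  qed
  moreover have "\<Phi> \<inter> B \<noteq> {}"
  proof -
    obtain j where "j \<in> {1..DIM('a)} - K" using ne by blast
    then have "\<alpha> j \<in> \<Phi> \<inter> B" using simple_root by (auto simp: B_def intro: span_base)
    then show ?thesis by blast
  qed
  moreover have "(\<Phi> \<inter> A) \<union> (\<Phi> \<inter> B) = \<Phi>" using cover by auto
  moreover have "\<forall>\<beta>\<in>\<Phi> \<inter> A. \<forall>\<gamma>\<in>\<Phi> \<inter> B. \<beta> \<bullet> \<gamma> = 0" using AB by auto
  ultimately have "\<exists>A B. A \<noteq> {} \<and> B \<noteq> {} \<and> A \<union> B = \<Phi> \<and> (\<forall>\<beta>\<in>A. \<forall>\<gamma>\<in>B. \<beta> \<bullet> \<gamma> = 0)"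
    by (intro exI[of _ "\<Phi> \<inter> A"] exI[of _ "\<Phi> \<inter> B"]) simp
  then show False using irreducible unfolding irreducible_roots_def by simp
qed


section \<open>The highest root\<close>

lemma simple_obtuse:
  assumes i: "i \<in> {1..DIM('a)}" and j: "j \<in> {1..DIM('a)}" and "i \<noteq> j"
  shows "\<alpha> i \<bullet> \<alpha> j \<le> 0"
proof (rule ccontr)
  assume "\<not> ?thesis"
  then have "\<alpha> i = \<alpha> j \<or> \<alpha> i - \<alpha> j \<in> \<Phi>" using acute_roots_diff[OF simple_root[OF i] simple_root[OF j]] by simp
  moreover have "\<alpha> i \<noteq> \<alpha> j"
    using fund_coweight_simple[OF i, of i] fund_coweight_simple[OF j, of i] \<open>i \<noteq> j\<close> by auto
  ultimately have "\<alpha> i - \<alpha> j \<in> pos \<or> - (\<alpha> i - \<alpha> j) \<in> pos" using root_cases by blast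
  moreover have "\<omega> i \<bullet> (\<alpha> i - \<alpha> j) = 1" "\<omega> j \<bullet> (\<alpha> i - \<alpha> j) = - 1"
    using \<open>i \<noteq> j\<close> by (simp_all add: inner_diff_right fund_coweight_simple[OF i] fund_coweight_simple[OF j])
  ultimately show False
    using pos_cone_nonneg[OF pos_rootD(2), of "\<alpha> i - \<alpha> j" j] pos_cone_nonneg[OF pos_rootD(2), of "- (\<alpha> i - \<alpha> j)" i] i j
    by (auto simp del: minus_diff_eq)
qed

lemma inner_via_coordinates: "x \<bullet> y = (\<Sum>i\<in>{1..DIM('a)}. (\<omega> i \<bullet> x) * (\<alpha> i \<bullet> y))"
  by (subst coordinates[of x]) (simp add: inner_sum_left)

text \<open>Maximality is for the order in which \<open>\<beta>\<close> lies below \<open>\<gamma>\<close> when \<open>\<gamma> - \<beta>\<close> is in the positive cone.  Two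
  maximal roots are shown to be equal, which turns a maximal root into a greatest one.\<close>

definition maximal_root :: "'a \<Rightarrow> bool" where
  "maximal_root \<phi> \<longleftrightarrow> \<phi> \<in> \<Phi> \<and> (\<forall>\<beta>\<in>\<Phi>. \<beta> - \<phi> \<in> pos_cone \<alpha> \<longrightarrow> \<beta> = \<phi>)"

lemma maximal_root_dominant:
  assumes "maximal_root \<phi>" and i: "i \<in> {1..DIM('a)}"
  shows "0 \<le> \<alpha> i \<bullet> \<phi>"
proof (rule ccontr)
  assume neg: "\<not> ?thesis"
  have r: "\<phi> \<in> \<Phi>" using assms(1) by (simp add: maximal_root_def)
  have nz: "\<alpha> i \<noteq> 0" using root_nonzero[OF simple_root[OF i]] .
  obtain k :: int where k: "\<phi> \<bullet> coroot (\<alpha> i) = of_int k"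
    using cartan_Ints[OF simple_root[OF i] r] by (auto elim: Ints_cases)
  have "\<phi> \<bullet> coroot (\<alpha> i) < 0" using neg nz by (simp add: coroot_def inner_commute mult_pos_neg divide_neg_pos)
  then have "k < 0" using k by simp
  have "refl (\<alpha> i) \<phi> - \<phi> = of_int (- k) *\<^sub>R \<alpha> i" by (simp add: refl_alt k)
  moreover have "of_int (- k) *\<^sub>R \<alpha> i \<in> pos_cone \<alpha>"
    unfolding pos_cone_iff
  proof
    fix j assume "j \<in> {1..DIM('a)}"
    have "\<omega> j \<bullet> of_int (- k) *\<^sub>R \<alpha> i = of_nat (if j = i then nat (- k) else 0)"
      using \<open>k < 0\<close> by (simp add: fund_coweight_simple[OF i])
    then show "\<omega> j \<bullet> of_int (- k) *\<^sub>R \<alpha> i \<in> \<nat>" by (simp only: of_nat_in_Nats)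
  qed
  ultimately have "refl (\<alpha> i) \<phi> = \<phi>"
    using assms(1) refl_root[OF simple_root[OF i] r] by (simp add: maximal_root_def)
  then show False using \<open>k < 0\<close> nz by (simp add: refl_alt k)
qed

lemma maximal_root_pos:
  assumes "maximal_root \<phi>" shows "\<phi> \<in> pos"
proof (rule ccontr)
  assume "\<phi> \<notin> pos"
  have r: "\<phi> \<in> \<Phi>" using assms by (simp add: maximal_root_def)
  then have n: "- \<phi> \<in> pos" using root_cases \<open>\<phi> \<notin> pos\<close> by blast
  then have "- \<phi> - \<phi> \<in> pos_cone \<alpha>" using pos_cone_add[of "- \<phi>" "- \<phi>"] pos_rootD by auto
  then have "- \<phi> = \<phi>" using assms root_minus[OF r] by (simp add: maximal_root_def)
  then show False using \<open>\<phi> \<notin> pos\<close> n by simp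
qed

text \<open>If some coordinates vanished, then dominance and the obtuse angles between simple roots would make
  the support of \<open>\<phi>\<close> orthogonal to its complement.\<close>

lemma maximal_root_full:
  assumes m: "maximal_root \<phi>" and i: "i \<in> {1..DIM('a)}"
  shows "0 < \<omega> i \<bullet> \<phi>"
proof -
  define K where "K = {i \<in> {1..DIM('a)}. 0 < \<omega> i \<bullet> \<phi>}"
  have nn: "0 \<le> \<omega> i \<bullet> \<phi>" if "i \<in> {1..DIM('a)}" for i
    using pos_cone_nonneg[OF pos_rootD(2)[OF maximal_root_pos[OF m]] that] .
  have "K = {1..DIM('a)}"
  proof (rule nodes_connected)
    show "K \<subseteq> {1..DIM('a)}" by (auto simp: K_def)
    show "K \<noteq> {}"
    proof
      assume "K = {}"
      then have "\<omega> i \<bullet> \<phi> = 0" if "i \<in> {1..DIM('a)}" for i using nn[OF that] that unfolding K_def by force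
      then have "\<phi> = 0" using eq_if_inner_coweight[of \<phi> 0] by simp
      then show False using m root_nonzero[of \<phi>] by (simp add: maximal_root_def)
    qed
    fix i j assume ij: "i \<in> K" "j \<in> {1..DIM('a)} - K"
    then have i: "i \<in> {1..DIM('a)}" and j: "j \<in> {1..DIM('a)}" and "\<omega> j \<bullet> \<phi> = 0" "0 < \<omega> i \<bullet> \<phi>"
      using nn[of j] by (auto simp: K_def)
    have np: "(\<omega> k \<bullet> \<phi>) * (\<alpha> k \<bullet> \<alpha> j) \<le> 0" if k: "k \<in> {1..DIM('a)}" for k
      using nn[OF k] simple_obtuse[OF k j] \<open>\<omega> j \<bullet> \<phi> = 0\<close> by (cases "k = j") (auto intro: mult_nonneg_nonpos)
    have "0 \<le> \<alpha> j \<bullet> \<phi>" using maximal_root_dominant[OF m j] .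
    also have "\<alpha> j \<bullet> \<phi> = (\<Sum>k\<in>{1..DIM('a)}. (\<omega> k \<bullet> \<phi>) * (\<alpha> k \<bullet> \<alpha> j))"
      by (simp add: inner_commute[of "\<alpha> j"] inner_via_coordinates[of \<phi>])
    finally have "(\<Sum>k\<in>{1..DIM('a)}. (\<omega> k \<bullet> \<phi>) * (\<alpha> k \<bullet> \<alpha> j)) = 0"
      using sum_nonpos[of "{1..DIM('a)}" "\<lambda>k. (\<omega> k \<bullet> \<phi>) * (\<alpha> k \<bullet> \<alpha> j)"] np by force
    then have "(\<omega> i \<bullet> \<phi>) * (\<alpha> i \<bullet> \<alpha> j) = 0"
      using sum_nonneg_eq_0_iff[of "{1..DIM('a)}" "\<lambda>k. - ((\<omega> k \<bullet> \<phi>) * (\<alpha> k \<bullet> \<alpha> j))"] np i by (simp add: sum_negf)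
    then show "\<alpha> i \<bullet> \<alpha> j = 0" using \<open>0 < \<omega> i \<bullet> \<phi>\<close> by simp
  qed
  then have "i \<in> K" using i by simp
  then show ?thesis unfolding K_def by simp
qed

lemma maximal_root_above:
  assumes "\<beta> \<in> \<Phi>" shows "\<exists>\<gamma>. maximal_root \<gamma> \<and> \<gamma> - \<beta> \<in> pos_cone \<alpha>"
proof -
  let ?U = "{\<gamma>\<in>\<Phi>. \<gamma> - \<beta> \<in> pos_cone \<alpha>}"
  have "finite ?U" "\<beta> \<in> ?U" using finite_roots assms by (auto simp: pos_cone_iff)
  then obtain \<gamma> where g: "\<gamma> \<in> ?U" and mx: "\<And>\<delta>. \<delta> \<in> ?U \<Longrightarrow> height \<delta> \<le> height \<gamma>"
    using obtains_MAX[of ?U height] by (metis (no_types, lifting) Max_ge empty_iff finite_imageI imageI)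
  have "maximal_root \<gamma>" unfolding maximal_root_def
  proof (intro conjI ballI impI)
    show "\<gamma> \<in> \<Phi>" using g by simp
    fix \<delta> assume d: "\<delta> \<in> \<Phi>" "\<delta> - \<gamma> \<in> pos_cone \<alpha>"
    then have "\<delta> \<in> ?U" using pos_cone_add[of "\<delta> - \<gamma>" "\<gamma> - \<beta>"] g by simp
    then have "height (\<delta> - \<gamma>) \<le> 0" using mx by (simp add: height_diff)
    then show "\<delta> = \<gamma>" using height_pos[OF d(2)] by force
  qed
  then show ?thesis using g by blast
qed

text \<open>By fullness and dominance the two roots are not orthogonal, so their difference is zero or a root;
  in the second case they are comparable.\<close>

lemma maximal_root_unique:
  assumes m: "maximal_root \<phi>" and m': "maximal_root \<gamma>" shows "\<phi> = \<gamma>"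
proof -
  have r: "\<phi> \<in> \<Phi>" "\<gamma> \<in> \<Phi>" using m m' by (auto simp: maximal_root_def)
  have nn: "0 \<le> (\<omega> i \<bullet> \<phi>) * (\<alpha> i \<bullet> \<gamma>)" if "i \<in> {1..DIM('a)}" for i
    using maximal_root_full[OF m that] maximal_root_dominant[OF m' that] by simp
  have ip: "\<phi> \<bullet> \<gamma> = (\<Sum>i\<in>{1..DIM('a)}. (\<omega> i \<bullet> \<phi>) * (\<alpha> i \<bullet> \<gamma>))" by (rule inner_via_coordinates)
  have "\<phi> \<bullet> \<gamma> \<noteq> 0"
  proof
    assume "\<phi> \<bullet> \<gamma> = 0"
    then have "\<forall>i\<in>{1..DIM('a)}. (\<omega> i \<bullet> \<phi>) * (\<alpha> i \<bullet> \<gamma>) = 0"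
      unfolding ip using nn by (subst (asm) sum_nonneg_eq_0_iff) auto
    then have "\<gamma> \<bullet> \<alpha> i = 0 \<bullet> \<alpha> i" if "i \<in> {1..DIM('a)}" for i
      using maximal_root_full[OF m that] that by (auto simp: inner_commute dest!: bspec[of _ _ i])
    then have "\<gamma> = 0" by (rule eq_if_inner_simple)
    then show False using r root_nonzero by blast
  qed
  moreover have "0 \<le> \<phi> \<bullet> \<gamma>" unfolding ip using nn by (rule sum_nonneg)
  ultimately have "\<phi> = \<gamma> \<or> \<phi> - \<gamma> \<in> \<Phi>" using acute_roots_diff[OF r] by simp
  then show ?thesis
  proof
    assume "\<phi> - \<gamma> \<in> \<Phi>"
    then have "\<phi> - \<gamma> \<in> pos_cone \<alpha> \<or> \<gamma> - \<phi> \<in> pos_cone \<alpha>" using root_cases pos_rootD(2) by fastforce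
    then show ?thesis using m m' r by (auto simp: maximal_root_def)
  qed
qed

abbreviation \<theta> :: 'a where "\<theta> \<equiv> highest_root \<Phi> \<alpha>"

lemma highest_root: "\<theta> \<in> \<Phi>" "\<And>\<beta>. \<beta> \<in> \<Phi> \<Longrightarrow> \<theta> - \<beta> \<in> pos_cone \<alpha>"
proof -
  obtain \<beta> where b: "\<beta> \<in> \<Phi>" using irreducible unfolding irreducible_roots_def by auto
  then obtain \<phi> where m: "maximal_root \<phi>" using maximal_root_above by blast
  have ex: "\<phi> \<in> \<Phi> \<and> (\<forall>\<beta>\<in>\<Phi>. \<phi> - \<beta> \<in> pos_cone \<alpha>)"
    using m maximal_root_above maximal_root_unique[OF m] by (metis maximal_root_def)
  have "\<psi> = \<phi>" if "\<psi> \<in> \<Phi> \<and> (\<forall>\<beta>\<in>\<Phi>. \<psi> - \<beta> \<in> pos_cone \<alpha>)" for \<psi>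
    using that m by (metis maximal_root_def)
  with ex have "\<exists>!\<phi>. \<phi> \<in> \<Phi> \<and> (\<forall>\<beta>\<in>\<Phi>. \<phi> - \<beta> \<in> pos_cone \<alpha>)" by blast
  from theI'[OF this] show "\<theta> \<in> \<Phi>" "\<And>\<beta>. \<beta> \<in> \<Phi> \<Longrightarrow> \<theta> - \<beta> \<in> pos_cone \<alpha>"
    unfolding highest_root_def by blast+
qed

lemma highest_root_maximal: "maximal_root \<theta>"
  unfolding maximal_root_def
proof (intro conjI ballI impI)
  show "\<theta> \<in> \<Phi>" by (rule highest_root)
  fix \<beta> assume "\<beta> \<in> \<Phi>" "\<beta> - \<theta> \<in> pos_cone \<alpha>"
  then show "\<beta> = \<theta>" using highest_root(2)[of \<beta>] pos_cone_antisym[of "\<beta> - \<theta>"] by simp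
qed

lemma highest_root_pos: "\<theta> \<in> pos"
  by (rule maximal_root_pos[OF highest_root_maximal])

lemma double_highest_root: "2 *\<^sub>R \<theta> \<notin> \<Phi>"
proof
  assume "2 *\<^sub>R \<theta> \<in> \<Phi>"
  from highest_root(2)[OF this] have "- \<theta> \<in> pos_cone \<alpha>" by (simp add: scaleR_2)
  then show False using pos_cone_antisym[OF pos_rootD(2)[OF highest_root_pos]] root_nonzero highest_root(1) by blast
qed

text \<open>The value is a nonnegative integer \<open>k\<close> because \<open>\<theta>\<close> is dominant.  If \<open>k \<ge> 2\<close>, then
  \<open>k \<theta> - \<beta>\<close> is a root that is at least \<open>\<theta>\<close> in the order, which forces \<open>\<beta> = \<theta>\<close>.
  This is what limits the affine reflection of the base alcove to a single crossing.\<close>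

lemma highest_root_cartan:
  assumes b: "\<beta> \<in> pos" "\<beta> \<noteq> \<theta>"
  shows "\<beta> \<bullet> coroot \<theta> = 0 \<or> \<beta> \<bullet> coroot \<theta> = 1"
proof -
  have br: "\<beta> \<in> \<Phi>" using b pos_rootD by blast
  have tz: "\<theta> \<noteq> 0" using root_nonzero highest_root(1) by blast
  obtain k :: int where k: "\<beta> \<bullet> coroot \<theta> = of_int k"
    using cartan_Ints[OF highest_root(1) br] by (auto elim: Ints_cases)
  have "0 \<le> \<beta> \<bullet> \<theta>" unfolding inner_via_coordinates[of \<beta>]
    by (intro sum_nonneg mult_nonneg_nonneg pos_cone_nonneg[OF pos_rootD(2)[OF b(1)]]
        maximal_root_dominant[OF highest_root_maximal])
  then have "0 \<le> \<beta> \<bullet> coroot \<theta>" by (simp add: coroot_def)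
  then have "0 \<le> k" using k by simp
  have "k < 2"
  proof (rule ccontr)
    assume "\<not> k < 2"
    let ?\<gamma> = "of_int k *\<^sub>R \<theta> - \<beta>"
    have "?\<gamma> \<in> \<Phi>" using root_minus[OF refl_root[OF highest_root(1) br]] by (simp add: refl_alt k)
    then have c: "\<theta> - ?\<gamma> \<in> pos_cone \<alpha>" by (rule highest_root)
    have "\<omega> i \<bullet> \<beta> = \<omega> i \<bullet> \<theta>" if i: "i \<in> {1..DIM('a)}" for i
    proof -
      have 1: "0 \<le> \<omega> i \<bullet> (\<theta> - ?\<gamma>)" by (rule pos_cone_nonneg[OF c i])
      have 2: "0 \<le> \<omega> i \<bullet> (\<theta> - \<beta>)" by (rule pos_cone_nonneg[OF highest_root(2)[OF br] i])
      have "0 \<le> of_int (k - 2) * (\<omega> i \<bullet> \<theta>)"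
        using pos_cone_nonneg[OF pos_rootD(2)[OF highest_root_pos] i] \<open>\<not> k < 2\<close> by simp
      then show ?thesis using 1 2 by (simp add: inner_diff_right algebra_simps)
    qed
    then have "\<beta> = \<theta>" by (rule eq_if_inner_coweight)
    then show False using b by simp
  qed
  then have "k = 0 \<or> k = 1" using \<open>0 \<le> k\<close> by auto
  then show ?thesis using k by auto
qed

section \<open>Lattices and the extended affine Weyl group\<close>

abbreviation P :: "'a set" where "P \<equiv> coweight_lattice \<alpha>"
abbreviation Q :: "'a set" where "Q \<equiv> coroot_lattice \<Phi>"
abbreviation We :: "('a \<Rightarrow> 'a) set" where "We \<equiv> ext_affine_weyl \<Phi> \<alpha>"
abbreviation s :: "nat \<Rightarrow> 'a \<Rightarrow> 'a" where "s \<equiv> gen_refl \<Phi> \<alpha>"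

lemma coweight_lattice_iff: "\<mu> \<in> P \<longleftrightarrow> (\<forall>j\<in>{1..DIM('a)}. \<mu> \<bullet> \<alpha> j \<in> \<int>)"
proof
  have eq: "(\<Sum>i=1..DIM('a). c i *\<^sub>R \<omega> i) \<bullet> \<alpha> j = c j" if j: "j \<in> {1..DIM('a)}" for c :: "nat \<Rightarrow> real" and j
  proof -
    have "(\<Sum>i=1..DIM('a). c i *\<^sub>R \<omega> i) \<bullet> \<alpha> j = (\<Sum>i=1..DIM('a). if i = j then c i else 0)"
      unfolding inner_sum_left by (intro sum.cong) (auto simp: fund_coweight_simple[OF j])
    also have "\<dots> = c j" using j by (subst sum.delta) auto
    finally show ?thesis .
  qed
  show "\<forall>j\<in>{1..DIM('a)}. \<mu> \<bullet> \<alpha> j \<in> \<int>" if "\<mu> \<in> P"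
    using that eq unfolding coweight_lattice_def by auto
  assume "\<forall>j\<in>{1..DIM('a)}. \<mu> \<bullet> \<alpha> j \<in> \<int>"
  then have "\<forall>j\<in>{1..DIM('a)}. \<exists>k::int. \<mu> \<bullet> \<alpha> j = of_int k" by (auto elim: Ints_cases)
  then obtain k :: "nat \<Rightarrow> int" where "\<forall>j\<in>{1..DIM('a)}. \<mu> \<bullet> \<alpha> j = of_int (k j)" by metis
  then have "\<mu> = (\<Sum>i=1..DIM('a). of_int (k i) *\<^sub>R \<omega> i)" by (intro eq_if_inner_simple) (simp add: eq)
  then show "\<mu> \<in> P" unfolding coweight_lattice_def by blast
qed

lemma coweight_root_Ints:
  assumes "\<mu> \<in> P" "\<beta> \<in> \<Phi>" shows "\<mu> \<bullet> \<beta> \<in> \<int>"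
proof -
  have "\<beta> \<bullet> \<mu> \<in> \<int>" unfolding inner_via_coordinates[of \<beta>]
    using assms(1) root_coordinate_Ints[OF assms(2)]
    by (intro Ints_sum Ints_mult) (simp_all add: coweight_lattice_iff inner_commute[of "\<alpha> _"])
  then show ?thesis by (simp add: inner_commute)
qed

lemma P_zero: "0 \<in> P" and P_add: "\<mu> \<in> P \<Longrightarrow> \<nu> \<in> P \<Longrightarrow> \<mu> + \<nu> \<in> P" and P_minus: "\<mu> \<in> P \<Longrightarrow> - \<mu> \<in> P"
  by (auto simp: coweight_lattice_iff inner_add_left)

lemma P_scale: "\<mu> \<in> P \<Longrightarrow> of_int k *\<^sub>R \<mu> \<in> P"
  by (auto simp: coweight_lattice_iff)

lemma fund_coweight_P: "\<omega> i \<in> P"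
  by (auto simp: coweight_lattice_iff fund_coweight_simple)

lemma P_W0: assumes "\<mu> \<in> P" "g \<in> W0" shows "g \<mu> \<in> P"
  unfolding coweight_lattice_iff
proof
  fix j assume j: "j \<in> {1..DIM('a)}"
  obtain h where h: "h \<in> W0" "h \<circ> g = id" "g \<circ> h = id" using W0_inverse[OF assms(2)] by blast
  have "g \<mu> \<bullet> \<alpha> j = g \<mu> \<bullet> g (h (\<alpha> j))" using h(3) by (metis comp_apply id_apply)
  also have "\<dots> = \<mu> \<bullet> h (\<alpha> j)" by (rule W0_isometry[OF assms(2)])
  also have "\<dots> \<in> \<int>" by (rule coweight_root_Ints[OF assms(1) W0_root[OF h(1) simple_root[OF j]]])
  finally show "g \<mu> \<bullet> \<alpha> j \<in> \<int>" .
qed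

lemma coroot_P: "\<beta> \<in> \<Phi> \<Longrightarrow> coroot \<beta> \<in> P"
  using cartan_Ints simple_root by (auto simp: coweight_lattice_iff inner_commute[of "coroot \<beta>"])

lemma Q_add: "x \<in> Q \<Longrightarrow> y \<in> Q \<Longrightarrow> x + y \<in> Q"
  unfolding coroot_lattice_def
proof clarify
  fix k l :: "'a \<Rightarrow> int"
  show "\<exists>m :: 'a \<Rightarrow> int. (\<Sum>\<beta>\<in>\<Phi>. of_int (k \<beta>) *\<^sub>R coroot \<beta>) + (\<Sum>\<beta>\<in>\<Phi>. of_int (l \<beta>) *\<^sub>R coroot \<beta>) = (\<Sum>\<beta>\<in>\<Phi>. of_int (m \<beta>) *\<^sub>R coroot \<beta>) \<and> True"
    by (rule exI[of _ "\<lambda>\<beta>. k \<beta> + l \<beta>"]) (simp add: sum.distrib scaleR_add_left)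
qed

lemma Q_minus: "x \<in> Q \<Longrightarrow> - x \<in> Q"
  unfolding coroot_lattice_def
proof clarify
  fix k :: "'a \<Rightarrow> int"
  show "\<exists>m :: 'a \<Rightarrow> int. - (\<Sum>\<beta>\<in>\<Phi>. of_int (k \<beta>) *\<^sub>R coroot \<beta>) = (\<Sum>\<beta>\<in>\<Phi>. of_int (m \<beta>) *\<^sub>R coroot \<beta>) \<and> True"
    by (rule exI[of _ "\<lambda>\<beta>. - k \<beta>"]) (simp add: sum_negf)
qed

lemma Q_coroot: assumes "\<beta> \<in> \<Phi>" shows "of_int k *\<^sub>R coroot \<beta> \<in> Q"
proof -
  have "of_int k *\<^sub>R coroot \<beta> = (\<Sum>\<gamma>\<in>\<Phi>. of_int (if \<gamma> = \<beta> then k else 0) *\<^sub>R coroot \<gamma>)"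
    using assms finite_roots by (simp add: if_distrib[of of_int] if_distrib[of "\<lambda>c. c *\<^sub>R _"] sum.delta cong: if_cong)
  then show ?thesis unfolding coroot_lattice_def by (intro CollectI exI[of _ "\<lambda>\<gamma>. if \<gamma> = \<beta> then k else 0"] conjI TrueI)
qed

lemma Q_zero: "0 \<in> Q"
  using Q_coroot[OF highest_root(1), of 0] by simp

text \<open>The class of \<open>w 0\<close> in \<open>P / Q\<close> is therefore multiplicative in \<open>w\<close>; it supplies the \<open>\<zeta>\<close>-part of the
  representation.\<close>

lemma W0_acts_trivially_mod_Q:
  assumes "\<mu> \<in> P" "g \<in> W0" shows "g \<mu> - \<mu> \<in> Q"
  using assms(2)
proof (induction rule: W0_induct)
  case id then show ?case by (simp add: Q_zero)
next
  case (refl g i)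
  have i: "i \<in> {1..DIM('a)}" by fact
  obtain k :: int where k: "g \<mu> \<bullet> \<alpha> i = of_int k"
    using coweight_root_Ints[OF P_W0[OF assms(1) refl.hyps(1)] simple_root[OF i]] by (auto elim: Ints_cases)
  have "(refl (\<alpha> i) \<circ> g) \<mu> - \<mu> = (g \<mu> - \<mu>) + of_int (- k) *\<^sub>R coroot (\<alpha> i)"
    by (simp add: aff_refl_def k)
  then show ?case using Q_add[OF refl.IH Q_coroot[OF simple_root[OF i], of "- k"]] by (metis (no_types))
qed

text \<open>For \<open>w\<close> in the extended affine Weyl group \<open>w = t\<^sub>\<mu> g\<close> this is \<open>g\<close>, and \<open>w 0\<close> is \<open>\<mu>\<close>; these two
  expressions replace the choice of a decomposition.\<close>

definition lin :: "('a \<Rightarrow> 'a) \<Rightarrow> 'a \<Rightarrow> 'a" where "lin w x = w x - w 0"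

lemma transl_comp_parts:
  assumes "g \<in> W0" shows "lin (transl \<mu> \<circ> g) = g" "(transl \<mu> \<circ> g) 0 = \<mu>"
  using linear_0[OF W0_linear[OF assms]] by (auto simp: lin_def transl_def)

lemma We_parts:
  assumes "w \<in> We"
  shows "lin w \<in> W0" "w 0 \<in> P" "w = transl (w 0) \<circ> lin w" "w x = lin w x + w 0"
proof -
  obtain \<mu> g where w: "w = transl \<mu> \<circ> g" "\<mu> \<in> P" "g \<in> W0" using assms unfolding ext_affine_weyl_def by blast
  note p = transl_comp_parts[OF w(3), of \<mu>, folded w(1)]
  show "lin w \<in> W0" "w 0 \<in> P" using p w by auto
  show "w = transl (w 0) \<circ> lin w" unfolding p by (rule w(1))
  show "w x = lin w x + w 0" by (simp add: lin_def)
qed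

lemma We_I: "\<mu> \<in> P \<Longrightarrow> g \<in> W0 \<Longrightarrow> transl \<mu> \<circ> g \<in> We"
  unfolding ext_affine_weyl_def by blast

lemma W0_We: "g \<in> W0 \<Longrightarrow> g \<in> We"
  using We_I[OF P_zero, of g] by (simp add: transl_def comp_def)

lemma transl_We: "\<mu> \<in> P \<Longrightarrow> transl \<mu> \<in> We"
  using We_I[OF _ W0_id, of \<mu>] by simp

lemma We_comp:
  assumes "w \<in> We" "u \<in> We" shows "w \<circ> u \<in> We"
proof -
  have "w \<circ> u = transl (w 0 + lin w (u 0)) \<circ> (lin w \<circ> lin u)"
  proof
    fix x
    have "w (u x) = lin w (lin u x + u 0) + w 0" using We_parts(4)[OF assms(1), of "u x"] We_parts(4)[OF assms(2), of x] by simp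
    then show "(w \<circ> u) x = (transl (w 0 + lin w (u 0)) \<circ> (lin w \<circ> lin u)) x"
      by (simp add: linear_add[OF W0_linear[OF We_parts(1)[OF assms(1)]]] transl_def algebra_simps)
  qed
  then show ?thesis using We_I[OF P_add[OF We_parts(2)[OF assms(1)] P_W0[OF We_parts(2)[OF assms(2)] We_parts(1)[OF assms(1)]]] W0_comp[OF We_parts(1)[OF assms(1)] We_parts(1)[OF assms(2)]]] by simp
qed

lemma We_inverse:
  assumes "w \<in> We" shows "\<exists>u\<in>We. u \<circ> w = id \<and> w \<circ> u = id"
proof -
  let ?g = "lin w"
  obtain h where h: "h \<in> W0" "h \<circ> ?g = id" "?g \<circ> h = id" using W0_inverse[OF We_parts(1)[OF assms]] by blast
  have h': "h (?g x) = x" "?g (h x) = x" for x using h by (metis comp_apply id_apply)+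
  let ?u = "transl (- h (w 0)) \<circ> h"
  have "?u \<in> We" using We_I[OF P_minus[OF P_W0[OF We_parts(2)[OF assms] h(1)]] h(1)] .
  moreover have "?u (w x) = x" for x
    by (simp add: transl_def We_parts(4)[OF assms, of x] linear_add[OF W0_linear[OF h(1)]] h')
  moreover have "w (?u x) = x" for x
    using We_parts(4)[OF assms, of "?u x"]
    by (simp add: transl_def linear_diff[OF W0_linear[OF We_parts(1)[OF assms]]] h')
  ultimately show ?thesis by (intro bexI[of _ ?u]) (auto simp: fun_eq_iff)
qed

lemma We_bij: "w \<in> We \<Longrightarrow> bij w"
  using We_inverse o_bij by blast

lemma s_zero: "s 0 = transl (coroot \<theta>) \<circ> refl \<theta>"
  by (auto simp: gen_refl_def aff_refl_def transl_def fun_eq_iff algebra_simps)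

lemma s_We: assumes "i \<in> {0..DIM('a)}" shows "s i \<in> We"
proof (cases "i = 0")
  case True
  show ?thesis unfolding True s_zero by (rule We_I[OF coroot_P[OF highest_root(1)] W0_refl_root[OF highest_root(1)]])
next
  case False
  then have "i \<in> {1..DIM('a)}" using assms by auto
  then show ?thesis using W0_We[OF W0_simple] gen_refl_node by simp
qed

lemma s_involution: "s i (s i x) = x"
proof (cases "i = 0")
  case True
  have "\<theta> \<noteq> 0" using root_nonzero highest_root(1) by blast
  then show ?thesis using True coroot_inner_self[of \<theta>]
    by (simp add: gen_refl_def aff_refl_def inner_diff_left inner_commute[of "coroot \<theta>"] algebra_simps)
next
  case False then show ?thesis by (simp add: gen_refl_def refl_involution)
qed

lemma word_We: "set is \<subseteq> {0..DIM('a)} \<Longrightarrow> word_map \<Phi> \<alpha> is \<in> We"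
proof (induction "is")
  case Nil show ?case using W0_We[OF W0_id] by (simp only: word_map_simps)
next
  case (Cons i "is")
  then have "s i \<in> We" "word_map \<Phi> \<alpha> is \<in> We" using s_We[of i] by auto
  then show ?case using We_comp by (simp only: word_map_simps)
qed


section \<open>Hyperplanes separating two points\<close>

definition generic :: "'a \<Rightarrow> bool" where
  "generic x \<longleftrightarrow> (\<forall>\<beta>\<in>\<Phi>. x \<bullet> \<beta> \<notin> \<int>)"

text \<open>Pairs \<open>(\<beta>, m)\<close> with \<open>\<beta>\<close> ranging over all roots, so the sign of \<open>\<beta>\<close> records the direction in which
  the hyperplane \<open>\<langle>\<cdot>, \<beta>\<rangle> = m\<close> is crossed on the way from \<open>x\<close> to \<open>y\<close>, and no normalisation by positive roots
  spoils the equivariance.  If \<open>\<beta>\<close> and \<open>2 \<beta>\<close> are roots, a hyperplane of \<open>\<beta>\<close> is counted by both.\<close>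

definition crossings :: "'a \<Rightarrow> 'a \<Rightarrow> ('a \<times> int) set" where
  "crossings x y = {(\<beta>, m). \<beta> \<in> \<Phi> \<and> x \<bullet> \<beta> < of_int m \<and> of_int m < y \<bullet> \<beta>}"

lemma mem_crossings: "(\<beta>, m) \<in> crossings x y \<longleftrightarrow> \<beta> \<in> \<Phi> \<and> x \<bullet> \<beta> < of_int m \<and> of_int m < y \<bullet> \<beta>"
  by (simp add: crossings_def)

lemma finite_crossings: "finite (crossings x y)"
proof -
  have "crossings x y \<subseteq> (SIGMA \<beta>:\<Phi>. {\<lfloor>x \<bullet> \<beta>\<rfloor>..\<lceil>y \<bullet> \<beta>\<rceil>})"
    by (auto simp: crossings_def) linarith+
  then show ?thesis using finite_subset finite_roots by blast
qed

lemma genericD: "generic x \<Longrightarrow> \<beta> \<in> \<Phi> \<Longrightarrow> x \<bullet> \<beta> \<noteq> of_int m"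
  unfolding generic_def by (metis Ints_of_int)

lemma generic_cases: "generic x \<Longrightarrow> \<beta> \<in> \<Phi> \<Longrightarrow> x \<bullet> \<beta> < of_int m \<or> of_int m < x \<bullet> \<beta>"
  using genericD[of x \<beta> m] by linarith

lemma crossings_swap:
  "bij_betw (\<lambda>(\<beta>, m). (- \<beta>, - m)) (crossings x y) (crossings y x)"
  by (rule bij_betwI[where g = "\<lambda>(\<beta>, m). (- \<beta>, - m)"]) (auto simp: crossings_def root_minus)

text \<open>The hypothesis says that the way from \<open>y\<close> to \<open>z\<close> recrosses none of the hyperplanes crossed from
  \<open>x\<close> to \<open>y\<close>.\<close>

lemma crossings_concat:
  assumes "generic y" "generic z" and "\<And>\<beta> m. (\<beta>, m) \<in> crossings y z \<Longrightarrow> x \<bullet> \<beta> < of_int m"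
  shows "crossings x z = crossings x y \<union> crossings y z" "crossings x y \<inter> crossings y z = {}"
proof -
  show "crossings x y \<inter> crossings y z = {}" by (auto simp: crossings_def)
  have "of_int m < z \<bullet> \<beta>" if c: "(\<beta>, m) \<in> crossings x y" for \<beta> m
  proof (rule ccontr)
    assume "\<not> ?thesis"
    then have "z \<bullet> \<beta> < of_int m" using generic_cases[OF assms(2), of \<beta> m] c by (auto simp: mem_crossings)
    then have "(- \<beta>, - m) \<in> crossings y z" using c by (auto simp: mem_crossings root_minus)
    from assms(3)[OF this] show False using c by (auto simp: mem_crossings)
  qed
  moreover have "x \<bullet> \<beta> < of_int m" if "(\<beta>, m) \<in> crossings y z" for \<beta> m using assms(3) that .
  ultimately show "crossings x z = crossings x y \<union> crossings y z"
    using generic_cases[OF assms(1)] by (auto simp: mem_crossings) (metis order.strict_trans)+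
qed

lemma crossings_concat':
  assumes "generic x" "generic y" "generic z" and "crossings x y \<subseteq> crossings x z"
  shows "crossings x z = crossings x y \<union> crossings y z" "crossings x y \<inter> crossings y z = {}"
proof -
  have 1: "x \<bullet> \<beta> < of_int m" if c: "(\<beta>, m) \<in> crossings y z" for \<beta> m
  proof (rule ccontr)
    assume "\<not> ?thesis"
    then have "of_int m < x \<bullet> \<beta>" using generic_cases[OF assms(1), of \<beta> m] c by (auto simp: mem_crossings)
    then have "(- \<beta>, - m) \<in> crossings x y" using c by (auto simp: mem_crossings root_minus)
    then have "(- \<beta>, - m) \<in> crossings x z" using assms(4) by blast
    then show False using c by (auto simp: mem_crossings)
  qed
  show "crossings x z = crossings x y \<union> crossings y z" "crossings x y \<inter> crossings y z = {}"
    using crossings_concat[OF assms(2,3) 1] by auto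
qed

lemma crossings_triangle:
  assumes "generic y" shows "crossings x z \<subseteq> crossings x y \<union> crossings y z"
proof clarify
  fix \<beta> m assume "(\<beta>, m) \<in> crossings x z" "(\<beta>, m) \<notin> crossings y z"
  then show "(\<beta>, m) \<in> crossings x y" using generic_cases[OF assms, of \<beta> m] by (auto simp: mem_crossings)
qed

text \<open>The action of \<open>w\<close> on hyperplanes: \<open>w\<close> maps \<open>\<langle>\<cdot>, \<beta>\<rangle> = m\<close> to the set of zeros of the transported
  equation.  The floor is exact on the extended group, where \<open>w 0\<close> is a coweight.\<close>

definition act :: "('a \<Rightarrow> 'a) \<Rightarrow> 'a \<times> int \<Rightarrow> 'a \<times> int" where
  "act w = (\<lambda>(\<beta>, m). (lin w \<beta>, m + \<lfloor>w 0 \<bullet> lin w \<beta>\<rfloor>))"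

lemma We_inner: "w \<in> We \<Longrightarrow> w x \<bullet> lin w \<beta> = x \<bullet> \<beta> + w 0 \<bullet> lin w \<beta>"
  by (subst We_parts(4)) (simp_all add: inner_add_left W0_isometry[OF We_parts(1)])

lemma We_inner_floor:
  assumes "w \<in> We" "\<beta> \<in> \<Phi>" shows "w x \<bullet> lin w \<beta> = x \<bullet> \<beta> + of_int \<lfloor>w 0 \<bullet> lin w \<beta>\<rfloor>"
proof -
  have "w 0 \<bullet> lin w \<beta> \<in> \<int>"
    using coweight_root_Ints[OF We_parts(2)[OF assms(1)] W0_root[OF We_parts(1)[OF assms(1)] assms(2)]] .
  then have "w 0 \<bullet> lin w \<beta> = of_int \<lfloor>w 0 \<bullet> lin w \<beta>\<rfloor>" by simp
  with We_inner[OF assms(1), of x \<beta>] show ?thesis by linarith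
qed

lemma crossings_act: assumes w: "w \<in> We" shows "bij_betw (act w) (crossings x y) (crossings (w x) (w y))"
proof -
  have b: "bij (lin w)" by (rule W0_bij[OF We_parts(1)[OF w]])
  have "inj_on (act w) (crossings x y)" using b by (auto simp: inj_on_def act_def bij_def inj_def)
  moreover have "act w ` crossings x y = crossings (w x) (w y)"
  proof (intro equalityI subsetI)
    fix c assume "c \<in> act w ` crossings x y"
    then obtain \<beta> m where bm: "(\<beta>, m) \<in> crossings x y" "c = act w (\<beta>, m)" by auto
    then have b: "\<beta> \<in> \<Phi>" by (simp add: mem_crossings)
    show "c \<in> crossings (w x) (w y)"
      using bm We_inner_floor[OF w b, of x] We_inner_floor[OF w b, of y] W0_root[OF We_parts(1)[OF w] b]
      by (simp add: act_def mem_crossings)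
  next
    fix c assume c: "c \<in> crossings (w x) (w y)"
    obtain \<gamma> k where ck: "c = (\<gamma>, k)" by force
    obtain \<beta> where g: "\<gamma> = lin w \<beta>" using bij_is_surj[OF b] by (rule surjE)
    have br: "\<beta> \<in> \<Phi>" using c W0_root_iff[OF We_parts(1)[OF w]] by (simp add: ck g mem_crossings)
    then have "(\<beta>, k - \<lfloor>w 0 \<bullet> lin w \<beta>\<rfloor>) \<in> crossings x y"
      using c We_inner_floor[OF w br, of x] We_inner_floor[OF w br, of y] by (simp add: ck g mem_crossings)
    then show "c \<in> act w ` crossings x y" by (rule image_eqI[rotated]) (simp add: act_def ck g)
  qed
  ultimately show ?thesis by (simp add: bij_betw_def)
qed

lemma fst_act: "fst (act w c) = lin w (fst c)" by (simp add: act_def split: prod.split)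

lemma generic_We: assumes w: "w \<in> We" and "generic x" shows "generic (w x)"
  unfolding generic_def
proof
  fix \<gamma> assume g: "\<gamma> \<in> \<Phi>"
  obtain \<beta> where b: "\<gamma> = lin w \<beta>" using bij_is_surj[OF W0_bij[OF We_parts(1)[OF w]]] by (rule surjE)
  have br: "\<beta> \<in> \<Phi>" using g W0_root_iff[OF We_parts(1)[OF w]] b by simp
  have "x \<bullet> \<beta> \<notin> \<int>" using assms(2) br by (simp add: generic_def)
  then show "w x \<bullet> \<gamma> \<notin> \<int>" unfolding b using We_inner_floor[OF w br, of x] by (metis Ints_diff Ints_of_int add_diff_cancel)
qed

text \<open>A point in the interior of the fundamental alcove: a multiple of the sum of the fundamental
  coweights, scaled so that its products with all roots stay below \<open>1\<close> in absolute value.\<close>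

definition base_point :: 'a where
  "base_point = (1 / (1 + (\<Sum>\<beta>\<in>\<Phi>. \<bar>height \<beta>\<bar>))) *\<^sub>R (\<Sum>i=1..DIM('a). \<omega> i)"

abbreviation p :: 'a where "p \<equiv> base_point"

lemma base_point_inner: "p \<bullet> \<beta> = height \<beta> / (1 + (\<Sum>\<beta>\<in>\<Phi>. \<bar>height \<beta>\<bar>))"
  by (simp add: base_point_def height_def)

lemma base_point_pos: assumes "\<beta> \<in> pos" shows "0 < p \<bullet> \<beta>" "p \<bullet> \<beta> < 1"
proof -
  have b: "\<beta> \<in> \<Phi>" using pos_rootD assms by blast
  have h: "1 \<le> height \<beta>" using height_pos[OF pos_rootD(2)[OF assms] root_nonzero[OF b]] .
  have le: "\<bar>height \<beta>\<bar> \<le> (\<Sum>\<beta>\<in>\<Phi>. \<bar>height \<beta>\<bar>)"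
    using member_le_sum[OF b, of "\<lambda>\<beta>. \<bar>height \<beta>\<bar>"] finite_roots by simp
  then show "0 < p \<bullet> \<beta>" "p \<bullet> \<beta> < 1" unfolding base_point_inner using h by (simp_all add: field_simps)
qed

lemma base_point_neg: assumes "- \<beta> \<in> pos" shows "- 1 < p \<bullet> \<beta>" "p \<bullet> \<beta> < 0"
  using base_point_pos[OF assms] by auto

lemma base_point_floor: "\<beta> \<in> pos \<Longrightarrow> \<lfloor>p \<bullet> \<beta>\<rfloor> = 0"
  using base_point_pos[of \<beta>] by (simp add: floor_eq_iff)

lemma generic_base_point: "generic p"
  unfolding generic_def
proof
  fix \<beta> assume "\<beta> \<in> \<Phi>"
  then consider "\<beta> \<in> pos" | "- \<beta> \<in> pos" using root_cases by blast
  then show "p \<bullet> \<beta> \<notin> \<int>"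
  proof cases
    case 1 then show ?thesis using base_point_pos[OF 1] by (auto elim!: Ints_cases)
  next
    case 2
    then show ?thesis using base_point_neg[OF 2] by (auto elim!: Ints_cases)
  qed
qed

lemma generic_orbit: "w \<in> We \<Longrightarrow> generic (w p)"
  by (rule generic_We[OF _ generic_base_point])

subsection \<open>Crossings of a simple reflection\<close>

text \<open>The walls of the fundamental alcove, written as \<open>\<langle>\<cdot>, wall_root i\<rangle> = wall_level i\<close> and oriented outwards;
  \<open>s i\<close> is the reflection in the \<open>i\<close>-th wall.\<close>

definition wall_root :: "nat \<Rightarrow> 'a" where "wall_root i = (if i = 0 then \<theta> else - \<alpha> i)"
definition wall_level :: "nat \<Rightarrow> int" where "wall_level i = (if i = 0 then 1 else 0)"

lemma no_integer_between:
  assumes "0 < (x::real)" "x < 1" "0 < y" "y < (1::real)" "x < of_int m" "of_int m < y" shows False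
proof -
  have "0 < real_of_int m" "real_of_int m < 1" using assms by linarith+
  then show False by simp
qed

text \<open>A simple reflection permutes the positive roots off its own line, so the products of \<open>p\<close> and its
  image with these roots stay in the same unit interval; only the line of \<open>\<alpha> i\<close> contributes.\<close>

lemma crossings_node:
  assumes i: "i \<in> {1..DIM('a)}"
  shows "crossings p (s i p) = {(c *\<^sub>R wall_root i, 0) | c. c \<in> {1, 2} \<and> c *\<^sub>R wall_root i \<in> \<Phi>}"
proof (intro equalityI subsetI)
  have i0: "i \<noteq> 0" using i by auto
  have inn: "s i p \<bullet> \<beta> = p \<bullet> refl (\<alpha> i) \<beta>" for \<beta>
    by (simp add: gen_refl_node[OF i] refl_adjoint)
  have neg: "refl (\<alpha> i) (c *\<^sub>R \<alpha> i) = - (c *\<^sub>R \<alpha> i)" for c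
    using refl_self[OF root_nonzero[OF simple_root[OF i]]] by (simp add: linear_cmul[OF refl_linear])
  {
    fix x assume x: "x \<in> crossings p (s i p)"
    obtain \<beta> m where xb: "x = (\<beta>, m)" by force
    have b: "\<beta> \<in> \<Phi>" "p \<bullet> \<beta> < of_int m" "of_int m < p \<bullet> refl (\<alpha> i) \<beta>"
      using x unfolding xb mem_crossings inn by auto
    show "x \<in> {(c *\<^sub>R wall_root i, 0) | c. c \<in> {1, 2} \<and> c *\<^sub>R wall_root i \<in> \<Phi>}"
    proof (cases "\<exists>c. \<beta> = c *\<^sub>R \<alpha> i")
      case True
      then obtain c where c: "\<beta> = c *\<^sub>R \<alpha> i" by blast
      then have r: "refl (\<alpha> i) \<beta> = - \<beta>" using neg by simp
      have "p \<bullet> \<beta> < 0" using b r by simp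
      then have c0: "c < 0" unfolding c using base_point_pos(1)[OF simple_pos[OF i]] by (simp add: mult_less_0_iff)
      have "(- c) *\<^sub>R \<alpha> i \<in> \<Phi>" using root_minus[OF b(1)] c by simp
      then have "- c \<in> {1, 2}" using simple_multiple_root[OF i, of "- c"] c0 by auto
      moreover have "m = 0"
      proof -
        have "- \<beta> \<in> pos" using root_cases[OF b(1)] base_point_pos(1)[of \<beta>] \<open>p \<bullet> \<beta> < 0\<close> by auto
        from base_point_neg[OF this] base_point_pos[OF this] show ?thesis using b(2,3) r by simp
      qed
      moreover have "\<beta> = (- c) *\<^sub>R wall_root i" using c i0 by (simp add: wall_root_def)
      ultimately show ?thesis unfolding xb using b(1) by (intro CollectI exI[of _ "- c"]) simp
    next
      case False
      then have n1: "\<beta> \<noteq> c *\<^sub>R \<alpha> i" and n2: "- \<beta> \<noteq> c *\<^sub>R \<alpha> i" for c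
        by (blast, metis add.inverse_inverse scaleR_minus_left)
      have "False"
      proof (cases "\<beta> \<in> pos")
        case True
        have "refl (\<alpha> i) \<beta> \<in> pos" by (rule refl_simple_pos[OF i True n1])
        then show False using b no_integer_between[OF base_point_pos[OF True] base_point_pos[of "refl (\<alpha> i) \<beta>"], of m] by blast
      next
        case False
        then have m: "- \<beta> \<in> pos" using root_cases b by blast
        have "- refl (\<alpha> i) \<beta> \<in> pos" using refl_simple_pos[OF i m n2] linear_neg[OF refl_linear] by simp
        from no_integer_between[OF base_point_pos[OF this] base_point_pos[OF m], of "- m"] show False using b by simp
      qed
      then show ?thesis ..
    qed
  next
    fix x assume "x \<in> {(c *\<^sub>R wall_root i, 0::int) | c. c \<in> {1, 2} \<and> c *\<^sub>R wall_root i \<in> \<Phi>}"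
    then obtain c where c: "x = (- (c *\<^sub>R \<alpha> i), 0)" "c = 1 \<or> c = 2" "- (c *\<^sub>R \<alpha> i) \<in> \<Phi>"
      using i0 by (auto simp: wall_root_def)
    have "0 < c * (p \<bullet> \<alpha> i)" using base_point_pos(1)[OF simple_pos[OF i]] c(2) by auto
    then show "x \<in> crossings p (s i p)"
      using c refl_self[OF root_nonzero[OF simple_root[OF i]]]
      by (simp add: mem_crossings inn linear_neg[OF refl_linear] linear_cmul[OF refl_linear])
  }
qed

text \<open>For \<open>\<beta> \<noteq> \<theta>\<close> positive, the product of \<open>s 0 p\<close> with \<open>\<beta>\<close> is that of \<open>p\<close> with \<open>\<beta>\<close>, or \<open>1\<close> minus that of \<open>p\<close> with
  the positive root \<open>\<theta> - \<beta>\<close>, according to the two possible Cartan integers.\<close>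

lemma crossings_affine: "crossings p (s 0 p) = {(\<theta>, 1)}"
proof -
  have inn: "s 0 p \<bullet> \<beta> = p \<bullet> \<beta> - (p \<bullet> \<theta> - 1) * (\<beta> \<bullet> coroot \<theta>)" for \<beta>
    by (simp add: gen_refl_def aff_refl_def inner_diff_left inner_commute[of \<beta>])
  have tz: "\<theta> \<noteq> 0" using root_nonzero highest_root(1) by blast
  have t: "0 < p \<bullet> \<theta>" "p \<bullet> \<theta> < 1" using base_point_pos[OF highest_root_pos] by auto
  have other: "0 < s 0 p \<bullet> \<beta> \<and> s 0 p \<bullet> \<beta> < 1" if b: "\<beta> \<in> pos" "\<beta> \<noteq> \<theta>" for \<beta>
    using highest_root_cartan[OF b]
  proof
    assume "\<beta> \<bullet> coroot \<theta> = 0" then show ?thesis using inn base_point_pos[OF b(1)] by simp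
  next
    assume k: "\<beta> \<bullet> coroot \<theta> = 1"
    have "\<theta> - \<beta> \<in> \<Phi>" using root_minus[OF refl_root[OF highest_root(1) pos_rootD(1)[OF b(1)]]] k by (simp add: refl_alt)
    then have "\<theta> - \<beta> \<in> pos" using highest_root(2) pos_rootD[OF b(1)] by (auto simp: pos_roots_def)
    from base_point_pos[OF this] show ?thesis using inn[of \<beta>] k by (simp add: inner_diff_right)
  qed
  have top: "s 0 p \<bullet> \<theta> = 2 - p \<bullet> \<theta>" using inn[of \<theta>] coroot_inner_self[OF tz] by (simp add: algebra_simps)
  show ?thesis
  proof (intro equalityI subsetI)
    fix x assume x: "x \<in> crossings p (s 0 p)"
    obtain \<beta> m where xb: "x = (\<beta>, m)" by force
    have b: "\<beta> \<in> \<Phi>" "p \<bullet> \<beta> < of_int m" "of_int m < s 0 p \<bullet> \<beta>"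
      using x unfolding xb mem_crossings by auto
    have "\<beta> = \<theta>"
    proof (rule ccontr)
      assume ne: "\<beta> \<noteq> \<theta>"
      show False
      proof (cases "\<beta> \<in> pos")
        case True then show False using other[OF True ne] no_integer_between[OF base_point_pos[OF True], of "s 0 p \<bullet> \<beta>" m] b by blast
      next
        case False
        then have m: "- \<beta> \<in> pos" using root_cases b by blast
        show False
        proof (cases "- \<beta> = \<theta>")
          case True
          have "\<beta> = - \<theta>" unfolding True[symmetric] by simp
          then have "s 0 p \<bullet> \<beta> = p \<bullet> \<theta> - 2" "p \<bullet> \<beta> = - (p \<bullet> \<theta>)" using top by simp_all
          then show False using b t by linarith
        next
          case False
          from other[OF m this] base_point_pos[OF m] show False using b
            no_integer_between[of "s 0 p \<bullet> (- \<beta>)" "p \<bullet> (- \<beta>)" "- m"] by simp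
        qed
      qed
    qed
    moreover have "m = 1" using b t top unfolding \<open>\<beta> = \<theta>\<close> by linarith
    ultimately show "x \<in> {(\<theta>, 1)}" by (simp add: xb)
  next
    fix x assume "x \<in> {(\<theta>, 1::int)}"
    then show "x \<in> crossings p (s 0 p)" using t top highest_root(1) by (simp add: mem_crossings)
  qed
qed

lemma wall_root: "i \<in> {0..DIM('a)} \<Longrightarrow> wall_root i \<in> \<Phi>"
  using highest_root(1) root_minus simple_root[of i] by (auto simp: wall_root_def)

text \<open>A generator crosses one hyperplane; it shows up as two pairs exactly when the double of its root is
  again a root.\<close>

lemma crossings_generator:
  assumes i: "i \<in> {0..DIM('a)}"
  shows "crossings p (s i p) = {(c *\<^sub>R wall_root i, \<lfloor>c\<rfloor> * wall_level i) | c. c \<in> {1, 2} \<and> c *\<^sub>R wall_root i \<in> \<Phi>}"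
proof (cases "i = 0")
  case True
  show ?thesis unfolding True crossings_affine using double_highest_root highest_root(1)
    by (auto simp: wall_root_def wall_level_def intro!: exI[of _ "1::real"])
next
  case False
  then have "i \<in> {1..DIM('a)}" using i by auto
  from crossings_node[OF this] show ?thesis using False by (simp add: wall_level_def)
qed

lemma wall_crossing: "i \<in> {0..DIM('a)} \<Longrightarrow> (wall_root i, wall_level i) \<in> crossings p (s i p)"
  unfolding crossings_generator using wall_root by (auto intro!: exI[of _ 1])

lemma single_hyperplane:
  assumes w: "w \<in> We" and i: "i \<in> {0..DIM('a)}"
  obtains \<beta> m where "(\<beta>, m) \<in> crossings (w p) (w (s i p))"
    "\<And>\<gamma> k. (\<gamma>, k) \<in> crossings (w p) (w (s i p)) \<Longrightarrow> \<exists>c>0. \<gamma> = c *\<^sub>R \<beta> \<and> of_int k = c * of_int m"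
proof -
  define \<beta>0 where "\<beta>0 = wall_root i"
  define \<beta> where "\<beta> = lin w \<beta>0"
  define m where "m = wall_level i + \<lfloor>w 0 \<bullet> \<beta>\<rfloor>"
  have b: "\<beta> \<in> \<Phi>" unfolding \<beta>_def \<beta>0_def by (rule W0_root[OF We_parts(1)[OF w] wall_root[OF i]])
  have fl: "of_int \<lfloor>w 0 \<bullet> \<beta>\<rfloor> = w 0 \<bullet> \<beta>" using coweight_root_Ints[OF We_parts(2)[OF w] b] by auto
  have im: "crossings (w p) (w (s i p)) = act w ` crossings p (s i p)"
    using crossings_act[OF w] by (simp add: bij_betw_def)
  have "(\<beta>, m) \<in> crossings (w p) (w (s i p))"
    unfolding im by (rule image_eqI[OF _ wall_crossing[OF i]]) (simp add: act_def \<beta>_def \<beta>0_def m_def)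
  moreover have "\<exists>c>0. \<gamma> = c *\<^sub>R \<beta> \<and> of_int k = c * of_int m" if gk: "(\<gamma>, k) \<in> crossings (w p) (w (s i p))" for \<gamma> k
  proof -
    obtain c where c: "c \<in> {1, 2}" "(\<gamma>, k) = act w (c *\<^sub>R \<beta>0, \<lfloor>c\<rfloor> * wall_level i)"
      using gk unfolding im crossings_generator[OF i] \<beta>0_def[symmetric] by blast
    have g: "\<gamma> = c *\<^sub>R \<beta>" "k = \<lfloor>c\<rfloor> * wall_level i + \<lfloor>w 0 \<bullet> (c *\<^sub>R \<beta>)\<rfloor>"
      using c(2) by (simp_all add: act_def \<beta>_def linear_cmul[OF W0_linear[OF We_parts(1)[OF w]]])
    have "c \<in> \<int>" using c(1) by auto
    then have "c * (w 0 \<bullet> \<beta>) \<in> \<int>" using coweight_root_Ints[OF We_parts(2)[OF w] b] by (rule Ints_mult)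
    then have "of_int \<lfloor>w 0 \<bullet> (c *\<^sub>R \<beta>)\<rfloor> = c * (w 0 \<bullet> \<beta>)" by (auto elim!: Ints_cases)
    then have "of_int k = c * of_int m" unfolding g m_def using c(1) fl by (auto simp: algebra_simps)
    then show ?thesis using g c(1) by (intro exI[of _ c]) auto
  qed
  ultimately show ?thesis by (rule that)
qed

text \<open>Right multiplication by a generator crosses a single wall of the alcove of \<open>w\<close>, so it either extends
  the set of hyperplanes separating from the base alcove or shrinks it.\<close>

lemma right_step:
  assumes w: "w \<in> We" and i: "i \<in> {0..DIM('a)}"
  defines "y \<equiv> w p" and "z \<equiv> w (s i p)"
  shows "(crossings p z = crossings p y \<union> crossings y z \<and> crossings p y \<inter> crossings y z = {}) \<or>
         (crossings p y = crossings p z \<union> crossings z y \<and> crossings p z \<inter> crossings z y = {})"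
proof -
  obtain \<beta> m where bm: "(\<beta>, m) \<in> crossings y z"
    and all: "\<And>\<gamma> k. (\<gamma>, k) \<in> crossings y z \<Longrightarrow> \<exists>c>0. \<gamma> = c *\<^sub>R \<beta> \<and> of_int k = c * of_int m"
    by (rule single_hyperplane[OF w i, folded y_def z_def]) blast
  have gy: "generic y" unfolding y_def by (rule generic_orbit[OF w])
  have "w \<circ> s i \<in> We" using We_comp[OF w s_We[OF i]] .
  then have gz: "generic z" using generic_orbit unfolding z_def by fastforce
  have br: "\<beta> \<in> \<Phi>" using bm by (simp add: mem_crossings)
  show ?thesis
  proof (cases "p \<bullet> \<beta> < of_int m")
    case True
    have "p \<bullet> \<gamma> < of_int k" if "(\<gamma>, k) \<in> crossings y z" for \<gamma> k
      using all[OF that] True by auto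
    then show ?thesis using crossings_concat[OF gy gz] by blast
  next
    case False
    then have gt: "of_int m < p \<bullet> \<beta>" using generic_cases[OF generic_base_point br, of m] by blast
    have "p \<bullet> \<gamma> < of_int k" if "(\<gamma>, k) \<in> crossings z y" for \<gamma> k
    proof -
      have "(- \<gamma>, - k) \<in> crossings y z" using that by (auto simp: mem_crossings root_minus)
      from all[OF this] obtain c where c: "c > 0" "- \<gamma> = c *\<^sub>R \<beta>" "of_int (- k) = c * of_int m" by blast
      have "p \<bullet> (- \<gamma>) > of_int (- k)" unfolding c(2,3) using c(1) gt by simp
      then show ?thesis by simp
    qed
    then show ?thesis using crossings_concat[OF gz gy] by blast
  qed
qed

subsection \<open>Counting hyperplanes\<close>

text \<open>If \<open>2 \<beta>\<close> is a root then the hyperplanes of \<open>\<beta>\<close> are also hyperplanes of \<open>2 \<beta>\<close>, so every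
  hyperplane is counted once by the pairs whose root cannot be doubled.\<close>

definition num_hyperplanes :: "'a \<Rightarrow> 'a \<Rightarrow> nat" where
  "num_hyperplanes x y = card {c \<in> crossings x y. 2 *\<^sub>R fst c \<notin> \<Phi>}"

lemma bij_betw_filter:
  assumes "bij_betw f S T" and "\<And>c. c \<in> S \<Longrightarrow> A c = B (f c)"
  shows "bij_betw f {c \<in> S. A c} {c \<in> T. B c}"
proof -
  have "inj_on f {c \<in> S. A c}" using assms(1) by (auto simp: bij_betw_def inj_on_def)
  moreover have "f ` {c \<in> S. A c} = {c \<in> T. B c}" using assms by (auto simp: bij_betw_def)
  ultimately show ?thesis by (simp add: bij_betw_def)
qed

lemma num_hyperplanes_act: assumes w: "w \<in> We" shows "num_hyperplanes (w x) (w y) = num_hyperplanes x y"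
proof -
  have "2 *\<^sub>R lin w \<beta> \<in> \<Phi> \<longleftrightarrow> 2 *\<^sub>R \<beta> \<in> \<Phi>" for \<beta>
    using W0_root_iff[OF We_parts(1)[OF w], of "2 *\<^sub>R \<beta>"] linear_cmul[OF W0_linear[OF We_parts(1)[OF w]]] by simp
  then have "bij_betw (act w) {c \<in> crossings x y. 2 *\<^sub>R fst c \<notin> \<Phi>} {c \<in> crossings (w x) (w y). 2 *\<^sub>R fst c \<notin> \<Phi>}"
    by (intro bij_betw_filter[OF crossings_act[OF w]]) (simp add: fst_act)
  then show ?thesis unfolding num_hyperplanes_def by (simp add: bij_betw_same_card)
qed

lemma num_hyperplanes_swap: "num_hyperplanes y x = num_hyperplanes x y"
proof -
  have *: "2 *\<^sub>R (- \<beta>) \<in> \<Phi> \<longleftrightarrow> 2 *\<^sub>R \<beta> \<in> \<Phi>" for \<beta>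
    using root_minus[of "2 *\<^sub>R \<beta>"] root_minus[of "- (2 *\<^sub>R \<beta>)"] by auto
  have "bij_betw (\<lambda>(\<beta>, m). (- \<beta>, - m)) {c \<in> crossings x y. 2 *\<^sub>R fst c \<notin> \<Phi>} {c \<in> crossings y x. 2 *\<^sub>R fst c \<notin> \<Phi>}"
  proof (rule bij_betw_filter[OF crossings_swap])
    fix c :: "'a \<times> int"
    show "(2 *\<^sub>R fst c \<notin> \<Phi>) = (2 *\<^sub>R fst (case c of (\<beta>, m) \<Rightarrow> (- \<beta>, - m)) \<notin> \<Phi>)"
      using *[of "fst c"] by (simp add: case_prod_beta)
  qed
  then show ?thesis unfolding num_hyperplanes_def by (simp add: bij_betw_same_card)
qed

lemma num_hyperplanes_union:
  assumes "crossings x z = crossings x y \<union> crossings y z" "crossings x y \<inter> crossings y z = {}"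
  shows "num_hyperplanes x z = num_hyperplanes x y + num_hyperplanes y z"
proof -
  have "{c \<in> crossings x z. 2 *\<^sub>R fst c \<notin> \<Phi>} = {c \<in> crossings x y. 2 *\<^sub>R fst c \<notin> \<Phi>} \<union> {c \<in> crossings y z. 2 *\<^sub>R fst c \<notin> \<Phi>}"
    using assms by auto
  then show ?thesis unfolding num_hyperplanes_def using assms(2)
    by (simp only:) (rule card_Un_disjoint, auto intro: finite_subset[OF _ finite_crossings])
qed

lemma num_hyperplanes_triangle:
  assumes "generic y" shows "num_hyperplanes x z \<le> num_hyperplanes x y + num_hyperplanes y z"
proof -
  have "{c \<in> crossings x z. 2 *\<^sub>R fst c \<notin> \<Phi>} \<subseteq> {c \<in> crossings x y. 2 *\<^sub>R fst c \<notin> \<Phi>} \<union> {c \<in> crossings y z. 2 *\<^sub>R fst c \<notin> \<Phi>}"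
    using crossings_triangle[OF assms] by blast
  then have "num_hyperplanes x z \<le> card ({c \<in> crossings x y. 2 *\<^sub>R fst c \<notin> \<Phi>} \<union> {c \<in> crossings y z. 2 *\<^sub>R fst c \<notin> \<Phi>})"
    unfolding num_hyperplanes_def by (rule card_mono[rotated]) (auto intro: finite_subset[OF _ finite_crossings])
  also have "\<dots> \<le> num_hyperplanes x y + num_hyperplanes y z" unfolding num_hyperplanes_def by (rule card_Un_le)
  finally show ?thesis .
qed

lemma not_quadruple_root: assumes "\<beta> \<in> \<Phi>" shows "4 *\<^sub>R \<beta> \<notin> \<Phi>"
proof
  assume "4 *\<^sub>R \<beta> \<in> \<Phi>"
  from cartan_Ints[OF this assms] have "(1/2::real) \<in> \<int>" using root_nonzero[OF assms] by (simp add: coroot_def)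
  then obtain k :: int where "(1/2::real) = of_int k" by (auto elim: Ints_cases)
  then have "(1::real) = of_int (2 * k)" by simp
  then have "1 = 2 * k" by linarith
  then show False by presburger
qed

lemma num_hyperplanes_0_iff: "num_hyperplanes x y = 0 \<longleftrightarrow> crossings x y = {}"
proof
  assume z: "num_hyperplanes x y = 0"
  have "finite {c \<in> crossings x y. 2 *\<^sub>R fst c \<notin> \<Phi>}" by (auto intro: finite_subset[OF _ finite_crossings])
  then have e: "2 *\<^sub>R \<beta> \<in> \<Phi>" if "(\<beta>, m) \<in> crossings x y" for \<beta> m using z that unfolding num_hyperplanes_def by auto
  show "crossings x y = {}"
  proof (rule ccontr)
    assume "crossings x y \<noteq> {}"
    then obtain \<beta> m where c: "(\<beta>, m) \<in> crossings x y" by auto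
    have "(2 *\<^sub>R \<beta>, 2 * m) \<in> crossings x y" using e[OF c] c by (auto simp: mem_crossings)
    from e[OF this] have "4 *\<^sub>R \<beta> \<in> \<Phi>" by simp
    then show False using not_quadruple_root c by (auto simp: mem_crossings)
  qed
qed (simp add: num_hyperplanes_def)

lemma num_hyperplanes_generator:
  assumes i: "i \<in> {0..DIM('a)}" shows "num_hyperplanes p (s i p) = 1"
proof -
  let ?b = "if 2 *\<^sub>R wall_root i \<in> \<Phi> then (2 *\<^sub>R wall_root i, 2 * wall_level i) else (wall_root i, wall_level i)"
  have "{c \<in> crossings p (s i p). 2 *\<^sub>R fst c \<notin> \<Phi>} = {?b}"
    unfolding crossings_generator[OF i] using not_quadruple_root[OF wall_root[OF i]] wall_root[OF i]
    by (auto intro: exI[of _ 1] exI[of _ 2])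
  then show ?thesis unfolding num_hyperplanes_def by simp
qed


subsection \<open>Alcoves\<close>

text \<open>The closed alcove around a generic point: the intersection of all half-spaces bounded by root
  hyperplanes that contain the point in their interior.\<close>

definition alcove :: "'a \<Rightarrow> 'a set" where
  "alcove x = {y. \<forall>\<beta>\<in>\<Phi>. \<forall>m::int. x \<bullet> \<beta> < of_int m \<longrightarrow> y \<bullet> \<beta> \<le> of_int m}"

lemma mem_alcoveD: "y \<in> alcove x \<Longrightarrow> \<beta> \<in> \<Phi> \<Longrightarrow> x \<bullet> \<beta> < of_int m \<Longrightarrow> y \<bullet> \<beta> \<le> of_int m"
  by (auto simp: alcove_def)

lemma alcove_self: "x \<in> alcove x"
  by (auto simp: alcove_def)

lemma fund_alcove_eq: "fund_alcove \<Phi> \<alpha> = alcove p"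
proof (intro equalityI subsetI)
  fix y assume y: "y \<in> fund_alcove \<Phi> \<alpha>"
  show "y \<in> alcove p" unfolding alcove_def
  proof (intro CollectI ballI allI impI)
    fix \<beta> and m :: int assume b: "\<beta> \<in> \<Phi>" "p \<bullet> \<beta> < of_int m"
    show "y \<bullet> \<beta> \<le> of_int m"
    proof (cases "\<beta> \<in> pos")
      case True
      then have "0 < real_of_int m" using base_point_pos(1)[OF True] b by linarith
      then have "1 \<le> real_of_int m" by simp
      then show ?thesis using y True by (force simp: fund_alcove_def)
    next
      case False
      then have m: "- \<beta> \<in> pos" using root_cases b by blast
      have "- 1 < real_of_int m" using base_point_neg(1)[OF m] b by linarith
      then have "0 \<le> real_of_int m" by simp
      moreover have "0 \<le> y \<bullet> (- \<beta>)" using y m by (auto simp: fund_alcove_def simp del: inner_minus_right)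
      ultimately show ?thesis by simp
    qed
  qed
next
  fix y assume y: "y \<in> alcove p"
  show "y \<in> fund_alcove \<Phi> \<alpha>" unfolding fund_alcove_def
  proof (intro CollectI ballI conjI)
    fix \<beta> assume b: "\<beta> \<in> pos"
    show "y \<bullet> \<beta> \<le> 1" using mem_alcoveD[OF y pos_rootD(1)[OF b], of 1] base_point_pos[OF b] by simp
    show "0 \<le> y \<bullet> \<beta>" using mem_alcoveD[OF y root_minus[OF pos_rootD(1)[OF b]], of 0] base_point_pos[OF b] by simp
  qed
qed

lemma alcove_We_subset: assumes w: "w \<in> We" shows "w ` alcove x \<subseteq> alcove (w x)"
proof
  fix z assume "z \<in> w ` alcove x"
  then obtain y where y: "y \<in> alcove x" "z = w y" by blast
  show "z \<in> alcove (w x)" unfolding alcove_def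
  proof (intro CollectI ballI allI impI)
    fix \<gamma> and k :: int assume g: "\<gamma> \<in> \<Phi>" "w x \<bullet> \<gamma> < of_int k"
    obtain \<beta> where b: "\<gamma> = lin w \<beta>" using bij_is_surj[OF W0_bij[OF We_parts(1)[OF w]]] by (rule surjE)
    have br: "\<beta> \<in> \<Phi>" using g W0_root_iff[OF We_parts(1)[OF w]] b by simp
    have "x \<bullet> \<beta> < of_int (k - \<lfloor>w 0 \<bullet> lin w \<beta>\<rfloor>)" using g(2) We_inner_floor[OF w br, of x] b by simp
    then have "y \<bullet> \<beta> \<le> of_int (k - \<lfloor>w 0 \<bullet> lin w \<beta>\<rfloor>)" by (rule mem_alcoveD[OF y(1) br])
    then show "z \<bullet> \<gamma> \<le> of_int k" using We_inner_floor[OF w br, of y] b y(2) by simp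
  qed
qed

lemma alcove_We: assumes w: "w \<in> We" shows "w ` alcove x = alcove (w x)"
proof
  show "w ` alcove x \<subseteq> alcove (w x)" by (rule alcove_We_subset[OF w])
  obtain u where u: "u \<in> We" "u \<circ> w = id" "w \<circ> u = id" using We_inverse[OF w] by blast
  have uw: "u (w x) = x" and wu: "w (u y) = y" for y using u by (metis comp_apply id_apply)+
  have "u ` alcove (w x) \<subseteq> alcove x" using alcove_We_subset[OF u(1), of "w x"] uw by simp
  then have "w ` u ` alcove (w x) \<subseteq> w ` alcove x" by (rule image_mono)
  then show "alcove (w x) \<subseteq> w ` alcove x" by (simp add: image_image wu)
qed

lemma alcove_below:
  assumes "generic x" "\<beta> \<in> \<Phi>"
  shows "alcove x \<subseteq> {y. y \<bullet> \<beta> \<le> of_int m} \<longleftrightarrow> x \<bullet> \<beta> < of_int m"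
  using alcove_self[of x] genericD[OF assms, of m] mem_alcoveD[OF _ assms(2), of _ x m] by force

lemma alcove_above:
  assumes "generic x" "\<beta> \<in> \<Phi>"
  shows "alcove x \<subseteq> {y. y \<bullet> \<beta> \<ge> of_int m} \<longleftrightarrow> of_int m < x \<bullet> \<beta>"
  using alcove_below[OF assms(1) root_minus[OF assms(2)], of "- m"] by simp

text \<open>Two generic points span the same closed alcove if and only if no hyperplane separates them.  This
  and the next lemmas translate conditions on alcoves into conditions on crossings.\<close>

lemma alcove_eq_iff:
  assumes "generic x" "generic y" shows "alcove x = alcove y \<longleftrightarrow> crossings x y = {}"
proof
  assume eq: "alcove x = alcove y"
  show "crossings x y = {}"
  proof (rule ccontr)
    assume "crossings x y \<noteq> {}"
    then obtain \<beta> m where c: "(\<beta>, m) \<in> crossings x y" by auto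
    then have "y \<bullet> \<beta> \<le> of_int m" using mem_alcoveD[of y x \<beta> m] eq alcove_self[of y] by (auto simp: mem_crossings)
    then show False using c by (auto simp: mem_crossings)
  qed
next
  assume e: "crossings x y = {}"
  have "x \<bullet> \<beta> < of_int m \<longleftrightarrow> y \<bullet> \<beta> < of_int m" if b: "\<beta> \<in> \<Phi>" for \<beta> m
  proof -
    have "(\<beta>, m) \<notin> crossings x y" "(- \<beta>, - m) \<notin> crossings x y" using e by auto
    then show ?thesis
      using generic_cases[OF assms(1) b, of m] generic_cases[OF assms(2) b, of m] b root_minus[OF b]
      by (auto simp: mem_crossings)
  qed
  then show "alcove x = alcove y" unfolding alcove_def by auto
qed

lemma alcove_stab_iff: "\<sigma> \<in> alcove_stab \<Phi> \<alpha> \<longleftrightarrow> \<sigma> \<in> We \<and> crossings p (\<sigma> p) = {}"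
proof -
  have "\<sigma> ` alcove p = alcove p \<longleftrightarrow> crossings p (\<sigma> p) = {}" if "\<sigma> \<in> We"
    unfolding alcove_We[OF that] alcove_eq_iff[OF generic_base_point generic_orbit[OF that], symmetric] by (rule eq_commute)
  then show ?thesis unfolding alcove_stab_def fund_alcove_eq by blast
qed

lemma crossing_sign_eq:
  assumes u: "u \<in> We" and i: "i \<in> {0..DIM('a)}"
  shows "crossing_sign \<Phi> \<alpha> u i =
    (if \<exists>\<beta>\<in>pos. \<exists>m. (\<beta>, m) \<in> crossings (u p) (u (s i p)) then 1 else - 1)"
proof -
  have us: "u \<circ> s i \<in> We" by (rule We_comp[OF u s_We[OF i]])
  have "(u ` fund_alcove \<Phi> \<alpha> \<subseteq> {x. x \<bullet> \<beta> \<le> of_int m} \<and> (u \<circ> s i) ` fund_alcove \<Phi> \<alpha> \<subseteq> {x. x \<bullet> \<beta> \<ge> of_int m})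
     \<longleftrightarrow> (\<beta>, m) \<in> crossings (u p) (u (s i p))" if "\<beta> \<in> pos" for \<beta> m
    unfolding fund_alcove_eq alcove_We[OF u] alcove_We[OF us] mem_crossings
    using alcove_below[OF generic_orbit[OF u] pos_rootD(1)[OF that]]
      alcove_above[OF generic_orbit[OF us] pos_rootD(1)[OF that]] pos_rootD(1)[OF that] by simp
  then show ?thesis unfolding crossing_sign_def by (simp cong: bex_cong)
qed

subsection \<open>The length counts hyperplanes\<close>

text \<open>Each letter of a word adds at most one hyperplane, so the number of hyperplanes is a lower bound for
  the length of every expression.\<close>

lemma word_num_hyperplanes:
  assumes "set is \<subseteq> {0..DIM('a)}" "\<sigma> \<in> alcove_stab \<Phi> \<alpha>"
  shows "num_hyperplanes p (word_map \<Phi> \<alpha> is (\<sigma> p)) \<le> length is"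
  using assms(1)
proof (induction "is")
  case Nil
  have "num_hyperplanes p (\<sigma> p) = 0" using assms(2) by (simp add: alcove_stab_iff num_hyperplanes_0_iff)
  then show ?case unfolding word_map_simps by simp
next
  case (Cons i "is")
  have i: "i \<in> {0..DIM('a)}" and "is": "set is \<subseteq> {0..DIM('a)}" using Cons.prems by auto
  let ?w = "word_map \<Phi> \<alpha> is (\<sigma> p)"
  have "num_hyperplanes p (s i ?w) \<le> num_hyperplanes p (s i p) + num_hyperplanes (s i p) (s i ?w)"
    by (rule num_hyperplanes_triangle[OF generic_orbit[OF s_We[OF i]]])
  also have "\<dots> \<le> length (i # is)"
    using Cons.IH[OF "is"] num_hyperplanes_generator[OF i] num_hyperplanes_act[OF s_We[OF i]] by simp
  finally show ?case unfolding word_map_simps by simp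
qed

text \<open>If no wall of the base alcove separated it from \<open>w p\<close>, then \<open>w p\<close> would have positive products with
  the simple roots and product less than \<open>1\<close> with the highest root, hence lie in the same alcove.  Applying
  the reflection in a separating wall removes just this wall from the crossings.\<close>

lemma left_descent:
  assumes w: "w \<in> We" and c: "crossings p (w p) \<noteq> {}"
  shows "\<exists>i\<in>{0..DIM('a)}. num_hyperplanes p (w p) = Suc (num_hyperplanes p (s i (w p)))"
proof -
  have "\<exists>i\<in>{0..DIM('a)}. (wall_root i, wall_level i) \<in> crossings p (w p)"
  proof (rule ccontr)
    assume n: "\<not> ?thesis"
    have g: "generic (w p)" by (rule generic_orbit[OF w])
    have n0: "(\<theta>, 1) \<notin> crossings p (w p)" using n by (force simp: wall_root_def wall_level_def)
    have top: "w p \<bullet> \<theta> < 1"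
      using n0 generic_cases[OF g highest_root(1), of 1] base_point_pos(2)[OF highest_root_pos] highest_root(1)
      by (auto simp: mem_crossings)
    have simp_pos: "0 < w p \<bullet> \<alpha> i" if i: "i \<in> {1..DIM('a)}" for i
    proof -
      have "(- \<alpha> i, 0) \<notin> crossings p (w p)" using n i by (force simp: wall_root_def wall_level_def)
      then show ?thesis
        using generic_cases[OF g simple_root[OF i], of 0] base_point_pos(1)[OF simple_pos[OF i]] root_minus[OF simple_root[OF i]]
        by (auto simp: mem_crossings)
    qed
    have cone: "0 \<le> w p \<bullet> x" if "x \<in> pos_cone \<alpha>" for x
    proof -
      have "0 \<le> x \<bullet> w p" unfolding inner_via_coordinates[of x]
        by (intro sum_nonneg mult_nonneg_nonneg pos_cone_nonneg[OF that])
          (simp_all only: inner_commute[of "\<alpha> _"] less_imp_le[OF simp_pos])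
      then show ?thesis by (simp add: inner_commute)
    qed
    have in01: "0 < w p \<bullet> \<beta> \<and> w p \<bullet> \<beta> < 1" if b: "\<beta> \<in> pos" for \<beta>
    proof
      show "0 < w p \<bullet> \<beta>" using cone[OF pos_rootD(2)[OF b]] genericD[OF g pos_rootD(1)[OF b], of 0] by simp
      show "w p \<bullet> \<beta> < 1" using cone[OF highest_root(2)[OF pos_rootD(1)[OF b]]] top by (simp add: inner_diff_right)
    qed
    obtain \<beta> m where bm: "(\<beta>, m) \<in> crossings p (w p)" using c by auto
    show False
    proof (cases "\<beta> \<in> pos")
      case True
      then show False using bm in01[OF True] no_integer_between[OF base_point_pos[OF True], of "w p \<bullet> \<beta>" m]
        by (auto simp: mem_crossings)
    next
      case False
      then have m: "- \<beta> \<in> pos" using bm root_cases by (auto simp: mem_crossings)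
      show False using bm in01[OF m] base_point_pos[OF m]
          no_integer_between[of "w p \<bullet> (- \<beta>)" "p \<bullet> (- \<beta>)" "- m"] by (auto simp: mem_crossings)
    qed
  qed
  then obtain i where i: "i \<in> {0..DIM('a)}" and b: "(wall_root i, wall_level i) \<in> crossings p (w p)" by blast
  have "crossings p (s i p) \<subseteq> crossings p (w p)"
  proof
    fix x assume "x \<in> crossings p (s i p)"
    then obtain c where cc: "x = (c *\<^sub>R wall_root i, \<lfloor>c\<rfloor> * wall_level i)" "c = 1 \<or> c = 2" "c *\<^sub>R wall_root i \<in> \<Phi>"
      unfolding crossings_generator[OF i] by blast
    then show "x \<in> crossings p (w p)" using b by (auto simp: mem_crossings)
  qed
  from crossings_concat'[OF generic_base_point generic_orbit[OF s_We[OF i]] generic_orbit[OF w] this]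
  have "num_hyperplanes p (w p) = num_hyperplanes p (s i p) + num_hyperplanes (s i p) (w p)"
    by (rule num_hyperplanes_union)
  moreover have "num_hyperplanes (s i p) (w p) = num_hyperplanes p (s i (w p))"
    using num_hyperplanes_act[OF s_We[OF i], of p "s i (w p)"] s_involution by simp
  ultimately show ?thesis using num_hyperplanes_generator[OF i] i by auto
qed

lemma expression_exists:
  assumes "w \<in> We" shows "\<exists>is \<sigma>. expression \<Phi> \<alpha> is \<sigma> w \<and> length is = num_hyperplanes p (w p)"
  using assms
proof (induction "num_hyperplanes p (w p)" arbitrary: w)
  case 0
  then have "w \<in> alcove_stab \<Phi> \<alpha>" using num_hyperplanes_0_iff by (simp add: alcove_stab_iff)
  then have "expression \<Phi> \<alpha> [] w w" unfolding expression_def word_map_simps by simp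
  then show ?case using 0 by (intro exI[of _ "[]"] exI[of _ w]) simp
next
  case (Suc k)
  then have "crossings p (w p) \<noteq> {}" using num_hyperplanes_0_iff by (metis nat.distinct(1))
  from left_descent[OF Suc.prems this] obtain i where i: "i \<in> {0..DIM('a)}"
    and n: "num_hyperplanes p (w p) = Suc (num_hyperplanes p (s i (w p)))" by blast
  let ?u = "s i \<circ> w"
  have u: "?u \<in> We" by (rule We_comp[OF s_We[OF i] Suc.prems])
  have k: "k = num_hyperplanes p (?u p)" using n Suc.hyps(2) by simp
  from Suc.hyps(1)[OF k u] obtain "is" \<sigma> where e: "expression \<Phi> \<alpha> is \<sigma> ?u" "length is = num_hyperplanes p (?u p)" by blast
  have "w = word_map \<Phi> \<alpha> (i # is) \<circ> \<sigma>"
  proof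
    fix x
    have "s i (w x) = word_map \<Phi> \<alpha> is (\<sigma> x)" using e(1) unfolding expression_def by (metis comp_apply)
    then show "w x = (word_map \<Phi> \<alpha> (i # is) \<circ> \<sigma>) x" unfolding word_map_simps comp_apply using s_involution by metis
  qed
  then have "expression \<Phi> \<alpha> (i # is) \<sigma> w" using e(1) i unfolding expression_def by simp
  then show ?case using e(2) k Suc.hyps(2) by (intro exI[of _ "i # is"] exI[of _ \<sigma>]) simp
qed

lemma wlen_eq: assumes "w \<in> We" shows "wlen \<Phi> \<alpha> w = num_hyperplanes p (w p)"
  unfolding wlen_def
proof (rule Least_equality)
  show "\<exists>is \<sigma>. expression \<Phi> \<alpha> is \<sigma> w \<and> length is = num_hyperplanes p (w p)" by (rule expression_exists[OF assms])
  fix k assume "\<exists>is \<sigma>. expression \<Phi> \<alpha> is \<sigma> w \<and> length is = k"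
  then obtain "is" \<sigma> where "expression \<Phi> \<alpha> is \<sigma> w" "length is = k" by blast
  then show "num_hyperplanes p (w p) \<le> k" using word_num_hyperplanes unfolding expression_def by auto
qed

lemma stab_We: "\<sigma> \<in> alcove_stab \<Phi> \<alpha> \<Longrightarrow> \<sigma> \<in> We"
  by (simp add: alcove_stab_iff)

lemma id_stab: "id \<in> alcove_stab \<Phi> \<alpha>"
  using W0_We[OF W0_id] by (simp add: alcove_stab_iff crossings_def)

lemma wlen_stab: "\<sigma> \<in> alcove_stab \<Phi> \<alpha> \<Longrightarrow> wlen \<Phi> \<alpha> \<sigma> = 0"
  using wlen_eq[OF stab_We, of \<sigma>] by (simp add: alcove_stab_iff num_hyperplanes_0_iff)

lemma wlen_generator: "i \<in> {0..DIM('a)} \<Longrightarrow> wlen \<Phi> \<alpha> (s i) = 1"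
  using wlen_eq[OF s_We] num_hyperplanes_generator by simp

text \<open>Every element is a reduced product of generators followed by an element stabilizing the alcove; the
  induction strips the leftmost generator.\<close>

lemma We_length_induct [consumes 1, case_names stab step]:
  assumes "w \<in> We" and stab: "\<And>\<sigma>. \<sigma> \<in> alcove_stab \<Phi> \<alpha> \<Longrightarrow> R \<sigma>"
    and step: "\<And>i u. i \<in> {0..DIM('a)} \<Longrightarrow> u \<in> We \<Longrightarrow> wlen \<Phi> \<alpha> (s i \<circ> u) = wlen \<Phi> \<alpha> (s i) + wlen \<Phi> \<alpha> u \<Longrightarrow> R u \<Longrightarrow> R (s i \<circ> u)"
  shows "R w"
  using assms(1)
proof (induction "wlen \<Phi> \<alpha> w" arbitrary: w)
  case 0
  then have "w \<in> alcove_stab \<Phi> \<alpha>" using num_hyperplanes_0_iff wlen_eq[OF 0(2)] by (simp add: alcove_stab_iff)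
  then show ?case by (rule stab)
next
  case (Suc k)
  then have "crossings p (w p) \<noteq> {}" using num_hyperplanes_0_iff wlen_eq[OF Suc.prems] by (metis nat.distinct(1))
  from left_descent[OF Suc.prems this] obtain i where i: "i \<in> {0..DIM('a)}"
    and n: "num_hyperplanes p (w p) = Suc (num_hyperplanes p (s i (w p)))" by blast
  let ?u = "s i \<circ> w"
  have u: "?u \<in> We" by (rule We_comp[OF s_We[OF i] Suc.prems])
  have k: "k = wlen \<Phi> \<alpha> ?u" using n Suc.hyps(2) wlen_eq[OF u] wlen_eq[OF Suc.prems] by simp
  have w: "s i \<circ> ?u = w" by (auto simp: fun_eq_iff s_involution)
  have "R (s i \<circ> ?u)"
    by (rule step[OF i u _ Suc.hyps(1)[OF k u]]) (use k Suc.hyps(2) w wlen_generator[OF i] in simp)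
  then show ?case unfolding w .
qed

lemma wlen_right_stab:
  assumes w: "w \<in> We" and "\<sigma> \<in> alcove_stab \<Phi> \<alpha>"
  shows "crossings p (w (\<sigma> p)) = crossings p (w p)" "wlen \<Phi> \<alpha> (w \<circ> \<sigma>) = wlen \<Phi> \<alpha> w"
proof -
  have s: "\<sigma> \<in> We" by (rule stab_We[OF assms(2)])
  have e: "crossings (w p) (w (\<sigma> p)) = {}"
    using crossings_act[OF w, of p "\<sigma> p"] assms(2) by (simp add: alcove_stab_iff bij_betw_def)
  have "generic (w (\<sigma> p))" using generic_orbit[OF We_comp[OF w s]] by simp
  then show c: "crossings p (w (\<sigma> p)) = crossings p (w p)"
    using crossings_concat(1)[OF generic_orbit[OF w] _, of "w (\<sigma> p)" p] e by simp
  show "wlen \<Phi> \<alpha> (w \<circ> \<sigma>) = wlen \<Phi> \<alpha> w"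
    using c wlen_eq[OF w] wlen_eq[OF We_comp[OF w s]] by (simp add: num_hyperplanes_def)
qed

lemma right_step_wlen:
  assumes w: "w \<in> We" and i: "i \<in> {0..DIM('a)}"
  shows "(wlen \<Phi> \<alpha> (w \<circ> s i) = wlen \<Phi> \<alpha> w + 1 \<and> crossings p (w (s i p)) = crossings p (w p) \<union> crossings (w p) (w (s i p))
           \<and> crossings p (w p) \<inter> crossings (w p) (w (s i p)) = {}) \<or>
         (wlen \<Phi> \<alpha> w = wlen \<Phi> \<alpha> (w \<circ> s i) + 1 \<and> crossings p (w p) = crossings p (w (s i p)) \<union> crossings (w (s i p)) (w p)
           \<and> crossings p (w (s i p)) \<inter> crossings (w (s i p)) (w p) = {})"
proof -
  have ws: "w \<circ> s i \<in> We" by (rule We_comp[OF w s_We[OF i]])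
  have 1: "num_hyperplanes (w p) (w (s i p)) = 1"
    using num_hyperplanes_act[OF w] num_hyperplanes_generator[OF i] by simp
  have 2: "num_hyperplanes (w (s i p)) (w p) = 1" using 1 num_hyperplanes_swap by metis
  have l: "wlen \<Phi> \<alpha> (w \<circ> s i) = num_hyperplanes p (w (s i p))" "wlen \<Phi> \<alpha> w = num_hyperplanes p (w p)"
    using wlen_eq[OF w] wlen_eq[OF ws] by simp_all
  show ?thesis using right_step[OF w i] num_hyperplanes_union[of p "w (s i p)" "w p"] num_hyperplanes_union[of p "w p" "w (s i p)"]
    unfolding l 1 2 by auto
qed

end

section \<open>Structure of the extended affine Hecke algebra\<close>

locale hecke_algebra = based_root_system +
  fixes L :: "('a \<Rightarrow> 'a) \<Rightarrow> nat" and H :: "(laurent, 'h) module" and T :: "('a \<Rightarrow> 'a) \<Rightarrow> 'h"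
  assumes hecke: "affine_hecke_algebra \<Phi> \<alpha> L H T"

sublocale hecke_algebra \<subseteq> HR: Ring.ring H
  using hecke unfolding affine_hecke_algebra_def by blast

sublocale hecke_algebra \<subseteq> HM: Module.module laurent_ring H
  using hecke unfolding affine_hecke_algebra_def by blast

lemma laurent_ring_simps [simp]:
  "carrier (ring_of_type_algebra :: 'r::comm_ring_1 ring) = UNIV"
  "x \<otimes>\<^bsub>ring_of_type_algebra\<^esub> y = x * (y :: 'r)"
  "x \<oplus>\<^bsub>ring_of_type_algebra\<^esub> y = x + (y :: 'r)"
  "\<one>\<^bsub>ring_of_type_algebra\<^esub> = (1 :: 'r)"
  "\<zero>\<^bsub>ring_of_type_algebra\<^esub> = (0 :: 'r)"
  by (simp_all add: ring_of_type_algebra_def)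

context hecke_algebra
begin

abbreviation hmul :: "'h \<Rightarrow> 'h \<Rightarrow> 'h" (infixl "\<cdot>" 70) where "x \<cdot> y \<equiv> x \<otimes>\<^bsub>H\<^esub> y"
abbreviation hadd :: "'h \<Rightarrow> 'h \<Rightarrow> 'h" (infixl "\<boxplus>" 65) where "x \<boxplus> y \<equiv> x \<oplus>\<^bsub>H\<^esub> y"
abbreviation hsmult :: "laurent \<Rightarrow> 'h \<Rightarrow> 'h" (infixr "\<star>" 75) where "r \<star> x \<equiv> r \<odot>\<^bsub>H\<^esub> x"

definition qgap :: "nat \<Rightarrow> laurent" where
  "qgap i = qpow (int (L (s i))) - qpow (- int (L (s i)))"

lemma T_closed: "w \<in> We \<Longrightarrow> T w \<in> carrier H"
  using hecke unfolding affine_hecke_algebra_def by blast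

lemma smult_mult:
  assumes "x \<in> carrier H" "y \<in> carrier H"
  shows "(r \<star> x) \<cdot> y = r \<star> (x \<cdot> y)" "x \<cdot> (r \<star> y) = r \<star> (x \<cdot> y)"
  using hecke assms unfolding affine_hecke_algebra_def by blast+

lemma T_mult:
  "w \<in> We \<Longrightarrow> u \<in> We \<Longrightarrow> wlen \<Phi> \<alpha> (w \<circ> u) = wlen \<Phi> \<alpha> w + wlen \<Phi> \<alpha> u \<Longrightarrow> T w \<cdot> T u = T (w \<circ> u)"
  using hecke unfolding affine_hecke_algebra_def by blast

lemma T_mult_descent:
  "w \<in> We \<Longrightarrow> i \<in> {0..DIM('a)} \<Longrightarrow> wlen \<Phi> \<alpha> w = wlen \<Phi> \<alpha> (w \<circ> s i) + 1 \<Longrightarrow>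
    T w \<cdot> T (s i) = T (w \<circ> s i) \<boxplus> qgap i \<star> T w"
  using hecke unfolding affine_hecke_algebra_def qgap_def by blast

definition lc :: "(('a \<Rightarrow> 'a) \<Rightarrow>\<^sub>0 laurent) \<Rightarrow> 'h" where
  "lc c = (\<Oplus>\<^bsub>H\<^esub>w\<in>Poly_Mapping.keys c. Poly_Mapping.lookup c w \<star> T w)"

lemma unique_coordinates: "x \<in> carrier H \<Longrightarrow> \<exists>!c. Poly_Mapping.keys c \<subseteq> We \<and> x = lc c"
  using hecke unfolding affine_hecke_algebra_def lc_def by blast

definition coord :: "'h \<Rightarrow> ('a \<Rightarrow> 'a) \<Rightarrow>\<^sub>0 laurent" where
  "coord x = (THE c. Poly_Mapping.keys c \<subseteq> We \<and> x = lc c)"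

lemma coord: "x \<in> carrier H \<Longrightarrow> Poly_Mapping.keys (coord x) \<subseteq> We" "x \<in> carrier H \<Longrightarrow> lc (coord x) = x"
  using theI'[OF unique_coordinates, of x] unfolding coord_def by auto

lemma coord_eqI: "x \<in> carrier H \<Longrightarrow> Poly_Mapping.keys c \<subseteq> We \<Longrightarrow> lc c = x \<Longrightarrow> coord x = c"
  unfolding coord_def by (rule the1_equality[OF unique_coordinates]) auto

lemma term_closed: "w \<in> We \<Longrightarrow> r \<star> T w \<in> carrier H"
  using HM.smult_closed T_closed by simp

lemma smult_zero: "x \<in> carrier H \<Longrightarrow> 0 \<star> x = \<zero>\<^bsub>H\<^esub>"
  using HM.smult_l_null[of x] by simp

lemma lc_superset:
  assumes "finite A" "Poly_Mapping.keys c \<subseteq> A" "A \<subseteq> We"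
  shows "lc c = (\<Oplus>\<^bsub>H\<^esub>w\<in>A. Poly_Mapping.lookup c w \<star> T w)"
  unfolding lc_def
proof (rule HR.add.finprod_mono_neutral_cong_left[OF assms(1,2)])
  show "Poly_Mapping.lookup c i \<star> T i = \<zero>\<^bsub>H\<^esub>" if "i \<in> A - Poly_Mapping.keys c" for i
    using that assms T_closed[of i] smult_zero by (auto simp: in_keys_iff)
qed (use assms term_closed in auto)

lemma lc_add:
  assumes "Poly_Mapping.keys c \<subseteq> We" "Poly_Mapping.keys d \<subseteq> We"
  shows "lc (c + d) = lc c \<boxplus> lc d"
proof -
  let ?A = "Poly_Mapping.keys c \<union> Poly_Mapping.keys d"
  have A: "finite ?A" "?A \<subseteq> We" using assms by auto
  have k: "Poly_Mapping.keys (c + d) \<subseteq> ?A" by (rule keys_add)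
  have "lc (c + d) = (\<Oplus>\<^bsub>H\<^esub>w\<in>?A. Poly_Mapping.lookup c w \<star> T w \<boxplus> Poly_Mapping.lookup d w \<star> T w)"
    unfolding lc_superset[OF A(1) k A(2)]
  proof (rule HR.finsum_cong')
    fix w assume "w \<in> ?A"
    then show "Poly_Mapping.lookup (c + d) w \<star> T w = Poly_Mapping.lookup c w \<star> T w \<boxplus> Poly_Mapping.lookup d w \<star> T w"
      using HM.smult_l_distr[of "Poly_Mapping.lookup c w" "Poly_Mapping.lookup d w" "T w"] T_closed A(2)
      by (auto simp: lookup_add)
  qed (use A term_closed in \<open>auto intro!: HR.add.m_closed\<close>)
  also have "\<dots> = lc c \<boxplus> lc d"
    unfolding lc_superset[OF A(1) Un_upper1 A(2)] lc_superset[OF A(1) Un_upper2 A(2)]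
    by (rule HR.finsum_addf) (use A term_closed in auto)
  finally show ?thesis .
qed

lemma lc_scale:
  assumes "Poly_Mapping.keys c \<subseteq> We"
  shows "lc (Poly_Mapping.map ((*) r) c) = r \<star> lc c"
proof -
  have k: "Poly_Mapping.keys (Poly_Mapping.map ((*) r) c) \<subseteq> Poly_Mapping.keys c"
    by (auto simp: in_keys_iff Poly_Mapping.map.rep_eq when_def split: if_splits)
  have "lc (Poly_Mapping.map ((*) r) c) = (\<Oplus>\<^bsub>H\<^esub>w\<in>Poly_Mapping.keys c. r \<star> (Poly_Mapping.lookup c w \<star> T w))"
    unfolding lc_superset[OF finite_keys k assms]
  proof (rule HR.finsum_cong')
    fix w assume w: "w \<in> Poly_Mapping.keys c"
    then show "Poly_Mapping.lookup (Poly_Mapping.map ((*) r) c) w \<star> T w = r \<star> (Poly_Mapping.lookup c w \<star> T w)"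
      using HM.smult_assoc1[of r "Poly_Mapping.lookup c w" "T w"] T_closed assms
      by (auto simp: Poly_Mapping.map.rep_eq when_def in_keys_iff)
  qed (use assms term_closed HM.smult_closed in auto)
  also have "\<dots> = r \<star> lc c"
    unfolding lc_def by (rule HM.finsum_smult_ldistr[symmetric]) (use assms T_closed HM.smult_closed in auto)
  finally show ?thesis .
qed

lemma lc_single: "w \<in> We \<Longrightarrow> lc (Poly_Mapping.single w r) = r \<star> T w"
  using term_closed[of w r] T_closed[of w] smult_zero[of "T w"]
  by (simp add: lc_superset[of "{w}"])

lemma coord_add: "x \<in> carrier H \<Longrightarrow> y \<in> carrier H \<Longrightarrow> coord (x \<boxplus> y) = coord x + coord y"
  using coord[of x] coord[of y] keys_add[of "coord x" "coord y"]
  by (intro coord_eqI) (auto simp: lc_add)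

lemma coord_scale: "x \<in> carrier H \<Longrightarrow> coord (r \<star> x) = Poly_Mapping.map ((*) r) (coord x)"
  using coord[of x] HM.smult_closed
  by (intro coord_eqI) (auto simp: lc_scale in_keys_iff Poly_Mapping.map.rep_eq when_def split: if_splits)

lemma coord_T: "w \<in> We \<Longrightarrow> coord (T w) = Poly_Mapping.single w 1"
  using T_closed[of w] HM.smult_one[of "T w"]
  by (intro coord_eqI) (auto simp: lc_single)

text \<open>Statements that are linear in an element of the algebra may be checked on the basis.\<close>

lemma hecke_induct [consumes 1, case_names zero add]:
  assumes "x \<in> carrier H" and zero: "R \<zero>\<^bsub>H\<^esub>"
    and add: "\<And>w r y. w \<in> We \<Longrightarrow> y \<in> carrier H \<Longrightarrow> R y \<Longrightarrow> R (r \<star> T w \<boxplus> y)"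
  shows "R x"
proof -
  have "Poly_Mapping.keys c \<subseteq> We \<Longrightarrow> R (\<Oplus>\<^bsub>H\<^esub>w\<in>A. Poly_Mapping.lookup c w \<star> T w)" if "finite A" "A \<subseteq> Poly_Mapping.keys c" for c A
    using that
  proof (induction A rule: finite_induct)
    case empty then show ?case using zero by simp
  next
    case (insert w A)
    have f: "(\<lambda>w. Poly_Mapping.lookup c w \<star> T w) \<in> A \<rightarrow> carrier H" using insert.prems term_closed by auto
    have w: "w \<in> We" using insert.prems by auto
    have "(\<Oplus>\<^bsub>H\<^esub>w\<in>insert w A. Poly_Mapping.lookup c w \<star> T w) = Poly_Mapping.lookup c w \<star> T w \<boxplus> (\<Oplus>\<^bsub>H\<^esub>w\<in>A. Poly_Mapping.lookup c w \<star> T w)"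
      by (rule HR.finsum_insert[OF insert.hyps f]) (rule term_closed[OF w])
    then show ?case using add[OF w HR.finsum_closed[OF f]] insert by auto
  qed
  from this[OF finite_keys order.refl coord(1)[OF assms(1)]] show ?thesis
    using coord(2)[OF assms(1)] unfolding lc_def by simp
qed

lemma T_id: "T id = \<one>\<^bsub>H\<^esub>"
proof -
  have id: "id \<in> We" by (rule W0_We[OF W0_id])
  have "T id \<cdot> x = x" if "x \<in> carrier H" for x
    using that
  proof (induction rule: hecke_induct)
    case zero show ?case by (rule HR.r_null[OF T_closed[OF id]])
  next
    case (add w r y)
    have "T id \<cdot> T w = T (id \<circ> w)" by (rule T_mult[OF id add(1)]) (simp only: comp_id id_comp wlen_stab[OF id_stab] add_0)
    then have "T id \<cdot> T w = T w" by (simp only: id_comp)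
    then show ?case using add T_closed[OF id] T_closed[OF add(1)] term_closed[OF add(1)]
      by (simp add: HR.r_distr smult_mult id_def)
  qed
  from this[OF HR.one_closed] show ?thesis using HR.r_one[OF T_closed[OF id]] by simp
qed

lemma generator_square:
  assumes i: "i \<in> {0..DIM('a)}"
  shows "T (s i) \<cdot> T (s i) = \<one>\<^bsub>H\<^esub> \<boxplus> qgap i \<star> T (s i)"
proof -
  have "s i \<circ> s i = id" by (auto simp: fun_eq_iff s_involution)
  then have "wlen \<Phi> \<alpha> (s i) = wlen \<Phi> \<alpha> (s i \<circ> s i) + 1"
    using wlen_generator[OF i] wlen_stab[OF id_stab] by simp
  from T_mult_descent[OF s_We[OF i] i this] show ?thesis using \<open>s i \<circ> s i = id\<close> T_id by simp
qed

text \<open>The quadratic relation \<open>T\<^sub>i\<^sup>2 = 1 + (q\<^sub>i - q\<^sub>i\<^sup>-\<^sup>1) T\<^sub>i\<close> makes \<open>T\<^sub>i\<close> invertible, with inverse in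
  the span of \<open>1\<close> and \<open>T\<^sub>i\<close>.  Hence every subalgebra containing \<open>T\<^sub>i\<close> contains its inverse.\<close>

lemma generator_inverse:
  assumes i: "i \<in> {0..DIM('a)}"
  shows "T (s i) \<in> Units H" "inv\<^bsub>H\<^esub> T (s i) = T (s i) \<boxplus> (- qgap i) \<star> \<one>\<^bsub>H\<^esub>"
proof -
  let ?t = "T (s i)" let ?y = "?t \<boxplus> (- qgap i) \<star> \<one>\<^bsub>H\<^esub>"
  have t: "?t \<in> carrier H" by (rule T_closed[OF s_We[OF i]])
  have o: "r \<star> \<one>\<^bsub>H\<^esub> \<in> carrier H" "r \<star> ?t \<in> carrier H" for r using t HM.smult_closed by auto
  have y: "?y \<in> carrier H" using t o by simp
  have c: "qgap i \<star> ?t \<boxplus> (- qgap i) \<star> ?t = \<zero>\<^bsub>H\<^esub>"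
    using HM.smult_l_distr[of "qgap i" "- qgap i" ?t] t smult_zero[OF t] by simp
  have "?t \<cdot> ?y = ?t \<cdot> ?t \<boxplus> (- qgap i) \<star> ?t" using t o by (simp add: HR.r_distr smult_mult)
  also have "\<dots> = \<one>\<^bsub>H\<^esub>" unfolding generator_square[OF i] using c o by (simp add: HR.a_assoc)
  finally have 1: "?t \<cdot> ?y = \<one>\<^bsub>H\<^esub>" .
  have "?y \<cdot> ?t = ?t \<cdot> ?t \<boxplus> (- qgap i) \<star> ?t" using t o by (simp add: HR.l_distr smult_mult)
  also have "\<dots> = \<one>\<^bsub>H\<^esub>" unfolding generator_square[OF i] using c o by (simp add: HR.a_assoc)
  finally have 2: "?y \<cdot> ?t = \<one>\<^bsub>H\<^esub>" .
  show "?t \<in> Units H" using t y 1 2 unfolding Units_def by blast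
  show "inv\<^bsub>H\<^esub> ?t = ?y" using HR.inv_unique'[OF t y 1 2] by simp
qed

lemma generator_pow_sign:
  assumes i: "i \<in> {0..DIM('a)}"
  shows "T (s i) [^]\<^bsub>H\<^esub> (1::int) = T (s i)" "T (s i) [^]\<^bsub>H\<^esub> (-1::int) = inv\<^bsub>H\<^esub> T (s i)"
  using T_closed[OF s_We[OF i]] by (simp_all add: int_pow_def2)

lemma crossing_sign_cases: "crossing_sign \<Phi> \<alpha> u i = 1 \<or> crossing_sign \<Phi> \<alpha> u i = - 1"
  by (simp add: crossing_sign_def)

lemma X_expr_from_units:
  assumes u: "u \<in> We" and "set is \<subseteq> {0..DIM('a)}"
  shows "X_expr_from \<Phi> \<alpha> H T u is id \<in> Units H"
  using assms
proof (induction "is" arbitrary: u)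
  case Nil then show ?case by (simp add: T_id[unfolded id_def])
next
  case (Cons i "is")
  have i: "i \<in> {0..DIM('a)}" using Cons.prems by simp
  have "T (s i) [^]\<^bsub>H\<^esub> crossing_sign \<Phi> \<alpha> u i \<in> Units H"
    using crossing_sign_cases[of u i] generator_pow_sign[OF i] generator_inverse(1)[OF i] HR.Units_inv_Units by auto
  moreover have "X_expr_from \<Phi> \<alpha> H T (u \<circ> s i) is id \<in> Units H"
    using Cons.IH[OF We_comp[OF Cons.prems(1) s_We[OF i]]] Cons.prems(2) by (simp add: id_def comp_def)
  ultimately show ?case by (simp add: id_def comp_def)
qed

lemma generator_pow_closed:
  assumes i: "i \<in> {0..DIM('a)}" shows "T (s i) [^]\<^bsub>H\<^esub> crossing_sign \<Phi> \<alpha> u i \<in> carrier H"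
  using crossing_sign_cases[of u i] generator_pow_sign[OF i] generator_inverse(1)[OF i] HR.Units_inv_closed T_closed[OF s_We[OF i]]
  by auto

lemma X_expr_from_factor:
  assumes u: "u \<in> We" and "set is \<subseteq> {0..DIM('a)}" and sg: "\<sigma> \<in> We"
  shows "X_expr_from \<Phi> \<alpha> H T u is \<sigma> = X_expr_from \<Phi> \<alpha> H T u is id \<cdot> T \<sigma>"
  using assms(1,2)
proof (induction "is" arbitrary: u)
  case Nil then show ?case using T_closed[OF sg] by (simp add: T_id[unfolded id_def])
next
  case (Cons i "is")
  have i: "i \<in> {0..DIM('a)}" "set is \<subseteq> {0..DIM('a)}" using Cons.prems by simp_all
  have u: "u \<circ> s i \<in> We" by (rule We_comp[OF Cons.prems(1) s_We[OF i(1)]])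
  show ?case
    using Cons.IH[OF u i(2)] HR.Units_closed[OF X_expr_from_units[OF u i(2)]] T_closed[OF sg] generator_pow_closed[OF i(1)]
    by (simp add: HR.m_assoc id_def comp_def)
qed

lemma X_expr_from_closed:
  assumes "u \<in> We" "set is \<subseteq> {0..DIM('a)}" "\<sigma> \<in> We"
  shows "X_expr_from \<Phi> \<alpha> H T u is \<sigma> \<in> carrier H"
  unfolding X_expr_from_factor[OF assms] using X_expr_from_units[OF assms(1,2)] T_closed[OF assms(3)] by blast

subsection \<open>Uniqueness of the representation\<close>

text \<open>The elements on which two candidates agree form a subalgebra.  It contains \<open>T\<^sub>i\<close> for the finite
  nodes and every \<open>X\<^sup>\<mu>\<close>.  From \<open>X\<close> at the coroot of \<open>\<theta>\<close>, whose expression is \<open>s\<^sub>0\<close> followed by a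
  word in the finite nodes, it contains \<open>T\<^sub>0\<close>; and since a suitable finite element times
  \<open>\<sigma>\<close> is a translation, it contains all \<open>T\<^sub>\<sigma>\<close>.\<close>

lemma is_psi_unique:
  assumes 1: "is_psi \<Phi> \<alpha> H T v \<psi>" and 2: "is_psi \<Phi> \<alpha> H T v \<psi>'"
  shows "\<psi> = \<psi>'"
proof -
  define E where "E = {x \<in> carrier H. \<psi> x = \<psi>' x}"
  have Ec: "E \<subseteq> carrier H" by (auto simp: E_def)
  have hom: "\<psi> \<in> ring_hom H (zeta_ring \<Phi> \<alpha>)" "\<psi>' \<in> ring_hom H (zeta_ring \<Phi> \<alpha>)"
    using 1 2 unfolding is_psi_def by auto
  have sm: "\<psi> (r \<star> x) = r \<odot>\<^bsub>zeta_ring \<Phi> \<alpha>\<^esub> \<psi> x" "\<psi>' (r \<star> x) = r \<odot>\<^bsub>zeta_ring \<Phi> \<alpha>\<^esub> \<psi>' x" if "x \<in> carrier H" for r x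
    using 1 2 that unfolding is_psi_def by auto
  have E_mult: "x \<cdot> y \<in> E" if "x \<in> E" "y \<in> E" for x y
    using that ring_hom_mult[OF hom(1)] ring_hom_mult[OF hom(2)] by (auto simp: E_def)
  have E_add: "x \<boxplus> y \<in> E" if "x \<in> E" "y \<in> E" for x y
    using that ring_hom_add[OF hom(1)] ring_hom_add[OF hom(2)] by (auto simp: E_def)
  have E_one: "\<one>\<^bsub>H\<^esub> \<in> E" using ring_hom_one[OF hom(1)] ring_hom_one[OF hom(2)] by (auto simp: E_def)
  have E_scale: "r \<star> x \<in> E" if "x \<in> E" for r x
    using that sm HM.smult_closed by (auto simp: E_def)
  have E_inv: "inv\<^bsub>H\<^esub> T (s i) \<in> E" if "i \<in> {0..DIM('a)}" "T (s i) \<in> E" for i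
    unfolding generator_inverse(2)[OF that(1)] by (intro E_add that E_scale E_one)
  have E_node: "T (s i) \<in> E" if i: "i \<in> {1..DIM('a)}" for i
    using i 1 2 T_closed[OF s_We, of i] unfolding is_psi_def E_def by auto
  have E_X: "X_expr \<Phi> \<alpha> H T is \<sigma> \<in> E" if "\<mu> \<in> P" "expression \<Phi> \<alpha> is \<sigma> (transl \<mu>)" for \<mu> "is" \<sigma>
  proof -
    have "X_expr \<Phi> \<alpha> H T is \<sigma> \<in> carrier H"
      using that X_expr_from_closed[OF W0_We[OF W0_id]] stab_We unfolding X_expr_def expression_def by blast
    moreover have "\<psi> (X_expr \<Phi> \<alpha> H T is \<sigma>) = \<psi>' (X_expr \<Phi> \<alpha> H T is \<sigma>)"
      using 1 2 that unfolding is_psi_def by simp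
    ultimately show ?thesis by (simp add: E_def)
  qed
  \<comment> \<open>Closure under inverses is not automatic for \<open>E\<close>, so it is tracked in the set \<open>U\<close>, which is a
    group.\<close>
  define U where "U = {x \<in> Units H. x \<in> E \<and> inv\<^bsub>H\<^esub> x \<in> E}"
  have U_mult: "x \<cdot> y \<in> U" if "x \<in> U" "y \<in> U" for x y
  proof -
    have u: "x \<in> Units H" "y \<in> Units H" using that by (auto simp: U_def)
    then have c: "x \<in> carrier H" "y \<in> carrier H" "inv\<^bsub>H\<^esub> x \<in> carrier H" "inv\<^bsub>H\<^esub> y \<in> carrier H"
      by auto
    have a: "x \<cdot> y \<cdot> (inv\<^bsub>H\<^esub> y \<cdot> inv\<^bsub>H\<^esub> x) = x \<cdot> (y \<cdot> inv\<^bsub>H\<^esub> y) \<cdot> inv\<^bsub>H\<^esub> x"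
      "(inv\<^bsub>H\<^esub> y \<cdot> inv\<^bsub>H\<^esub> x) \<cdot> (x \<cdot> y) = inv\<^bsub>H\<^esub> y \<cdot> (inv\<^bsub>H\<^esub> x \<cdot> x) \<cdot> y"
      using c by (simp_all add: HR.m_assoc)
    have "inv\<^bsub>H\<^esub> (x \<cdot> y) = inv\<^bsub>H\<^esub> y \<cdot> inv\<^bsub>H\<^esub> x"
      by (rule HR.inv_unique'[symmetric]) (use u c a in \<open>simp_all\<close>)
    then show ?thesis using that u E_mult by (auto simp: U_def)
  qed
  have U_inv: "inv\<^bsub>H\<^esub> x \<in> U" if "x \<in> U" for x
    using that by (auto simp: U_def)
  have U_gen: "T (s i) \<in> U" if "i \<in> {0..DIM('a)}" "T (s i) \<in> E" for i
    using generator_inverse(1)[OF that(1)] that E_inv[OF that] by (simp add: U_def)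
  have U_path: "X_expr_from \<Phi> \<alpha> H T u is id \<in> U"
    if "u \<in> We" "set is \<subseteq> {0..DIM('a)}" "\<And>i. i \<in> set is \<Longrightarrow> T (s i) \<in> E" for u "is"
    using that
  proof (induction "is" arbitrary: u)
    case Nil then show ?case using E_one by (simp add: T_id[unfolded id_def] U_def)
  next
    case (Cons i "is")
    have i: "i \<in> {0..DIM('a)}" using Cons.prems by simp
    have "T (s i) \<in> U" using U_gen[OF i] Cons.prems(3) by simp
    then have "T (s i) [^]\<^bsub>H\<^esub> crossing_sign \<Phi> \<alpha> u i \<in> U"
      using crossing_sign_cases[of u i] generator_pow_sign[OF i] U_inv by auto
    then show ?case using Cons.IH[of "u \<circ> s i"] We_comp[OF Cons.prems(1) s_We[OF i]] Cons.prems(2,3) U_mult by (simp add: id_def comp_def)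
  qed
  have id: "id \<in> We" by (rule W0_We[OF W0_id])
  have E_zero: "T (s 0) \<in> E"
  proof -
    obtain "is" where js: "set is \<subseteq> {1..DIM('a)}" "refl \<theta> = word_map \<Phi> \<alpha> is"
      using W0_refl_root[OF highest_root(1)] unfolding finite_weyl_def by auto
    have js': "set is \<subseteq> {0..DIM('a)}" using js(1) by auto
    have z: "(0::nat) \<in> {0..DIM('a)}" by simp
    have "word_map \<Phi> \<alpha> (0 # is) = transl (coroot \<theta>)"
      unfolding word_map_simps js(2)[symmetric] s_zero by (auto simp: fun_eq_iff refl_involution)
    then have "expression \<Phi> \<alpha> (0 # is) id (transl (coroot \<theta>))"
      using js' id_stab unfolding expression_def by simp
    from E_X[OF coroot_P[OF highest_root(1)] this]
    have X: "X_expr \<Phi> \<alpha> H T (0 # is) id \<in> E" .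
    have "(\<theta>, 1) \<in> crossings (id p) (id (s 0 p))" by (simp add: crossings_affine)
    then have "crossing_sign \<Phi> \<alpha> id 0 = 1"
      unfolding crossing_sign_eq[OF id z] using highest_root_pos by auto
    define Y where "Y = X_expr_from \<Phi> \<alpha> H T (s 0) is id"
    have Y: "Y \<in> U" unfolding Y_def by (rule U_path[OF s_We[OF z] js']) (use js(1) E_node in auto)
    have t: "T (s 0) \<in> carrier H" by (rule T_closed[OF s_We[OF z]])
    have "X_expr \<Phi> \<alpha> H T (0 # is) id = T (s 0) \<cdot> Y"
      using generator_pow_sign(1)[OF z] \<open>crossing_sign \<Phi> \<alpha> id 0 = 1\<close> by (simp add: X_expr_def Y_def)
    then have "X_expr \<Phi> \<alpha> H T (0 # is) id \<cdot> inv\<^bsub>H\<^esub> Y = T (s 0)"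
      using t Y by (simp add: U_def HR.m_assoc HR.Units_closed)
    moreover have "inv\<^bsub>H\<^esub> Y \<in> E" using Y by (simp add: U_def)
    ultimately show ?thesis using E_mult[OF X] by metis
  qed
  have E_gen: "T (s i) \<in> E" if "i \<in> {0..DIM('a)}" for i
    using E_zero E_node[of i] that by (cases "i = 0") auto
  have E_stab: "T \<sigma> \<in> E" if sg: "\<sigma> \<in> alcove_stab \<Phi> \<alpha>" for \<sigma>
  proof -
    have sW: "\<sigma> \<in> We" by (rule stab_We[OF sg])
    \<comment> \<open>Cancelling the linear part of \<open>\<sigma>\<close> by a finite element leaves a translation.\<close>
    obtain h where h: "h \<in> W0" "h \<circ> lin \<sigma> = id" "lin \<sigma> \<circ> h = id" using W0_inverse[OF We_parts(1)[OF sW]] by blast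
    obtain "is" where js: "set is \<subseteq> {1..DIM('a)}" "h = word_map \<Phi> \<alpha> is" using h(1) unfolding finite_weyl_def by auto
    have js': "set is \<subseteq> {0..DIM('a)}" using js(1) by auto
    have "transl (h (\<sigma> 0)) = word_map \<Phi> \<alpha> is \<circ> \<sigma>"
    proof
      fix x
      have "h (lin \<sigma> x) = x" using h(2) by (metis comp_apply id_apply)
      then show "transl (h (\<sigma> 0)) x = (word_map \<Phi> \<alpha> is \<circ> \<sigma>) x"
        using We_parts(4)[OF sW, of x] linear_add[OF W0_linear[OF h(1)]] by (simp add: transl_def js(2)[symmetric])
    qed
    then have e: "expression \<Phi> \<alpha> is \<sigma> (transl (h (\<sigma> 0)))" using js' sg unfolding expression_def by simp
    have X: "X_expr \<Phi> \<alpha> H T is \<sigma> \<in> E" by (rule E_X[OF P_W0[OF We_parts(2)[OF sW] h(1)] e])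
    define Y where "Y = X_expr_from \<Phi> \<alpha> H T id is id"
    have Y: "Y \<in> U" unfolding Y_def by (rule U_path[OF id js']) (use js' E_gen in auto)
    have "X_expr \<Phi> \<alpha> H T is \<sigma> = Y \<cdot> T \<sigma>" unfolding X_expr_def Y_def by (rule X_expr_from_factor[OF id js' sW])
    then have "inv\<^bsub>H\<^esub> Y \<cdot> X_expr \<Phi> \<alpha> H T is \<sigma> = T \<sigma>"
      using T_closed[OF sW] Y by (simp add: U_def HR.m_assoc[symmetric] HR.Units_closed)
    moreover have "inv\<^bsub>H\<^esub> Y \<in> E" using Y by (simp add: U_def)
    ultimately show ?thesis using E_mult[OF _ X] by metis
  qed
  have E_T: "T w \<in> E" if "w \<in> We" for w
    using that
  proof (induction rule: We_length_induct)
    case (stab \<sigma>) then show ?case by (rule E_stab)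
  next
    case (step i u)
    then show ?case using E_mult[OF E_gen[OF step(1)] step(4)] T_mult[OF s_We[OF step(1)] step(2,3)] by (simp add: comp_def)
  qed
  have "x \<in> E" if "x \<in> carrier H" for x
    using that
  proof (induction rule: hecke_induct)
    case zero show ?case using E_scale[OF E_one, of 0] smult_zero[OF HR.one_closed] by simp
  next
    case (add w r y) then show ?case using E_add E_scale E_T by blast
  qed
  then have "\<psi> x = \<psi>' x" if "x \<in> carrier H" for x using that by (auto simp: E_def)
  moreover have "\<psi> \<in> extensional (carrier H)" "\<psi>' \<in> extensional (carrier H)" using 1 2 unfolding is_psi_def by auto
  ultimately show ?thesis by (intro extensionalityI)
qed

end

section \<open>Signed crossings\<close>

lemma Units_laurent_iff: "(x :: 'r::comm_ring_1) \<in> Units ring_of_type_algebra \<longleftrightarrow> (\<exists>y. x * y = 1)"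
  by (auto simp: Units_def mult.commute)

lemma laurent_int_pow:
  fixes a b :: "'r::comm_ring_1"
  assumes "a * b = 1"
  shows "a [^]\<^bsub>ring_of_type_algebra\<^esub> (z::int) = (if z < 0 then b ^ nat (- z) else a ^ nat z)"
proof -
  interpret R: cring "ring_of_type_algebra :: 'r ring" by (rule cring_from_type_algebra)
  have pow: "x [^]\<^bsub>ring_of_type_algebra\<^esub> n = x ^ n" for x :: 'r and n :: nat
    by (induction n) (simp_all add: mult.commute)
  have "a ^ n * b ^ n = 1" for n using assms by (simp add: power_mult_distrib[symmetric])
  then have "inv\<^bsub>ring_of_type_algebra\<^esub> (a ^ n) = b ^ n" for n
    by (intro R.comm_inv_char) auto
  then show ?thesis by (simp add: int_pow_def2 pow)
qed

lemma laurent_int_pow_add_one: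
  fixes a :: "'r::comm_ring_1"
  assumes "a \<in> Units ring_of_type_algebra"
  shows "a [^]\<^bsub>ring_of_type_algebra\<^esub> ((z::int) + 1) = a [^]\<^bsub>ring_of_type_algebra\<^esub> z * a"
proof -
  obtain b where b: "a * b = 1" using assms Units_laurent_iff by blast
  show ?thesis
  proof (cases "z < 0")
    case True
    then have "nat (- z) = Suc (nat (- (z + 1)))" by simp
    moreover have "b ^ Suc n * a = b ^ n" for n
    proof -
      have "b ^ Suc n * a = (a * b) * b ^ n" by (simp only: power_Suc ac_simps)
      then show ?thesis using b by simp
    qed
    ultimately show ?thesis using True b by (cases "z = - 1") (simp_all add: laurent_int_pow[OF b] ac_simps)
  next
    case False
    then have "nat (z + 1) = Suc (nat z)" by simp
    then show ?thesis using False by (simp add: laurent_int_pow[OF b] mult.commute)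
  qed
qed

context based_root_system
begin

text \<open>The hyperplanes in one direction are counted by the change of a floor; genericity of \<open>y\<close> excludes
  the boundary case.\<close>

lemma crossing_fiber:
  assumes "generic y" "\<beta> \<in> \<Phi>"
  shows "{m. (\<beta>, m) \<in> crossings x y} = {\<lfloor>x \<bullet> \<beta>\<rfloor><..\<lfloor>y \<bullet> \<beta>\<rfloor>}"
proof -
  have le: "of_int m < y \<bullet> \<beta> \<longleftrightarrow> m \<le> \<lfloor>y \<bullet> \<beta>\<rfloor>" for m
    unfolding le_floor_iff using genericD[OF assms, of m] by linarith
  show ?thesis
  proof (rule Set.set_eqI)
    fix m
    have "(\<beta>, m) \<in> crossings x y \<longleftrightarrow> \<lfloor>x \<bullet> \<beta>\<rfloor> < m \<and> m \<le> \<lfloor>y \<bullet> \<beta>\<rfloor>"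
      unfolding mem_crossings le floor_less_iff using assms(2) by blast
    then show "m \<in> {m. (\<beta>, m) \<in> crossings x y} \<longleftrightarrow> m \<in> {\<lfloor>x \<bullet> \<beta>\<rfloor><..\<lfloor>y \<bullet> \<beta>\<rfloor>}"
      unfolding mem_Collect_eq greaterThanAtMost_iff .
  qed
qed

lemma floor_eq_if_no_crossing:
  assumes "generic x" "generic y" "\<beta> \<in> \<Phi>"
    and "\<And>m. (\<beta>, m) \<notin> crossings x y" "\<And>m. (- \<beta>, m) \<notin> crossings x y"
  shows "\<lfloor>y \<bullet> \<beta>\<rfloor> = \<lfloor>x \<bullet> \<beta>\<rfloor>"
proof -
  have "{m. (\<beta>, m) \<in> crossings y x} = {}"
  proof (safe; simp)
    fix m assume "(\<beta>, m) \<in> crossings y x"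
    then have "(- \<beta>, - m) \<in> crossings x y" by (auto simp: mem_crossings root_minus)
    then show False using assms(5) by blast
  qed
  then have "{\<lfloor>y \<bullet> \<beta>\<rfloor><..\<lfloor>x \<bullet> \<beta>\<rfloor>} = {}" using crossing_fiber[OF assms(1,3)] by simp
  moreover have "{m. (\<beta>, m) \<in> crossings x y} = {}" using assms(4) by blast
  then have "{\<lfloor>x \<bullet> \<beta>\<rfloor><..\<lfloor>y \<bullet> \<beta>\<rfloor>} = {}" using crossing_fiber[OF assms(2,3)] by simp
  ultimately show ?thesis by simp
qed

text \<open>Crossing a wall in the direction of a positive root \<open>\<beta>\<close> raises the floors along \<open>\<beta>\<close> and, when it
  is a root, along \<open>2 \<beta>\<close> by one, and leaves all the others unchanged.\<close>

lemma wall_crossing_floors: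
  assumes u: "u \<in> We" and i: "i \<in> {0..DIM('a)}" and b: "lin u (wall_root i) \<in> pos" and g: "\<gamma> \<in> pos"
  defines "\<beta> \<equiv> lin u (wall_root i)"
  shows "\<lfloor>u (s i p) \<bullet> \<gamma>\<rfloor> = \<lfloor>u p \<bullet> \<gamma>\<rfloor> + (if \<gamma> = \<beta> \<or> \<gamma> = 2 *\<^sub>R \<beta> then 1 else 0)"
proof -
  have l: "linear (lin u)" by (rule W0_linear[OF We_parts(1)[OF u]])
  have gx: "generic (u p)" by (rule generic_orbit[OF u])
  have gy: "generic (u (s i p))" using generic_orbit[OF We_comp[OF u s_We[OF i]]] by simp
  have gr: "\<gamma> \<in> \<Phi>" using g pos_rootD by blast
  have im: "crossings (u p) (u (s i p)) = act u ` crossings p (s i p)"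
    using crossings_act[OF u] by (simp add: bij_betw_def)
  define lev where "lev c = \<lfloor>c\<rfloor> * wall_level i + \<lfloor>u 0 \<bullet> (c *\<^sub>R \<beta>)\<rfloor>" for c :: real
  have S: "crossings (u p) (u (s i p)) = {(c *\<^sub>R \<beta>, lev c) | c. c \<in> {1, 2} \<and> c *\<^sub>R wall_root i \<in> \<Phi>}"
    unfolding im crossings_generator[OF i] setcompr_eq_image image_image
    by (intro image_cong refl) (simp add: act_def linear_cmul[OF l] \<beta>_def lev_def)
  have mem: "c *\<^sub>R wall_root i \<in> \<Phi> \<longleftrightarrow> c *\<^sub>R \<beta> \<in> \<Phi>" for c
    unfolding \<beta>_def using W0_root_iff[OF We_parts(1)[OF u], of "c *\<^sub>R wall_root i"] linear_cmul[OF l] by simp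
  have bz: "\<beta> \<noteq> 0" using b root_nonzero pos_rootD unfolding \<beta>_def by blast
  have neg: "(- \<gamma>, m) \<notin> crossings (u p) (u (s i p))" for m
  proof
    assume "(- \<gamma>, m) \<in> crossings (u p) (u (s i p))"
    then obtain c where c: "c = 1 \<or> c = 2" "- \<gamma> = c *\<^sub>R \<beta>" unfolding S by auto
    have "height (- \<gamma>) < 0" using height_pos[OF pos_rootD(2)[OF g] root_nonzero[OF gr]] by (simp add: height_minus)
    moreover have "height (c *\<^sub>R \<beta>) > 0"
      using height_pos[OF pos_rootD(2)[OF b] root_nonzero[OF pos_rootD(1)[OF b]]] c(1) by (auto simp: height_scale \<beta>_def)
    ultimately show False using c(2) by simp
  qed
  show ?thesis
  proof (cases "\<gamma> = \<beta> \<or> \<gamma> = 2 *\<^sub>R \<beta>")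
    case True
    then obtain c where c: "c \<in> {1, 2}" "\<gamma> = c *\<^sub>R \<beta>" by force
    have "{m. (\<gamma>, m) \<in> crossings (u p) (u (s i p))} = {lev c}"
      unfolding S mem using c gr bz by auto
    then have "{\<lfloor>u p \<bullet> \<gamma>\<rfloor><..\<lfloor>u (s i p) \<bullet> \<gamma>\<rfloor>} = {lev c}" using crossing_fiber[OF gy gr] by simp
    then have "card {\<lfloor>u p \<bullet> \<gamma>\<rfloor><..\<lfloor>u (s i p) \<bullet> \<gamma>\<rfloor>} = 1" by simp
    then show ?thesis using True by simp
  next
    case False
    then have "(\<gamma>, m) \<notin> crossings (u p) (u (s i p))" for m unfolding S by auto
    from floor_eq_if_no_crossing[OF gx gy gr this neg] show ?thesis using False by simp
  qed
qed

text \<open>The same crossing read backwards: the way from \<open>u s\<^sub>i p\<close> to \<open>u p\<close> is a wall crossing for the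
  element \<open>u s\<^sub>i\<close>, and \<open>s\<^sub>i\<close> changes the sign of its wall root.\<close>

lemma wall_crossing_floors':
  assumes u: "u \<in> We" and i: "i \<in> {0..DIM('a)}" and b: "- lin u (wall_root i) \<in> pos" and g: "\<gamma> \<in> pos"
  defines "\<beta> \<equiv> - lin u (wall_root i)"
  shows "\<lfloor>u p \<bullet> \<gamma>\<rfloor> = \<lfloor>u (s i p) \<bullet> \<gamma>\<rfloor> + (if \<gamma> = \<beta> \<or> \<gamma> = 2 *\<^sub>R \<beta> then 1 else 0)"
proof -
  have us: "u \<circ> s i \<in> We" by (rule We_comp[OF u s_We[OF i]])
  have l: "linear (lin u)" by (rule W0_linear[OF We_parts(1)[OF u]])
  have "lin (s i) (wall_root i) = - wall_root i"
  proof (cases "i = 0")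
    case True
    have "lin (s 0) = refl \<theta>" unfolding s_zero by (rule transl_comp_parts[OF W0_refl_root[OF highest_root(1)]])
    then show ?thesis using True refl_self[OF root_nonzero[OF highest_root(1)]] by (simp add: wall_root_def)
  next
    case False
    then have j: "i \<in> {1..DIM('a)}" using i by auto
    have "lin (s i) x = refl (\<alpha> i) x" for x
      by (simp add: lin_def gen_refl_node[OF j] linear_0[OF refl_linear])
    then show ?thesis using False refl_self[OF root_nonzero[OF simple_root[OF j]]] linear_neg[OF refl_linear]
      by (simp add: wall_root_def)
  qed
  moreover have "lin (u \<circ> s i) x = lin u (lin (s i) x)" for x
  proof -
    have "lin (u \<circ> s i) x = (lin u (s i x) + u 0) - (lin u (s i 0) + u 0)"
      unfolding lin_def[of "u \<circ> s i"] comp_apply We_parts(4)[OF u, symmetric] ..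
    then show ?thesis unfolding lin_def[of "s i"] linear_diff[OF l] by simp
  qed
  ultimately have e: "lin (u \<circ> s i) (wall_root i) = \<beta>" unfolding \<beta>_def by (simp add: linear_neg[OF l])
  have "lin (u \<circ> s i) (wall_root i) \<in> pos" unfolding e using b \<beta>_def by simp
  from wall_crossing_floors[OF us i this g] show ?thesis unfolding e by (simp add: s_involution)
qed

text \<open>The sign of a crossing is positive exactly when the outward wall root of the alcove that is left is
  positive.\<close>

lemma crossing_sign_wall:
  assumes u: "u \<in> We" and i: "i \<in> {0..DIM('a)}"
  shows "crossing_sign \<Phi> \<alpha> u i = (if lin u (wall_root i) \<in> pos then 1 else - 1)"
proof -
  have l: "linear (lin u)" by (rule W0_linear[OF We_parts(1)[OF u]])
  define \<beta> where "\<beta> = lin u (wall_root i)"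
  have b: "\<beta> \<in> \<Phi>" unfolding \<beta>_def by (rule W0_root[OF We_parts(1)[OF u] wall_root[OF i]])
  have im: "crossings (u p) (u (s i p)) = act u ` crossings p (s i p)"
    using crossings_act[OF u] by (simp add: bij_betw_def)
  have "(\<exists>\<gamma>\<in>pos. \<exists>m. (\<gamma>, m) \<in> crossings (u p) (u (s i p))) \<longleftrightarrow> \<beta> \<in> pos"
  proof
    assume "\<beta> \<in> pos"
    moreover have "act u (wall_root i, wall_level i) \<in> crossings (u p) (u (s i p))" unfolding im using wall_crossing[OF i] by blast
    ultimately show "\<exists>\<gamma>\<in>pos. \<exists>m. (\<gamma>, m) \<in> crossings (u p) (u (s i p))" by (auto simp: act_def \<beta>_def)
  next
    assume "\<exists>\<gamma>\<in>pos. \<exists>m. (\<gamma>, m) \<in> crossings (u p) (u (s i p))"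
    then obtain \<gamma> m where g: "\<gamma> \<in> pos" "(\<gamma>, m) \<in> crossings (u p) (u (s i p))" by blast
    then obtain c where c: "c = 1 \<or> c = 2" "(\<gamma>, m) = act u (c *\<^sub>R wall_root i, \<lfloor>c\<rfloor> * wall_level i)"
      unfolding im crossings_generator[OF i] by blast
    then have g': "\<gamma> = c *\<^sub>R \<beta>" by (simp add: act_def linear_cmul[OF l] \<beta>_def)
    show "\<beta> \<in> pos"
    proof (rule ccontr)
      assume "\<beta> \<notin> pos"
      then have m: "- \<beta> \<in> pos" using root_cases b by blast
      have "height (- \<beta>) > 0" "height \<gamma> > 0"
        using height_pos[OF pos_rootD(2)[OF m] root_nonzero[OF pos_rootD(1)[OF m]]] height_pos[OF pos_rootD(2)[OF g(1)] root_nonzero[OF pos_rootD(1)[OF g(1)]]]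
        by linarith+
      then show False using c(1) g' by (auto simp: height_minus height_scale)
    qed
  qed
  then show ?thesis unfolding crossing_sign_eq[OF u i] \<beta>_def by simp
qed

section \<open>Existence of the representation\<close>

text \<open>The class of \<open>\<mu>\<close> in \<open>P / Q\<close>.\<close>

abbreviation cls :: "'a \<Rightarrow> 'a set" where "cls \<mu> \<equiv> coroot_lattice \<Phi> #>\<^bsub>coweight_group \<alpha>\<^esub> \<mu>"

lemma cls_alt: "cls \<mu> = (\<lambda>h. h + \<mu>) ` Q"
  by (auto simp: r_coset_def coweight_group_def)

lemma cls_eq: assumes "\<mu> - \<nu> \<in> Q" shows "cls \<mu> = cls \<nu>"
proof -
  have "cls \<mu> \<subseteq> cls \<nu>" if "\<mu> - \<nu> \<in> Q" for \<mu> \<nu>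
  proof
    fix x assume "x \<in> cls \<mu>"
    then obtain h where h: "h \<in> Q" "x = h + \<mu>" unfolding cls_alt by blast
    then have "x = (h + (\<mu> - \<nu>)) + \<nu>" by simp
    then show "x \<in> cls \<nu>" unfolding cls_alt using Q_add[OF h(1) that] by blast
  qed
  from this[OF assms] this[of \<nu> \<mu>] Q_minus[OF assms] show ?thesis by simp
qed

lemma cls_mult: "cls \<mu> <#>\<^bsub>coweight_group \<alpha>\<^esub> cls \<nu> = cls (\<mu> + \<nu>)"
proof
  show "cls \<mu> <#>\<^bsub>coweight_group \<alpha>\<^esub> cls \<nu> \<subseteq> cls (\<mu> + \<nu>)"
  proof
    fix x assume "x \<in> cls \<mu> <#>\<^bsub>coweight_group \<alpha>\<^esub> cls \<nu>"
    then obtain h k where hk: "h \<in> Q" "k \<in> Q" "x = (h + \<mu>) + (k + \<nu>)"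
      unfolding cls_alt set_mult_def by (auto simp: coweight_group_def)
    then have "x = (h + k) + (\<mu> + \<nu>)" by (simp add: algebra_simps)
    then show "x \<in> cls (\<mu> + \<nu>)" unfolding cls_alt using Q_add[OF hk(1,2)] by blast
  qed
  show "cls (\<mu> + \<nu>) \<subseteq> cls \<mu> <#>\<^bsub>coweight_group \<alpha>\<^esub> cls \<nu>"
  proof
    fix x assume "x \<in> cls (\<mu> + \<nu>)"
    then obtain h where h: "h \<in> Q" "x = (h + \<mu>) + (0 + \<nu>)" unfolding cls_alt by auto
    then show "x \<in> cls \<mu> <#>\<^bsub>coweight_group \<alpha>\<^esub> cls \<nu>"
      unfolding cls_alt set_mult_def using Q_zero by (force simp: coweight_group_def)
  qed
qed

lemma cls_zero: "cls 0 = Q"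
  by (simp add: cls_alt)

lemma cls_carrier: "\<mu> \<in> P \<Longrightarrow> cls \<mu> \<in> carrier (coweight_group \<alpha> Mod Q)"
  by (auto simp: FactGroup_def RCOSETS_def coweight_group_def)

lemma cls_comp:
  assumes "w \<in> We" "u \<in> We" shows "cls ((w \<circ> u) 0) = cls (w 0 + u 0)"
proof (rule cls_eq)
  have e: "(w \<circ> u) 0 - (w 0 + u 0) = lin w (u 0) - u 0"
    by (simp add: lin_def algebra_simps)
  show "(w \<circ> u) 0 - (w 0 + u 0) \<in> Q"
    unfolding e by (rule W0_acts_trivially_mod_Q[OF We_parts(2)[OF assms(2)] We_parts(1)[OF assms(1)]])
qed

lemma cls_generator:
  assumes "i \<in> {0..DIM('a)}" shows "cls (s i 0) = cls 0"
proof (rule cls_eq, cases "i = 0")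
  case True
  then show "s i 0 - 0 \<in> Q"
    using Q_coroot[OF highest_root(1), of 1] by (simp add: gen_refl_def aff_refl_def)
next
  case False
  then show "s i 0 - 0 \<in> Q" by (simp add: gen_refl_def aff_refl_def Q_zero)
qed

abbreviation Z :: "(laurent, 'a zeta_elt) module" where "Z \<equiv> zeta_ring \<Phi> \<alpha>"
abbreviation gdot :: "'a set \<Rightarrow> 'a set \<Rightarrow> 'a set" where "gdot \<equiv> monoid.mult (coweight_group \<alpha> Mod Q)"

lemma zeta_ring_simps:
  "carrier Z = {f. Poly_Mapping.keys f \<subseteq> carrier (coweight_group \<alpha> Mod Q)}"
  "f \<otimes>\<^bsub>Z\<^esub> h = (\<Sum>x\<in>Poly_Mapping.keys f. \<Sum>y\<in>Poly_Mapping.keys h.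
     Poly_Mapping.single (gdot x y) (Poly_Mapping.lookup f x * Poly_Mapping.lookup h y))"
  "f \<oplus>\<^bsub>Z\<^esub> h = f + h"
  "r \<odot>\<^bsub>Z\<^esub> f = Poly_Mapping.map ((*) r) f"
  "\<one>\<^bsub>Z\<^esub> = Poly_Mapping.single (cls 0) 1"
  by (simp_all add: zeta_ring_def group_ring_def cls_zero FactGroup_def)

text \<open>Enlarging the index sets beyond the supports adds zero terms only.  With common index sets for two
  factors the product becomes visibly bilinear.\<close>

lemma zeta_mult_superset:
  assumes "finite A" "Poly_Mapping.keys f \<subseteq> A" "finite B" "Poly_Mapping.keys h \<subseteq> B"
  shows "f \<otimes>\<^bsub>Z\<^esub> h = (\<Sum>x\<in>A. \<Sum>y\<in>B. Poly_Mapping.single (gdot x y) (Poly_Mapping.lookup f x * Poly_Mapping.lookup h y))"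
proof -
  have "(\<Sum>y\<in>Poly_Mapping.keys h. Poly_Mapping.single (gdot x y) (Poly_Mapping.lookup f x * Poly_Mapping.lookup h y))
      = (\<Sum>y\<in>B. Poly_Mapping.single (gdot x y) (Poly_Mapping.lookup f x * Poly_Mapping.lookup h y))" for x
    by (rule sum.mono_neutral_left) (use assms in \<open>auto simp: in_keys_iff\<close>)
  then have "f \<otimes>\<^bsub>Z\<^esub> h = (\<Sum>x\<in>Poly_Mapping.keys f. \<Sum>y\<in>B. Poly_Mapping.single (gdot x y) (Poly_Mapping.lookup f x * Poly_Mapping.lookup h y))"
    by (simp add: zeta_ring_simps)
  also have "\<dots> = (\<Sum>x\<in>A. \<Sum>y\<in>B. Poly_Mapping.single (gdot x y) (Poly_Mapping.lookup f x * Poly_Mapping.lookup h y))"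
    by (rule sum.mono_neutral_left) (use assms in \<open>auto simp: in_keys_iff\<close>)
  finally show ?thesis .
qed

lemma zeta_mult_add:
  "(f + g) \<otimes>\<^bsub>Z\<^esub> h = f \<otimes>\<^bsub>Z\<^esub> h + g \<otimes>\<^bsub>Z\<^esub> h"
  "h \<otimes>\<^bsub>Z\<^esub> (f + g) = h \<otimes>\<^bsub>Z\<^esub> f + h \<otimes>\<^bsub>Z\<^esub> g"
proof -
  let ?A = "Poly_Mapping.keys f \<union> Poly_Mapping.keys g"
  have A: "finite ?A" "Poly_Mapping.keys f \<subseteq> ?A" "Poly_Mapping.keys g \<subseteq> ?A" "Poly_Mapping.keys (f + g) \<subseteq> ?A"
    using keys_add[of f g] by auto
  note h = finite_keys[of h] order.refl[of "Poly_Mapping.keys h"]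
  show "(f + g) \<otimes>\<^bsub>Z\<^esub> h = f \<otimes>\<^bsub>Z\<^esub> h + g \<otimes>\<^bsub>Z\<^esub> h"
    unfolding zeta_mult_superset[OF A(1,2) h] zeta_mult_superset[OF A(1,3) h] zeta_mult_superset[OF A(1,4) h]
    by (simp add: lookup_add distrib_right single_add sum.distrib)
  show "h \<otimes>\<^bsub>Z\<^esub> (f + g) = h \<otimes>\<^bsub>Z\<^esub> f + h \<otimes>\<^bsub>Z\<^esub> g"
    unfolding zeta_mult_superset[OF h A(1,2)] zeta_mult_superset[OF h A(1,3)] zeta_mult_superset[OF h A(1,4)]
    by (simp add: lookup_add distrib_left single_add sum.distrib)
qed

lemma lookup_scale: "Poly_Mapping.lookup (Poly_Mapping.map ((*) r) f) x = r * Poly_Mapping.lookup f x" for r :: laurent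
  by (simp add: Poly_Mapping.map.rep_eq when_def)

lemma map_scale_add: "Poly_Mapping.map ((*) r) (f + g) = Poly_Mapping.map ((*) r) f + Poly_Mapping.map ((*) (r::laurent)) g"
  by (rule poly_mapping_eqI) (simp add: lookup_scale lookup_add distrib_left)

lemma map_scale_sum: "finite A \<Longrightarrow> Poly_Mapping.map ((*) r) (sum f A) = (\<Sum>x\<in>A. Poly_Mapping.map ((*) (r::laurent)) (f x))"
proof (induction A rule: finite_induct)
  case empty show ?case by (rule poly_mapping_eqI) (simp add: lookup_scale)
qed (simp add: map_scale_add)

lemma zeta_mult_scale:
  "Poly_Mapping.map ((*) r) f \<otimes>\<^bsub>Z\<^esub> h = Poly_Mapping.map ((*) r) (f \<otimes>\<^bsub>Z\<^esub> h)"
  "h \<otimes>\<^bsub>Z\<^esub> Poly_Mapping.map ((*) r) f = Poly_Mapping.map ((*) r) (h \<otimes>\<^bsub>Z\<^esub> f)"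
proof -
  have k: "Poly_Mapping.keys (Poly_Mapping.map ((*) r) f) \<subseteq> Poly_Mapping.keys f"
    by (auto simp: in_keys_iff Poly_Mapping.map.rep_eq when_def split: if_splits)
  note h = finite_keys[of h] order.refl[of "Poly_Mapping.keys h"]
  show "Poly_Mapping.map ((*) r) f \<otimes>\<^bsub>Z\<^esub> h = Poly_Mapping.map ((*) r) (f \<otimes>\<^bsub>Z\<^esub> h)"
    unfolding zeta_mult_superset[OF finite_keys k h] unfolding lookup_scale zeta_ring_simps(2)
    by (simp add: map_scale_sum mult.assoc)
  show "h \<otimes>\<^bsub>Z\<^esub> Poly_Mapping.map ((*) r) f = Poly_Mapping.map ((*) r) (h \<otimes>\<^bsub>Z\<^esub> f)"
    unfolding zeta_mult_superset[OF h finite_keys k] unfolding lookup_scale zeta_ring_simps(2)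
    by (simp add: map_scale_sum mult.left_commute)
qed

lemma zeta_mult_single:
  "Poly_Mapping.single (cls \<mu>) a \<otimes>\<^bsub>Z\<^esub> Poly_Mapping.single (cls \<nu>) b = Poly_Mapping.single (cls (\<mu> + \<nu>)) (a * b)"
  using zeta_mult_superset[of "{cls \<mu>}" "Poly_Mapping.single (cls \<mu>) a" "{cls \<nu>}" "Poly_Mapping.single (cls \<nu>) b"] cls_mult[of \<mu> \<nu>]
  by (simp add: FactGroup_def)

end

locale hecke_character = hecke_algebra \<Phi> \<alpha> L H T
  for \<Phi> :: "'a::euclidean_space set" and \<alpha> L and H :: "(laurent, 'h) module" and T +
  fixes v :: "'a \<Rightarrow> laurent"
  assumes v_unit: "\<And>\<beta>. \<beta> \<in> \<Phi> \<Longrightarrow> v \<beta> \<in> Units laurent_ring"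
    and v_nonroot: "\<And>\<beta>. \<beta> \<notin> \<Phi> \<Longrightarrow> v \<beta> = 1"
    and v_W0: "\<And>g \<beta>. g \<in> W0 \<Longrightarrow> v (g \<beta>) = v \<beta>"
    and v_generator: "\<And>i. i \<in> {0..DIM('a)} \<Longrightarrow> v (wall_root i) * v (2 *\<^sub>R wall_root i) \<in>
      {qpow (int (L (s i))), - qpow (- int (L (s i)))}"
begin

text \<open>The scalar to which \<open>T\<close> of the \<open>i\<close>-th generator is sent; the second factor is \<open>1\<close> unless the wall root can
  be doubled.\<close>

definition gen_value :: "nat \<Rightarrow> laurent" where
  "gen_value i = v (wall_root i) * v (2 *\<^sub>R wall_root i)"

text \<open>The scalar part of \<open>\<psi> (T w)\<close>: each hyperplane separating \<open>A\<^sub>0\<close> from \<open>w A\<^sub>0\<close> contributes its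
  parameter.  A hyperplane of a root \<open>\<beta>\<close> that can be doubled contributes \<open>v\<^sub>\<beta> v\<^sub>2\<^sub>\<beta>\<close>, being counted for
  both roots, and the remaining hyperplanes of \<open>2 \<beta>\<close> contribute \<open>v\<^sub>2\<^sub>\<beta>\<close>.  These are the values at the
  conjugates of \<open>T\<^sub>n\<close> and \<open>T\<^sub>0\<close> in type \<open>BC\<^sub>n\<close>.\<close>

definition T_value :: "('a \<Rightarrow> 'a) \<Rightarrow> laurent" where
  "T_value w = (\<Prod>c\<in>crossings p (w p). v (fst c))"

lemma v_minus: "v (- \<beta>) = v \<beta>"
proof (cases "\<beta> \<in> \<Phi>")
  case True
  then show ?thesis using v_W0[OF W0_refl_root[OF True], of \<beta>] refl_self[OF root_nonzero[OF True]] by simp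
next
  case False
  then have "- \<beta> \<notin> \<Phi>" using root_minus[of "- \<beta>"] by auto
  then show ?thesis using False v_nonroot by simp
qed

text \<open>Both admissible values \<open>q\<^sub>i\<close> and \<open>- q\<^sub>i\<^sup>-\<^sup>1\<close> are roots of the quadratic relation of \<open>T\<^sub>i\<close>.\<close>

lemma gen_value_square:
  assumes "i \<in> {0..DIM('a)}" shows "gen_value i * gen_value i = 1 + qgap i * gen_value i"
proof -
  let ?a = "qpow (int (L (s i)))" and ?b = "qpow (- int (L (s i)))"
  have ab: "?a * ?b = 1" by (simp add: qpow_def mult_single)
  have "gen_value i = ?a \<or> gen_value i = - ?b" using v_generator[OF assms] by (simp add: gen_value_def)
  then show ?thesis using ab by (auto simp: qgap_def algebra_simps)
qed

lemma T_value_stab: "\<sigma> \<in> alcove_stab \<Phi> \<alpha> \<Longrightarrow> T_value \<sigma> = 1"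
  by (simp add: T_value_def alcove_stab_iff)

lemma prod_crossings_act:
  assumes "w \<in> We" shows "(\<Prod>c\<in>crossings (w x) (w y). v (fst c)) = (\<Prod>c\<in>crossings x y. v (fst c))"
  using prod.reindex_bij_betw[OF crossings_act[OF assms], of "\<lambda>c. v (fst c)"]
  by (simp add: fst_act v_W0[OF We_parts(1)[OF assms]])

lemma prod_crossings_swap: "(\<Prod>c\<in>crossings y x. v (fst c)) = (\<Prod>c\<in>crossings x y. v (fst c))"
  using prod.reindex_bij_betw[OF crossings_swap, of "\<lambda>c. v (fst c)" x y]
  by (simp add: case_prod_beta v_minus)

lemma T_value_generator:
  assumes i: "i \<in> {0..DIM('a)}" shows "T_value (s i) = gen_value i"
proof -
  have nz: "wall_root i \<noteq> 0" using wall_root[OF i] root_nonzero by blast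
  show ?thesis
  proof (cases "2 *\<^sub>R wall_root i \<in> \<Phi>")
    case True
    then have "crossings p (s i p) = {(wall_root i, wall_level i), (2 *\<^sub>R wall_root i, 2 * wall_level i)}"
      unfolding crossings_generator[OF i] using wall_root[OF i] by force
    moreover have "wall_root i \<noteq> 2 *\<^sub>R wall_root i" using nz by (simp add: scaleR_2)
    ultimately show ?thesis by (simp add: T_value_def gen_value_def)
  next
    case False
    then have "crossings p (s i p) = {(wall_root i, wall_level i)}"
      unfolding crossings_generator[OF i] using wall_root[OF i] by force
    then show ?thesis using v_nonroot[OF False] by (simp add: T_value_def gen_value_def)
  qed
qed

lemma T_value_right_stab:
  "w \<in> We \<Longrightarrow> \<sigma> \<in> alcove_stab \<Phi> \<alpha> \<Longrightarrow> T_value (w \<circ> \<sigma>) = T_value w"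
  by (simp add: T_value_def wlen_right_stab)

lemma T_value_right_step:
  assumes w: "w \<in> We" and i: "i \<in> {0..DIM('a)}"
  shows "(wlen \<Phi> \<alpha> (w \<circ> s i) = wlen \<Phi> \<alpha> w + 1 \<and> T_value (w \<circ> s i) = T_value w * gen_value i) \<or>
         (wlen \<Phi> \<alpha> w = wlen \<Phi> \<alpha> (w \<circ> s i) + 1 \<and> T_value w = T_value (w \<circ> s i) * gen_value i)"
proof -
  have 1: "(\<Prod>c\<in>crossings (w p) (w (s i p)). v (fst c)) = gen_value i"
    using prod_crossings_act[OF w] T_value_generator[OF i] by (simp add: T_value_def)
  then have 2: "(\<Prod>c\<in>crossings (w (s i p)) (w p). v (fst c)) = gen_value i"
    using prod_crossings_swap[of "w (s i p)" "w p"] by simp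
  note un = prod.union_disjoint[OF finite_crossings finite_crossings, of _ _ _ _ "\<lambda>c. v (fst c)"]
  from right_step_wlen[OF w i] show ?thesis
    using un[of p "w p" "w p" "w (s i p)"] un[of p "w (s i p)" "w (s i p)" "w p"] 1 2
    unfolding T_value_def comp_apply by metis
qed

definition psi_coord :: "(('a \<Rightarrow> 'a) \<Rightarrow>\<^sub>0 laurent) \<Rightarrow> 'a zeta_elt" where
  "psi_coord c = (\<Sum>w\<in>Poly_Mapping.keys c. Poly_Mapping.single (cls (w 0)) (Poly_Mapping.lookup c w * T_value w))"

text \<open>The representation, defined on the basis by the scalar \<open>T_value w\<close> and the class of \<open>w 0\<close>, and extended
  linearly.\<close>

definition Psi :: "'h \<Rightarrow> 'a zeta_elt" where "Psi x = psi_coord (coord x)"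

lemma psi_coord_superset:
  assumes "finite A" "Poly_Mapping.keys c \<subseteq> A"
  shows "psi_coord c = (\<Sum>w\<in>A. Poly_Mapping.single (cls (w 0)) (Poly_Mapping.lookup c w * T_value w))"
  unfolding psi_coord_def by (rule sum.mono_neutral_left) (use assms in \<open>auto simp: in_keys_iff\<close>)

lemma psi_coord_add: "psi_coord (c + d) = psi_coord c + psi_coord d"
proof -
  let ?A = "Poly_Mapping.keys c \<union> Poly_Mapping.keys d"
  have A: "finite ?A" "Poly_Mapping.keys c \<subseteq> ?A" "Poly_Mapping.keys d \<subseteq> ?A" "Poly_Mapping.keys (c + d) \<subseteq> ?A"
    using keys_add[of c d] by auto
  show ?thesis
    unfolding psi_coord_superset[OF A(1,2)] psi_coord_superset[OF A(1,3)] psi_coord_superset[OF A(1,4)]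
    by (simp add: lookup_add distrib_right single_add sum.distrib)
qed

lemma psi_coord_scale: "psi_coord (Poly_Mapping.map ((*) r) c) = Poly_Mapping.map ((*) r) (psi_coord c)"
proof -
  have k: "Poly_Mapping.keys (Poly_Mapping.map ((*) r) c) \<subseteq> Poly_Mapping.keys c"
    by (auto simp: in_keys_iff lookup_scale)
  show ?thesis
    unfolding psi_coord_superset[OF finite_keys k] unfolding psi_coord_def lookup_scale
    by (simp add: map_scale_sum mult.assoc)
qed

lemma Psi_add: "x \<in> carrier H \<Longrightarrow> y \<in> carrier H \<Longrightarrow> Psi (x \<boxplus> y) = Psi x + Psi y"
  by (simp add: Psi_def coord_add psi_coord_add)

lemma Psi_scale: "x \<in> carrier H \<Longrightarrow> Psi (r \<star> x) = Poly_Mapping.map ((*) r) (Psi x)"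
  by (simp add: Psi_def coord_scale psi_coord_scale)

lemma Psi_T: "w \<in> We \<Longrightarrow> Psi (T w) = Poly_Mapping.single (cls (w 0)) (T_value w)"
  by (simp add: Psi_def coord_T psi_coord_def)

lemma Psi_one: "Psi \<one>\<^bsub>H\<^esub> = Poly_Mapping.single (cls 0) 1"
  using Psi_T[OF W0_We[OF W0_id]] T_id T_value_stab[OF id_stab] by simp

lemma Psi_zero: "Psi \<zero>\<^bsub>H\<^esub> = 0"
  using Psi_scale[OF HR.one_closed, of 0] smult_zero[OF HR.one_closed] Psi_one by simp

lemma Psi_closed: assumes "x \<in> carrier H" shows "Psi x \<in> carrier Z"
proof -
  have "Poly_Mapping.keys (Psi x) \<subseteq> (\<Union>w\<in>Poly_Mapping.keys (coord x). {cls (w 0)})"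
    unfolding Psi_def psi_coord_def by (rule order_trans[OF keys_sum]) (intro UN_mono order.refl, simp)
  then show ?thesis using coord(1)[OF assms] cls_carrier We_parts(2) by (auto simp: zeta_ring_simps)
qed

text \<open>Multiplicativity of \<open>Psi\<close> is reached by induction on the right factor \<open>T u\<close>, for all left factors at once:
  a product \<open>T w \<cdot> T i\<close> is in general a combination of two basis elements, so the induction hypothesis has to
  cover every element of the algebra on the left.\<close>

definition right_multiplicative :: "('a \<Rightarrow> 'a) \<Rightarrow> bool" where
  "right_multiplicative u \<longleftrightarrow> (\<forall>x\<in>carrier H. Psi (x \<cdot> T u) = Psi x \<otimes>\<^bsub>Z\<^esub> Psi (T u))"

lemma zeta_zero_mult: "0 \<otimes>\<^bsub>Z\<^esub> f = 0"
  by (simp add: zeta_ring_simps)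

lemma right_multiplicativeI:
  assumes u: "u \<in> We" and "\<And>w. w \<in> We \<Longrightarrow> Psi (T w \<cdot> T u) = Psi (T w) \<otimes>\<^bsub>Z\<^esub> Psi (T u)"
  shows "right_multiplicative u"
  unfolding right_multiplicative_def
proof
  fix x assume "x \<in> carrier H"
  then show "Psi (x \<cdot> T u) = Psi x \<otimes>\<^bsub>Z\<^esub> Psi (T u)"
  proof (induction rule: hecke_induct)
    case zero show ?case using T_closed[OF u] by (simp add: Psi_zero zeta_zero_mult)
  next
    case (add w r y)
    have c: "T w \<in> carrier H" "T u \<in> carrier H" "r \<star> T w \<in> carrier H" "r \<star> (T w \<cdot> T u) \<in> carrier H"
      using T_closed[OF add(1)] T_closed[OF u] HM.smult_closed by auto
    have "Psi ((r \<star> T w \<boxplus> y) \<cdot> T u) = Psi (r \<star> (T w \<cdot> T u)) + Psi (y \<cdot> T u)"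
      using c add(2) by (simp add: HR.l_distr smult_mult Psi_add)
    also have "\<dots> = Psi (r \<star> T w \<boxplus> y) \<otimes>\<^bsub>Z\<^esub> Psi (T u)"
      using c add by (simp add: Psi_scale Psi_add assms(2) zeta_mult_add zeta_mult_scale)
    finally show ?case .
  qed
qed

lemma Psi_T_mult_T:
  "w \<in> We \<Longrightarrow> u \<in> We \<Longrightarrow> Psi (T w) \<otimes>\<^bsub>Z\<^esub> Psi (T u) = Poly_Mapping.single (cls ((w \<circ> u) 0)) (T_value w * T_value u)"
  by (simp only: Psi_T zeta_mult_single cls_comp)

lemma right_multiplicative_stab:
  assumes sg: "\<sigma> \<in> alcove_stab \<Phi> \<alpha>" shows "right_multiplicative \<sigma>"
proof (rule right_multiplicativeI[OF stab_We[OF sg]])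
  fix w assume w: "w \<in> We"
  have "T w \<cdot> T \<sigma> = T (w \<circ> \<sigma>)"
    by (rule T_mult[OF w stab_We[OF sg]]) (simp add: wlen_right_stab[OF w sg] wlen_stab[OF sg])
  then show "Psi (T w \<cdot> T \<sigma>) = Psi (T w) \<otimes>\<^bsub>Z\<^esub> Psi (T \<sigma>)"
    by (simp only: Psi_T_mult_T[OF w stab_We[OF sg]] Psi_T[OF We_comp[OF w stab_We[OF sg]]]
        T_value_right_stab[OF w sg] T_value_stab[OF sg] mult_1_right)
qed

text \<open>When the length goes up, one more hyperplane is crossed and the value gains the factor of the
  generator.  When it goes down, the extra term of the multiplication rule is absorbed by the quadratic
  relation of the value.\<close>

lemma right_multiplicative_generator:
  assumes i: "i \<in> {0..DIM('a)}" shows "right_multiplicative (s i)"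
proof (rule right_multiplicativeI[OF s_We[OF i]])
  fix w assume w: "w \<in> We"
  have ws: "w \<circ> s i \<in> We" by (rule We_comp[OF w s_We[OF i]])
  have rhs: "Psi (T w) \<otimes>\<^bsub>Z\<^esub> Psi (T (s i)) = Poly_Mapping.single (cls ((w \<circ> s i) 0)) (T_value w * gen_value i)"
    by (simp only: Psi_T_mult_T[OF w s_We[OF i]] T_value_generator[OF i])
  from T_value_right_step[OF w i]
  show "Psi (T w \<cdot> T (s i)) = Psi (T w) \<otimes>\<^bsub>Z\<^esub> Psi (T (s i))"
  proof (elim disjE conjE)
    assume l: "wlen \<Phi> \<alpha> (w \<circ> s i) = wlen \<Phi> \<alpha> w + 1" and val: "T_value (w \<circ> s i) = T_value w * gen_value i"
    have "T w \<cdot> T (s i) = T (w \<circ> s i)" by (rule T_mult[OF w s_We[OF i]]) (simp only: l wlen_generator[OF i])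
    then show ?thesis unfolding rhs by (simp only: Psi_T[OF ws] val)
  next
    assume l: "wlen \<Phi> \<alpha> w = wlen \<Phi> \<alpha> (w \<circ> s i) + 1" and val: "T_value w = T_value (w \<circ> s i) * gen_value i"
    have "cls (w 0) = cls ((w \<circ> s i) 0)"
      by (metis cls_comp[OF w s_We[OF i]] cls_generator[OF i] cls_mult add_0_right)
    then have "Psi (T w \<cdot> T (s i)) = Poly_Mapping.single (cls ((w \<circ> s i) 0)) (T_value (w \<circ> s i) + qgap i * T_value w)"
      unfolding T_mult_descent[OF w i l] using T_closed[OF ws] T_closed[OF w] HM.smult_closed
      by (simp add: Psi_add Psi_scale Psi_T[OF ws] Psi_T[OF w] single_add)
    also have "T_value (w \<circ> s i) + qgap i * T_value w = T_value (w \<circ> s i) * (1 + qgap i * gen_value i)"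
      unfolding val by (simp add: algebra_simps)
    also have "\<dots> = T_value w * gen_value i" unfolding gen_value_square[OF i, symmetric] val by (simp add: mult.assoc)
    finally show ?thesis unfolding rhs .
  qed
qed

lemma right_multiplicative: "u \<in> We \<Longrightarrow> right_multiplicative u"
proof (induction rule: We_length_induct)
  case (stab \<sigma>) then show ?case by (rule right_multiplicative_stab)
next
  case (step i u)
  have i: "i \<in> {0..DIM('a)}" and u: "u \<in> We" by fact+
  have l: "wlen \<Phi> \<alpha> (s i \<circ> u) = wlen \<Phi> \<alpha> (s i) + wlen \<Phi> \<alpha> u" by fact
  have su: "s i \<circ> u \<in> We" by (rule We_comp[OF s_We[OF i] u])
  have T: "T (s i) \<cdot> T u = T (s i \<circ> u)" by (rule T_mult[OF s_We[OF i] u l])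
  have IH: "Psi (x \<cdot> T u) = Psi x \<otimes>\<^bsub>Z\<^esub> Psi (T u)" if "x \<in> carrier H" for x
    using step.IH that by (simp add: right_multiplicative_def)
  have G: "Psi (x \<cdot> T (s i)) = Psi x \<otimes>\<^bsub>Z\<^esub> Psi (T (s i))" if "x \<in> carrier H" for x
    using right_multiplicative_generator[OF i] that by (simp add: right_multiplicative_def)
  have val: "Psi (T (s i \<circ> u)) = Psi (T (s i)) \<otimes>\<^bsub>Z\<^esub> Psi (T u)"
    unfolding T[symmetric] by (rule IH[OF T_closed[OF s_We[OF i]]])
  have "right_multiplicative (s i \<circ> u)"
  proof (rule right_multiplicativeI[OF su])
    fix w assume w: "w \<in> We"
    have c: "T w \<in> carrier H" "T (s i) \<in> carrier H" "T u \<in> carrier H" using T_closed w s_We[OF i] u by auto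
    have "T w \<cdot> T (s i \<circ> u) = (T w \<cdot> T (s i)) \<cdot> T u" unfolding T[symmetric] using c by (simp add: HR.m_assoc)
    then have "Psi (T w \<cdot> T (s i \<circ> u)) = (Psi (T w) \<otimes>\<^bsub>Z\<^esub> Psi (T (s i))) \<otimes>\<^bsub>Z\<^esub> Psi (T u)"
      using IH[of "T w \<cdot> T (s i)"] G[OF c(1)] c by simp
    also have "\<dots> = Psi (T w) \<otimes>\<^bsub>Z\<^esub> Psi (T (s i \<circ> u))"
      unfolding val Psi_T[OF w] Psi_T[OF s_We[OF i]] Psi_T[OF u] zeta_mult_single by (simp add: ac_simps)
    finally show "Psi (T w \<cdot> T (s i \<circ> u)) = Psi (T w) \<otimes>\<^bsub>Z\<^esub> Psi (T (s i \<circ> u))" .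
  qed
  then show ?case by (simp only: comp_def)
qed

lemma zeta_mult_zero: "f \<otimes>\<^bsub>Z\<^esub> 0 = 0"
  by (simp add: zeta_ring_simps)

lemma Psi_mult:
  assumes "x \<in> carrier H" "y \<in> carrier H" shows "Psi (x \<cdot> y) = Psi x \<otimes>\<^bsub>Z\<^esub> Psi y"
  using assms(2)
proof (induction rule: hecke_induct)
  case zero show ?case using assms(1) by (simp add: Psi_zero zeta_mult_zero)
next
  case (add w r y)
  have c: "T w \<in> carrier H" "r \<star> T w \<in> carrier H" "r \<star> (x \<cdot> T w) \<in> carrier H"
    using T_closed[OF add(1)] HM.smult_closed assms(1) by auto
  have "Psi (x \<cdot> (r \<star> T w \<boxplus> y)) = Psi (r \<star> (x \<cdot> T w)) + Psi (x \<cdot> y)"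
    using c add(2) assms(1) by (simp add: HR.r_distr smult_mult Psi_add)
  also have "\<dots> = Psi x \<otimes>\<^bsub>Z\<^esub> Psi (r \<star> T w \<boxplus> y)"
    using c add assms(1) right_multiplicative[OF add(1)]
    by (simp add: right_multiplicative_def Psi_scale Psi_add zeta_mult_add zeta_mult_scale)
  finally show ?case .
qed

text \<open>The signed product of the parameters over the hyperplanes between \<open>p\<close> and \<open>y\<close>: a crossing in the
  direction of a positive root counts with exponent \<open>1\<close>, in the opposite direction with exponent \<open>-1\<close>.
  Along a path it telescopes, and at a translate of \<open>p\<close> by \<open>\<mu>\<close> it is \<open>v\<^sup>\<mu>\<close>.\<close>

definition path_value :: "'a \<Rightarrow> laurent" where
  "path_value y = (\<Prod>\<beta>\<in>pos. v \<beta> [^]\<^bsub>laurent_ring\<^esub> \<lfloor>y \<bullet> \<beta>\<rfloor>)"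

lemma path_value_step:
  assumes b: "\<beta> \<in> pos"
    and fl: "\<And>\<gamma>. \<gamma> \<in> pos \<Longrightarrow> \<lfloor>y \<bullet> \<gamma>\<rfloor> = \<lfloor>x \<bullet> \<gamma>\<rfloor> + (if \<gamma> = \<beta> \<or> \<gamma> = 2 *\<^sub>R \<beta> then 1 else 0)"
  shows "path_value y = path_value x * (v \<beta> * v (2 *\<^sub>R \<beta>))"
proof -
  have "path_value y = (\<Prod>\<gamma>\<in>pos. v \<gamma> [^]\<^bsub>laurent_ring\<^esub> \<lfloor>x \<bullet> \<gamma>\<rfloor> * (if \<gamma> = \<beta> \<or> \<gamma> = 2 *\<^sub>R \<beta> then v \<gamma> else 1))"
    unfolding path_value_def
    by (rule prod.cong) (auto simp: fl laurent_int_pow_add_one[OF v_unit[OF pos_rootD(1)]])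
  also have "\<dots> = path_value x * (\<Prod>\<gamma>\<in>pos. if \<gamma> = \<beta> \<or> \<gamma> = 2 *\<^sub>R \<beta> then v \<gamma> else 1)"
    unfolding path_value_def by (rule prod.distrib)
  also have "(\<Prod>\<gamma>\<in>pos. if \<gamma> = \<beta> \<or> \<gamma> = 2 *\<^sub>R \<beta> then v \<gamma> else 1) = (\<Prod>\<gamma>\<in>pos \<inter> {\<beta>, 2 *\<^sub>R \<beta>}. v \<gamma>)"
    unfolding prod.inter_restrict[OF finite_pos] by (rule prod.cong) auto
  also have "\<dots> = v \<beta> * v (2 *\<^sub>R \<beta>)"
  proof (cases "2 *\<^sub>R \<beta> \<in> \<Phi>")
    case True
    then have "2 *\<^sub>R \<beta> \<in> pos" using pos_cone_add[OF pos_rootD(2)[OF b] pos_rootD(2)[OF b]] by (simp add: pos_roots_def scaleR_2)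
    then have "pos \<inter> {\<beta>, 2 *\<^sub>R \<beta>} = {\<beta>, 2 *\<^sub>R \<beta>}" using b by auto
    moreover have "\<beta> \<noteq> 2 *\<^sub>R \<beta>" using root_nonzero[OF pos_rootD(1)[OF b]] by (simp add: scaleR_2)
    ultimately show ?thesis by simp
  next
    case False
    then have "pos \<inter> {\<beta>, 2 *\<^sub>R \<beta>} = {\<beta>}" using b pos_rootD(1) by auto
    then show ?thesis using v_nonroot[OF False] by simp
  qed
  finally show ?thesis .
qed

lemma Psi_generator_pow:
  assumes u: "u \<in> We" and i: "i \<in> {0..DIM('a)}"
  shows "\<exists>x. Psi (T (s i) [^]\<^bsub>H\<^esub> crossing_sign \<Phi> \<alpha> u i) = Poly_Mapping.single (cls 0) x \<and>
    path_value (u p) * x = path_value (u (s i p))"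
proof -
  define \<beta> where "\<beta> = lin u (wall_root i)"
  have b: "\<beta> \<in> \<Phi>" unfolding \<beta>_def by (rule W0_root[OF We_parts(1)[OF u] wall_root[OF i]])
  have "2 *\<^sub>R \<beta> = lin u (2 *\<^sub>R wall_root i)"
    by (simp add: \<beta>_def linear_cmul[OF W0_linear[OF We_parts(1)[OF u]]])
  then have g: "v \<beta> * v (2 *\<^sub>R \<beta>) = gen_value i"
    using v_W0[OF We_parts(1)[OF u]] by (simp add: gen_value_def \<beta>_def)
  have t: "Psi (T (s i)) = Poly_Mapping.single (cls 0) (gen_value i)"
    by (simp only: Psi_T[OF s_We[OF i]] T_value_generator[OF i] cls_generator[OF i])
  show ?thesis
  proof (cases "\<beta> \<in> pos")
    case True
    then have "crossing_sign \<Phi> \<alpha> u i = 1" by (simp add: crossing_sign_wall[OF u i] \<beta>_def)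
    moreover have "path_value (u (s i p)) = path_value (u p) * (v \<beta> * v (2 *\<^sub>R \<beta>))"
      by (rule path_value_step[OF True]) (use wall_crossing_floors[OF u i] True in \<open>simp add: \<beta>_def\<close>)
    ultimately show ?thesis using t generator_pow_sign(1)[OF i] g by auto
  next
    case False
    then have m: "- \<beta> \<in> pos" using root_cases b by blast
    have cs: "crossing_sign \<Phi> \<alpha> u i = - 1" using False by (simp add: crossing_sign_wall[OF u i] \<beta>_def)
    have "path_value (u p) = path_value (u (s i p)) * (v (- \<beta>) * v (2 *\<^sub>R (- \<beta>)))"
      by (rule path_value_step[OF m]) (use wall_crossing_floors'[OF u i] m in \<open>simp add: \<beta>_def\<close>)
    then have pv: "path_value (u p) = path_value (u (s i p)) * gen_value i" using g by (simp add: v_minus)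
    have o: "(- qgap i) \<star> \<one>\<^bsub>H\<^esub> \<in> carrier H" using HM.smult_closed by simp
    have "Psi (T (s i) [^]\<^bsub>H\<^esub> crossing_sign \<Phi> \<alpha> u i) = Poly_Mapping.single (cls 0) (gen_value i - qgap i)"
      unfolding cs generator_pow_sign(2)[OF i] generator_inverse(2)[OF i]
      using o T_closed[OF s_We[OF i]] by (simp add: Psi_add Psi_scale Psi_one t single_add[symmetric])
    moreover have "path_value (u p) * (gen_value i - qgap i) = path_value (u (s i p))"
    proof -
      have "path_value (u p) * (gen_value i - qgap i)
        = path_value (u (s i p)) * (gen_value i * gen_value i - qgap i * gen_value i)"
        unfolding pv by (simp add: algebra_simps)
      then show ?thesis unfolding gen_value_square[OF i] by simp
    qed
    ultimately show ?thesis by blast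
  qed
qed

text \<open>The signs in the definition of the element \<open>X\<close> are those of the wall crossings along the path of
  alcoves, so its image is a quotient of two path values and depends on the end points only.\<close>

lemma Psi_X_expr_from:
  assumes u: "u \<in> We" and "set is \<subseteq> {0..DIM('a)}" and sg: "\<sigma> \<in> alcove_stab \<Phi> \<alpha>"
  shows "\<exists>x. Psi (X_expr_from \<Phi> \<alpha> H T u is \<sigma>) = Poly_Mapping.single (cls ((word_map \<Phi> \<alpha> is \<circ> \<sigma>) 0)) x \<and>
    path_value (u p) * x = path_value (u (word_map \<Phi> \<alpha> is p))"
  using assms(1,2)
proof (induction "is" arbitrary: u)
  case Nil
  then show ?case using Psi_T[OF stab_We[OF sg]] T_value_stab[OF sg] unfolding word_map_simps by auto
next
  case (Cons i "is")
  have i: "i \<in> {0..DIM('a)}" and js: "set is \<subseteq> {0..DIM('a)}" using Cons.prems by auto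
  let ?w = "word_map \<Phi> \<alpha> is \<circ> \<sigma>"
  have us: "u \<circ> s i \<in> We" by (rule We_comp[OF Cons.prems(1) s_We[OF i]])
  have w: "?w \<in> We" by (rule We_comp[OF word_We[OF js] stab_We[OF sg]])
  obtain x where x: "Psi (X_expr_from \<Phi> \<alpha> H T (u \<circ> s i) is \<sigma>) = Poly_Mapping.single (cls (?w 0)) x"
    "path_value ((u \<circ> s i) p) * x = path_value ((u \<circ> s i) (word_map \<Phi> \<alpha> is p))"
    using Cons.IH[OF us js] by blast
  obtain y where y: "Psi (T (s i) [^]\<^bsub>H\<^esub> crossing_sign \<Phi> \<alpha> u i) = Poly_Mapping.single (cls 0) y"
    "path_value (u p) * y = path_value (u (s i p))"
    using Psi_generator_pow[OF Cons.prems(1) i] by blast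
  have "Psi (X_expr_from \<Phi> \<alpha> H T u (i # is) \<sigma>) = Poly_Mapping.single (cls (?w 0)) (y * x)"
    using Psi_mult[OF generator_pow_closed[OF i] X_expr_from_closed[OF us js stab_We[OF sg]]]
    by (simp only: X_expr_from.simps x(1) y(1) zeta_mult_single add_0)
  moreover have "cls (?w 0) = cls ((word_map \<Phi> \<alpha> (i # is) \<circ> \<sigma>) 0)"
  proof -
    have "cls ((s i \<circ> ?w) 0) = cls (s i 0 + ?w 0)" by (rule cls_comp[OF s_We[OF i] w])
    also have "\<dots> = cls (?w 0)" using cls_mult[of "s i 0" "?w 0"] cls_mult[of 0 "?w 0"] cls_generator[OF i] by simp
    finally show ?thesis unfolding word_map_simps comp_assoc by simp
  qed
  moreover have "path_value (u p) * (y * x) = path_value (u (word_map \<Phi> \<alpha> (i # is) p))"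
    using x(2) y(2) unfolding word_map_simps by (simp add: mult.assoc[symmetric])
  ultimately show ?case by metis
qed

lemma path_value_base_point: "path_value p = 1"
  unfolding path_value_def by (rule prod.neutral) (simp add: base_point_floor)

lemma path_value_transl:
  assumes "\<mu> \<in> P" shows "path_value (transl \<mu> p) = v_power \<Phi> \<alpha> v \<mu>"
  unfolding path_value_def v_power_def
proof (rule prod.cong[OF refl])
  fix \<beta> assume b: "\<beta> \<in> pos"
  obtain k :: int where k: "\<mu> \<bullet> \<beta> = of_int k"
    using coweight_root_Ints[OF assms pos_rootD(1)[OF b]] by (auto elim: Ints_cases)
  show "v \<beta> [^]\<^bsub>laurent_ring\<^esub> \<lfloor>transl \<mu> p \<bullet> \<beta>\<rfloor> = v \<beta> [^]\<^bsub>laurent_ring\<^esub> \<lfloor>\<mu> \<bullet> \<beta>\<rfloor>"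
    using base_point_floor[OF b] by (simp add: transl_def inner_add_left k)
qed

lemma path_value_same_alcove:
  assumes "generic x" "generic y" "crossings x y = {}" shows "path_value x = path_value y"
  unfolding path_value_def
  by (rule prod.cong) (use floor_eq_if_no_crossing[OF assms(1,2)] assms(3) pos_rootD(1) in auto)

lemma Psi_X:
  assumes m: "\<mu> \<in> P" and e: "expression \<Phi> \<alpha> is \<sigma> (transl \<mu>)"
  shows "Psi (X_expr \<Phi> \<alpha> H T is \<sigma>) = v_power \<Phi> \<alpha> v \<mu> \<odot>\<^bsub>Z\<^esub> zeta \<Phi> \<alpha> \<mu>"
proof -
  have js: "set is \<subseteq> {0..DIM('a)}" and sg: "\<sigma> \<in> alcove_stab \<Phi> \<alpha>" and t: "transl \<mu> = word_map \<Phi> \<alpha> is \<circ> \<sigma>"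
    using e unfolding expression_def by auto
  obtain x where x: "Psi (X_expr \<Phi> \<alpha> H T is \<sigma>) = Poly_Mapping.single (cls (transl \<mu> 0)) x"
    "path_value (id p) * x = path_value (id (word_map \<Phi> \<alpha> is p))"
    using Psi_X_expr_from[OF W0_We[OF W0_id] js sg] unfolding X_expr_def t[symmetric] by blast
  have w: "word_map \<Phi> \<alpha> is \<in> We" by (rule word_We[OF js])
  have "crossings (word_map \<Phi> \<alpha> is p) (transl \<mu> p) = {}"
    using crossings_act[OF w, of p "\<sigma> p"] sg unfolding t by (simp add: alcove_stab_iff bij_betw_def)
  then have "path_value (word_map \<Phi> \<alpha> is p) = path_value (transl \<mu> p)"
    by (rule path_value_same_alcove[OF generic_orbit[OF w] generic_orbit[OF transl_We[OF m]]])
  then have "x = v_power \<Phi> \<alpha> v \<mu>" using x(2) path_value_base_point path_value_transl[OF m] by simp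
  then show ?thesis using x(1) by (simp add: zeta_def zeta_ring_simps transl_def)
qed

lemma Psi_is_psi: "is_psi \<Phi> \<alpha> H T v (restrict Psi (carrier H))"
  unfolding is_psi_def
proof (intro conjI allI ballI impI)
  show "restrict Psi (carrier H) \<in> ring_hom H Z"
    by (rule ring_hom_memI) (simp_all add: Psi_closed Psi_mult Psi_add Psi_one zeta_ring_simps(3,5))
  show "restrict Psi (carrier H) (r \<star> x) = r \<odot>\<^bsub>Z\<^esub> restrict Psi (carrier H) x" if "x \<in> carrier H" for r x
    using that HM.smult_closed by (simp add: Psi_scale zeta_ring_simps)
  show "restrict Psi (carrier H) (T (s i)) = (v (\<alpha> i) * v (2 *\<^sub>R \<alpha> i)) \<odot>\<^bsub>Z\<^esub> \<one>\<^bsub>Z\<^esub>" if i: "i \<in> {1..DIM('a)}" for i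
  proof -
    have i': "i \<in> {0..DIM('a)}" "i \<noteq> 0" using i by auto
    have "gen_value i = v (\<alpha> i) * v (2 *\<^sub>R \<alpha> i)"
      using i'(2) v_minus[of "\<alpha> i"] v_minus[of "2 *\<^sub>R \<alpha> i"] by (simp add: gen_value_def wall_root_def)
    then have "Psi (T (s i)) = Poly_Mapping.single (cls 0) (v (\<alpha> i) * v (2 *\<^sub>R \<alpha> i))"
      by (simp only: Psi_T[OF s_We[OF i'(1)]] T_value_generator[OF i'(1)] cls_generator[OF i'(1)])
    then show ?thesis using T_closed[OF s_We[OF i'(1)]] by (simp add: zeta_ring_simps)
  qed
  show "restrict Psi (carrier H) (X_expr \<Phi> \<alpha> H T is \<sigma>) = v_power \<Phi> \<alpha> v \<mu> \<odot>\<^bsub>Z\<^esub> zeta \<Phi> \<alpha> \<mu>"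
    if "\<mu> \<in> P" "expression \<Phi> \<alpha> is \<sigma> (transl \<mu>)" for \<mu> "is" \<sigma>
  proof -
    have "X_expr \<Phi> \<alpha> H T is \<sigma> \<in> carrier H"
      using that(2) X_expr_from_closed[OF W0_We[OF W0_id]] stab_We unfolding X_expr_def expression_def by blast
    then show ?thesis using Psi_X[OF that] by simp
  qed
qed simp

lemma psi_eq: "psi \<Phi> \<alpha> H T v = restrict Psi (carrier H)"
  unfolding psi_def by (rule the_equality, rule Psi_is_psi) (rule is_psi_unique[OF _ Psi_is_psi])

lemma psi_T: "w \<in> We \<Longrightarrow> psi \<Phi> \<alpha> H T v (T w) = Poly_Mapping.single (cls (w 0)) (T_value w)"
  using T_closed by (simp add: psi_eq Psi_T)

end

section \<open>Degrees and boundedness\<close>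

definition monomial :: "laurent \<Rightarrow> bool" where
  "monomial x \<longleftrightarrow> (\<exists>k. x = qpow k \<or> x = - qpow k)"

text \<open>The degree in \<open>q\<close>; it is additive on the monomials \<open>\<plusminus> q\<^sup>k\<close>, which are the only values of the
  parameters.\<close>

definition ldeg :: "laurent \<Rightarrow> int" where "ldeg x = Max (Poly_Mapping.keys x)"

lemma keys_qpow [simp]: "Poly_Mapping.keys (qpow k) = {k}"
  by (simp add: qpow_def)

lemma ldeg_qpow [simp]: "ldeg (qpow k) = k" "ldeg (- qpow k) = k"
  by (simp_all add: ldeg_def)

lemma qpow_mult: "qpow k * qpow l = qpow (k + l)"
  by (simp add: qpow_def mult_single)

lemma qpow_0: "qpow 0 = 1" by (simp add: qpow_def)

lemma monomial_one: "monomial 1" and ldeg_one: "ldeg 1 = 0"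
  using ldeg_qpow(1)[of 0] by (auto simp: monomial_def qpow_0 intro: exI[of _ 0])

lemma monomial_mult:
  assumes "monomial x" "monomial y" shows "monomial (x * y)" "ldeg (x * y) = ldeg x + ldeg y"
proof -
  obtain k l where "x = qpow k \<or> x = - qpow k" "y = qpow l \<or> y = - qpow l" using assms unfolding monomial_def by blast
  then have "(x * y = qpow (k + l) \<or> x * y = - qpow (k + l)) \<and> ldeg x = k \<and> ldeg y = l"
    by (auto simp: qpow_mult)
  then show "monomial (x * y)" "ldeg (x * y) = ldeg x + ldeg y" unfolding monomial_def by auto
qed

lemma monomial_prod:
  assumes "finite A" "\<And>a. a \<in> A \<Longrightarrow> monomial (f a)"
  shows "monomial (prod f A) \<and> ldeg (prod f A) = (\<Sum>a\<in>A. ldeg (f a))"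
  using assms by (induction A rule: finite_induct) (auto simp: monomial_one ldeg_one monomial_mult)

text \<open>Needed for type \<open>BC\<^sub>n\<close>, where only \<open>v\<close> at \<open>2 \<alpha>\<^sub>n\<close> and the product of the values at \<open>\<alpha>\<^sub>n\<close> and \<open>2 \<alpha>\<^sub>n\<close>
  are prescribed.\<close>

lemma monomial_quotient:
  assumes "monomial (x * y)" "monomial y" shows "monomial x"
proof -
  obtain l where l: "y = qpow l \<or> y = - qpow l" using assms(2) unfolding monomial_def by blast
  have "qpow l * qpow (- l) = 1" by (simp add: qpow_mult qpow_0)
  then have "x = (x * y) * qpow (- l) \<or> x = (x * y) * (- qpow (- l))"
    using l by (auto simp: mult.assoc)
  moreover have "monomial (qpow (- l))" "monomial (- qpow (- l))" unfolding monomial_def by blast+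
  ultimately show ?thesis using monomial_mult(1)[OF assms(1)] by metis
qed

lemma qdeg_single:
  assumes "monomial x" shows "qdeg (Poly_Mapping.single g x) = ldeg x"
proof -
  obtain k where k: "x = qpow k \<or> x = - qpow k" using assms unfolding monomial_def by blast
  then have "Poly_Mapping.keys x = {k}" by auto
  then have "x \<noteq> 0" by auto
  then show ?thesis by (simp add: qdeg_def ldeg_def)
qed

context based_root_system
begin

definition dominant :: "'a \<Rightarrow> bool" where "dominant x \<longleftrightarrow> (\<forall>i\<in>{1..DIM('a)}. 0 \<le> x \<bullet> \<alpha> i)"

lemma dominant_pos_cone: assumes "dominant x" "y \<in> pos_cone \<alpha>" shows "0 \<le> x \<bullet> y"
proof -
  have "0 \<le> y \<bullet> x" unfolding inner_via_coordinates[of y]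
    using assms(1) by (intro sum_nonneg mult_nonneg_nonneg pos_cone_nonneg[OF assms(2)]) (auto simp: dominant_def inner_commute)
  then show ?thesis by (simp add: inner_commute)
qed

text \<open>Induction on the number of positive roots having negative product with \<open>x\<close>: the reflection in a
  simple root with negative product permutes the other positive directions and removes this one.\<close>

lemma W0_dominant: "\<exists>g\<in>W0. dominant (g x)"
proof (induction "card {\<beta>\<in>pos. x \<bullet> \<beta> < 0}" arbitrary: x rule: less_induct)
  case less
  show ?case
  proof (cases "dominant x")
    case True then show ?thesis using W0_id by (intro bexI[of _ id]) simp_all
  next
    case False
    then obtain i where i: "i \<in> {1..DIM('a)}" and neg: "x \<bullet> \<alpha> i < 0" unfolding dominant_def by force
    let ?y = "refl (\<alpha> i) x"
    have "refl (\<alpha> i) ` {\<beta>\<in>pos. ?y \<bullet> \<beta> < 0} \<subseteq> {\<beta>\<in>pos. x \<bullet> \<beta> < 0} - {\<alpha> i}"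
    proof
      fix \<gamma> assume "\<gamma> \<in> refl (\<alpha> i) ` {\<beta>\<in>pos. ?y \<bullet> \<beta> < 0}"
      then obtain \<beta> where b: "\<beta> \<in> pos" "x \<bullet> refl (\<alpha> i) \<beta> < 0" "\<gamma> = refl (\<alpha> i) \<beta>" by (auto simp: refl_adjoint)
      have n: "\<beta> \<noteq> c *\<^sub>R \<alpha> i" for c
      proof
        assume c: "\<beta> = c *\<^sub>R \<alpha> i"
        then have "0 < c" using base_point_pos(1)[OF b(1)] base_point_pos(1)[OF simple_pos[OF i]] by (simp add: zero_less_mult_iff)
        moreover have "refl (\<alpha> i) \<beta> = - \<beta>"
          using c refl_self[OF root_nonzero[OF simple_root[OF i]]] by (simp add: linear_cmul[OF refl_linear])
        ultimately show False using b(2) c neg mult_pos_neg[of c "x \<bullet> \<alpha> i"] by simp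
      qed
      have "\<gamma> \<in> pos" unfolding b(3) by (rule refl_simple_pos[OF i b(1) n])
      moreover have "\<gamma> \<noteq> \<alpha> i"
      proof
        assume "\<gamma> = \<alpha> i"
        then have "\<beta> = (- 1) *\<^sub>R \<alpha> i"
          using b(3) refl_involution[of "\<alpha> i" \<beta>] refl_self[OF root_nonzero[OF simple_root[OF i]]] by simp
        then show False using n by blast
      qed
      ultimately show "\<gamma> \<in> {\<beta>\<in>pos. x \<bullet> \<beta> < 0} - {\<alpha> i}" using b by simp
    qed
    moreover have "inj_on (refl (\<alpha> i)) S" for S by (metis inj_onI refl_involution)
    ultimately have "card {\<beta>\<in>pos. ?y \<bullet> \<beta> < 0} \<le> card ({\<beta>\<in>pos. x \<bullet> \<beta> < 0} - {\<alpha> i})"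
      by (intro card_inj_on_le) (auto simp: finite_pos)
    also have "\<dots> < card {\<beta>\<in>pos. x \<bullet> \<beta> < 0}"
      using neg simple_pos[OF i] by (intro card_Diff1_less) (auto simp: finite_pos)
    finally obtain g where "g \<in> W0" "dominant (g ?y)" using less[of ?y] by blast
    then show ?thesis using W0_comp[OF _ W0_simple[OF i], of g] by (intro bexI[of _ "g \<circ> refl (\<alpha> i)"]) simp_all
  qed
qed

lemma base_point_root_bound: assumes "\<beta> \<in> \<Phi>" shows "\<bar>p \<bullet> \<beta>\<bar> < 1"
  using root_cases[OF assms] base_point_pos[of \<beta>] base_point_neg[of \<beta>] by auto

end

locale monomial_character = hecke_character \<Phi> \<alpha> L H T v
  for \<Phi> :: "'a::euclidean_space set" and \<alpha> L and H :: "(laurent, 'h) module" and T v +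
  assumes v_monomial: "\<And>\<beta>. \<beta> \<in> \<Phi> \<Longrightarrow> monomial (v \<beta>)"
begin

definition d :: "'a \<Rightarrow> int" where "d \<beta> = ldeg (v \<beta>)"

lemma d_W0: "g \<in> W0 \<Longrightarrow> d (g \<beta>) = d \<beta>"
  by (simp add: d_def v_W0)

lemma d_nonroot: "\<beta> \<notin> \<Phi> \<Longrightarrow> d \<beta> = 0"
  by (simp add: d_def v_nonroot ldeg_one)

text \<open>The homogeneous main part of the degree of \<open>\<psi> (T w)\<close>, as a function of \<open>x = w 0\<close>.  Summing the positive
  parts over all roots gives the sum of \<open>d \<beta> \<bar>\<langle>x, \<beta>\<rangle>\<bar>\<close> over the positive roots, and is
  evidently invariant under the finite Weyl group.\<close>

definition growth :: "'a \<Rightarrow> real" where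
  "growth x = (\<Sum>\<beta>\<in>\<Phi>. of_int (d \<beta>) * max 0 (x \<bullet> \<beta>))"

lemma crossing_fst: "c \<in> crossings x y \<Longrightarrow> fst c \<in> \<Phi>"
  by (auto simp: crossings_def)

lemma qdeg_psi:
  assumes "w \<in> We"
  shows "qdeg (psi \<Phi> \<alpha> H T v (T w)) = (\<Sum>\<beta>\<in>\<Phi>. d \<beta> * int (nat (\<lfloor>w p \<bullet> \<beta>\<rfloor> - \<lfloor>p \<bullet> \<beta>\<rfloor>)))"
proof -
  have m: "monomial (T_value w) \<and> ldeg (T_value w) = (\<Sum>c\<in>crossings p (w p). d (fst c))"
    unfolding T_value_def d_def by (rule monomial_prod[OF finite_crossings]) (simp add: v_monomial crossing_fst)
  have S: "crossings p (w p) = (SIGMA \<beta>:\<Phi>. {m. (\<beta>, m) \<in> crossings p (w p)})"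
    by (auto simp: crossings_def)
  have "(\<Sum>c\<in>crossings p (w p). d (fst c)) = (\<Sum>c\<in>(SIGMA \<beta>:\<Phi>. {m. (\<beta>, m) \<in> crossings p (w p)}). d (fst c))"
    using S by simp
  also have "\<dots> = (\<Sum>c\<in>(SIGMA \<beta>:\<Phi>. {\<lfloor>p \<bullet> \<beta>\<rfloor><..\<lfloor>w p \<bullet> \<beta>\<rfloor>}). d (fst c))"
    by (intro sum.cong Sigma_cong refl crossing_fiber[OF generic_orbit[OF assms]])
  also have "\<dots> = (\<Sum>\<beta>\<in>\<Phi>. \<Sum>m\<in>{\<lfloor>p \<bullet> \<beta>\<rfloor><..\<lfloor>w p \<bullet> \<beta>\<rfloor>}. d \<beta>)"
    by (subst sum.Sigma[OF finite_roots]) (simp_all add: case_prod_beta)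
  also have "\<dots> = (\<Sum>\<beta>\<in>\<Phi>. d \<beta> * int (nat (\<lfloor>w p \<bullet> \<beta>\<rfloor> - \<lfloor>p \<bullet> \<beta>\<rfloor>)))"
    by (intro sum.cong) (simp_all add: mult.commute)
  finally show ?thesis using m by (simp add: psi_T[OF assms] qdeg_single)
qed

text \<open>The linear part of \<open>w\<close> moves \<open>p\<close> by an amount whose products with roots are less than \<open>1\<close>, so the number
  of hyperplanes crossed in the direction \<open>\<beta>\<close> differs from the translation length by at most one.\<close>

lemma floor_estimate:
  assumes "w \<in> We" "\<beta> \<in> \<Phi>"
  shows "\<bar>real (nat (\<lfloor>w p \<bullet> \<beta>\<rfloor> - \<lfloor>p \<bullet> \<beta>\<rfloor>)) - max 0 (w 0 \<bullet> \<beta>)\<bar> \<le> 1"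
proof -
  obtain k :: int where k: "w 0 \<bullet> \<beta> = of_int k"
    using coweight_root_Ints[OF We_parts(2)[OF assms(1)] assms(2)] by (auto elim: Ints_cases)
  obtain h where h: "h \<in> W0" "h \<circ> lin w = id" "lin w \<circ> h = id" using W0_inverse[OF We_parts(1)[OF assms(1)]] by blast
  have "lin w p \<bullet> \<beta> = lin w p \<bullet> lin w (h \<beta>)" using h(3) by (metis comp_apply id_apply)
  then have e: "lin w p \<bullet> \<beta> = p \<bullet> h \<beta>" by (simp add: W0_isometry[OF We_parts(1)[OF assms(1)]])
  have b1: "\<bar>p \<bullet> h \<beta>\<bar> < 1" by (rule base_point_root_bound[OF W0_root[OF h(1) assms(2)]])
  have b2: "\<bar>p \<bullet> \<beta>\<bar> < 1" by (rule base_point_root_bound[OF assms(2)])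
  have "w p \<bullet> \<beta> = of_int k + p \<bullet> h \<beta>"
    using We_parts(4)[OF assms(1), of p] e k by (simp add: inner_add_left)
  then have f: "\<lfloor>w p \<bullet> \<beta>\<rfloor> = k + \<lfloor>p \<bullet> h \<beta>\<rfloor>" by simp
  have unit: "\<lfloor>x\<rfloor> = 0 \<or> \<lfloor>x\<rfloor> = - 1" if "\<bar>x\<bar> < 1" for x :: real
    using that by (cases "0 \<le> x") (auto simp: floor_eq_iff)
  define t where "t = \<lfloor>p \<bullet> h \<beta>\<rfloor> - \<lfloor>p \<bullet> \<beta>\<rfloor>"
  have t: "t = 0 \<or> t = 1 \<or> t = - 1" using unit[OF b1] unit[OF b2] by (auto simp: t_def)
  have "\<lfloor>w p \<bullet> \<beta>\<rfloor> - \<lfloor>p \<bullet> \<beta>\<rfloor> = k + t" unfolding f t_def by simp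
  then have "real (nat (\<lfloor>w p \<bullet> \<beta>\<rfloor> - \<lfloor>p \<bullet> \<beta>\<rfloor>)) = max 0 (of_int (k + t))" by auto
  then show ?thesis using t unfolding k by (auto simp: max_def)
qed

definition error_bound :: real where "error_bound = (\<Sum>\<beta>\<in>\<Phi>. \<bar>of_int (d \<beta>)\<bar>)"

lemma qdeg_growth:
  assumes "w \<in> We" shows "\<bar>of_int (qdeg (psi \<Phi> \<alpha> H T v (T w))) - growth (w 0)\<bar> \<le> error_bound"
proof -
  let ?N = "\<lambda>\<beta>. real (nat (\<lfloor>w p \<bullet> \<beta>\<rfloor> - \<lfloor>p \<bullet> \<beta>\<rfloor>))"
  have "of_int (qdeg (psi \<Phi> \<alpha> H T v (T w))) - growth (w 0) = (\<Sum>\<beta>\<in>\<Phi>. of_int (d \<beta>) * (?N \<beta> - max 0 (w 0 \<bullet> \<beta>)))"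
    unfolding qdeg_psi[OF assms] growth_def of_int_sum of_int_mult of_int_of_nat_eq
    by (simp only: sum_subtractf right_diff_distrib)
  also have "\<bar>\<dots>\<bar> \<le> (\<Sum>\<beta>\<in>\<Phi>. \<bar>of_int (d \<beta>) * (?N \<beta> - max 0 (w 0 \<bullet> \<beta>))\<bar>)" by (rule sum_abs)
  also have "\<dots> \<le> error_bound" unfolding error_bound_def abs_mult
    by (intro sum_mono mult_left_le floor_estimate[OF assms]) simp_all
  finally show ?thesis .
qed

lemma growth_scale: "0 \<le> c \<Longrightarrow> growth (c *\<^sub>R x) = c * growth x"
  unfolding growth_def sum_distrib_left
  by (intro sum.cong) (auto simp: max_def mult_le_0_iff zero_le_mult_iff)

lemma growth_W0: assumes g: "g \<in> W0" shows "growth (g x) = growth x"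
proof -
  have "bij_betw g \<Phi> \<Phi>"
    unfolding bij_betw_def
  proof
    show "inj_on g \<Phi>" using W0_bij[OF g] by (auto simp: bij_def inj_on_def)
    show "g ` \<Phi> = \<Phi>"
    proof (intro equalityI subsetI)
      fix \<beta> assume b: "\<beta> \<in> \<Phi>"
      obtain \<gamma> where c: "\<beta> = g \<gamma>" using bij_is_surj[OF W0_bij[OF g]] by (rule surjE)
      then show "\<beta> \<in> g ` \<Phi>" using b W0_root_iff[OF g] by simp
    qed (use W0_root[OF g] in auto)
  qed
  from sum.reindex_bij_betw[OF this, of "\<lambda>\<beta>. of_int (d \<beta>) * max 0 (g x \<bullet> \<beta>)"]
  show ?thesis by (simp add: growth_def d_W0[OF g] W0_isometry[OF g])
qed

text \<open>The sum of the positive roots weighted by the degrees of their parameters; with all degrees equal to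
  \<open>1\<close> in a reduced system this is the classical \<open>2 \<rho>\<close>.\<close>

definition two_rho :: 'a where "two_rho = (\<Sum>\<beta>\<in>pos. of_int (d \<beta>) *\<^sub>R \<beta>)"

lemma growth_dominant: assumes "dominant x" shows "growth x = x \<bullet> two_rho"
proof -
  have "growth x = (\<Sum>\<beta>\<in>pos. of_int (d \<beta>) * max 0 (x \<bullet> \<beta>))"
    unfolding growth_def
  proof (rule sum.mono_neutral_right[OF finite_roots])
    show "pos \<subseteq> \<Phi>" using pos_rootD by blast
    show "\<forall>\<beta>\<in>\<Phi> - pos. of_int (d \<beta>) * max 0 (x \<bullet> \<beta>) = 0"
    proof
      fix \<beta> assume "\<beta> \<in> \<Phi> - pos"
      then have "- \<beta> \<in> pos" using root_cases by blast
      then have "x \<bullet> \<beta> \<le> 0" using dominant_pos_cone[OF assms pos_rootD(2)] by fastforce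
      then show "of_int (d \<beta>) * max 0 (x \<bullet> \<beta>) = 0" by simp
    qed
  qed
  also have "\<dots> = (\<Sum>\<beta>\<in>pos. of_int (d \<beta>) * (x \<bullet> \<beta>))"
    by (intro sum.cong refl) (simp add: max_def dominant_pos_cone[OF assms pos_rootD(2)])
  finally show ?thesis by (simp add: two_rho_def inner_sum_right)
qed

lemma fund_coweight_dominant: "dominant (\<omega> i)"
  by (simp add: dominant_def fund_coweight_simple)

lemma coweight_coordinates: "x = (\<Sum>i\<in>{1..DIM('a)}. (x \<bullet> \<alpha> i) *\<^sub>R \<omega> i)"
proof (rule eq_if_inner_simple)
  fix j assume j: "j \<in> {1..DIM('a)}"
  have "(\<Sum>i\<in>{1..DIM('a)}. (x \<bullet> \<alpha> i) *\<^sub>R \<omega> i) \<bullet> \<alpha> j = (\<Sum>i\<in>{1..DIM('a)}. if i = j then x \<bullet> \<alpha> i else 0)"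
    unfolding inner_sum_left by (intro sum.cong) (auto simp: fund_coweight_simple[OF j])
  also have "\<dots> = x \<bullet> \<alpha> j" using j by (subst sum.delta) auto
  finally show "x \<bullet> \<alpha> j = (\<Sum>i\<in>{1..DIM('a)}. (x \<bullet> \<alpha> i) *\<^sub>R \<omega> i) \<bullet> \<alpha> j" by simp
qed

text \<open>Translations by multiples of a fundamental coweight \<open>\<omega> i\<close> show that boundedness forces the growth at \<open>\<omega> i\<close>
  to be nonpositive.  Conversely, growth is invariant under the finite Weyl group and linear on the
  dominant cone, which the fundamental coweights generate.\<close>

lemma bounded_iff:
  "bounded_rep \<Phi> \<alpha> T (psi \<Phi> \<alpha> H T v) \<longleftrightarrow> (\<forall>i\<in>{1..DIM('a)}. \<omega> i \<bullet> two_rho \<le> 0)"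
proof
  assume "bounded_rep \<Phi> \<alpha> T (psi \<Phi> \<alpha> H T v)"
  then obtain N where N: "\<And>w. w \<in> We \<Longrightarrow> qdeg (psi \<Phi> \<alpha> H T v (T w)) \<le> N" unfolding bounded_rep_def by blast
  show "\<forall>i\<in>{1..DIM('a)}. \<omega> i \<bullet> two_rho \<le> 0"
  proof (intro ballI, rule ccontr)
    fix i assume i: "i \<in> {1..DIM('a)}" and "\<not> \<omega> i \<bullet> two_rho \<le> 0"
    then have pos: "0 < growth (\<omega> i)" using growth_dominant[OF fund_coweight_dominant] by simp
    obtain k :: nat where k: "(of_int N + error_bound) / growth (\<omega> i) < real k" using reals_Archimedean2 by blast
    let ?\<mu> = "of_int (int k) *\<^sub>R \<omega> i"
    have w: "transl ?\<mu> \<in> We" by (rule transl_We[OF P_scale[OF fund_coweight_P]])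
    have "of_int (qdeg (psi \<Phi> \<alpha> H T v (T (transl ?\<mu>)))) \<le> real_of_int N" using N[OF w] by simp
    moreover have "transl ?\<mu> 0 = ?\<mu>" by (simp add: transl_def)
    then have "growth (transl ?\<mu> 0) = real k * growth (\<omega> i)" using growth_scale[of "real k" "\<omega> i"] by simp
    ultimately have "real k * growth (\<omega> i) \<le> of_int N + error_bound" using qdeg_growth[OF w] by linarith
    then show False using k pos by (simp add: divide_less_eq)
  qed
next
  assume neg: "\<forall>i\<in>{1..DIM('a)}. \<omega> i \<bullet> two_rho \<le> 0"
  have "qdeg (psi \<Phi> \<alpha> H T v (T w)) \<le> \<lceil>error_bound\<rceil>" if w: "w \<in> We" for w
  proof -
    obtain g where g: "g \<in> W0" "dominant (g (w 0))" using W0_dominant by blast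
    have "growth (w 0) = g (w 0) \<bullet> two_rho" using growth_W0[OF g(1)] growth_dominant[OF g(2)] by simp
    also have "\<dots> = (\<Sum>i\<in>{1..DIM('a)}. (g (w 0) \<bullet> \<alpha> i) * (\<omega> i \<bullet> two_rho))"
      by (subst coweight_coordinates[of "g (w 0)"]) (simp add: inner_sum_left)
    also have "\<dots> \<le> 0" using neg g(2) by (intro sum_nonpos mult_nonneg_nonpos) (auto simp: dominant_def)
    finally have "of_int (qdeg (psi \<Phi> \<alpha> H T v (T w))) \<le> error_bound" using qdeg_growth[OF w] by linarith
    then show ?thesis by linarith
  qed
  then show "bounded_rep \<Phi> \<alpha> T (psi \<Phi> \<alpha> H T v)" unfolding bounded_rep_def by blast
qed

text \<open>The simple reflection permutes the positive roots other than \<open>\<alpha> j\<close> and \<open>2 \<alpha> j\<close>, and the degrees are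
  constant on orbits, so the sum over these roots is fixed by the reflection and is orthogonal to
  \<open>\<alpha> j\<close>.  What remains is the contribution of \<open>\<alpha> j\<close> and its double.\<close>

lemma two_rho_cartan:
  assumes j: "j \<in> {1..DIM('a)}"
  shows "two_rho \<bullet> coroot (\<alpha> j) = 2 * of_int (d (\<alpha> j) + 2 * d (2 *\<^sub>R \<alpha> j))"
proof -
  define M where "M = pos \<inter> {\<alpha> j, 2 *\<^sub>R \<alpha> j}"
  define R where "R = (\<Sum>\<beta>\<in>pos - M. of_int (d \<beta>) *\<^sub>R \<beta>)"
  have nz: "\<alpha> j \<noteq> 0" by (rule root_nonzero[OF simple_root[OF j]])
  have sc: "refl (\<alpha> j) (c *\<^sub>R \<alpha> j) = - (c *\<^sub>R \<alpha> j)" for c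
    using refl_self[OF nz] by (simp add: linear_cmul[OF refl_linear])
  have notmult: "\<beta> \<noteq> c *\<^sub>R \<alpha> j" if "\<beta> \<in> pos - M" for \<beta> c
  proof
    assume c: "\<beta> = c *\<^sub>R \<alpha> j"
    have b: "\<beta> \<in> pos" using that by simp
    have "0 < c" using base_point_pos(1)[OF b] base_point_pos(1)[OF simple_pos[OF j]] c by (simp add: zero_less_mult_iff)
    then have "c = 1 \<or> c = 2" using simple_multiple_root[OF j] pos_rootD(1)[OF b] c by blast
    then show False using that c unfolding M_def by auto
  qed
  have into: "refl (\<alpha> j) \<beta> \<in> pos - M" if b: "\<beta> \<in> pos - M" for \<beta>
  proof -
    have "refl (\<alpha> j) \<beta> \<in> pos" using refl_simple_pos[OF j _ notmult[OF b]] b by blast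
    moreover have "refl (\<alpha> j) \<beta> \<noteq> c *\<^sub>R \<alpha> j" for c
    proof
      assume "refl (\<alpha> j) \<beta> = c *\<^sub>R \<alpha> j"
      then have "\<beta> = (- c) *\<^sub>R \<alpha> j" using refl_involution[of "\<alpha> j" \<beta>] sc[of c] by simp
      then show False using notmult[OF b] by blast
    qed
    from this[of 1] this[of 2] have "refl (\<alpha> j) \<beta> \<notin> M" unfolding M_def by auto
    ultimately show ?thesis by blast
  qed
  have bij: "bij_betw (refl (\<alpha> j)) (pos - M) (pos - M)"
    by (rule bij_betwI[where g = "refl (\<alpha> j)"]) (use into refl_involution in auto)
  have "refl (\<alpha> j) R = (\<Sum>\<beta>\<in>pos - M. of_int (d \<beta>) *\<^sub>R refl (\<alpha> j) \<beta>)"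
    unfolding R_def by (simp add: linear_sum[OF refl_linear] linear_cmul[OF refl_linear])
  also have "\<dots> = (\<Sum>\<beta>\<in>pos - M. of_int (d (refl (\<alpha> j) \<beta>)) *\<^sub>R refl (\<alpha> j) \<beta>)"
    by (simp add: d_W0[OF W0_simple[OF j]])
  also have "\<dots> = R" unfolding R_def by (rule sum.reindex_bij_betw[OF bij])
  finally have "refl (\<alpha> j) R \<bullet> \<alpha> j = R \<bullet> \<alpha> j" by simp
  then have "R \<bullet> \<alpha> j = 0" by (simp add: refl_adjoint refl_self[OF nz])
  then have R: "R \<bullet> coroot (\<alpha> j) = 0" by (simp add: coroot_def)
  have "two_rho = R + (\<Sum>\<beta>\<in>M. of_int (d \<beta>) *\<^sub>R \<beta>)"
    unfolding two_rho_def R_def by (rule sum.subset_diff) (auto simp: M_def finite_pos)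
  moreover have "(\<Sum>\<beta>\<in>M. of_int (d \<beta>) *\<^sub>R \<beta>) = (\<Sum>\<beta>\<in>{\<alpha> j, 2 *\<^sub>R \<alpha> j}. of_int (d \<beta>) *\<^sub>R \<beta>)"
  proof (rule sum.mono_neutral_left)
    have "d (2 *\<^sub>R \<alpha> j) = 0" if "2 *\<^sub>R \<alpha> j \<notin> pos"
    proof (rule d_nonroot)
      have "2 *\<^sub>R \<alpha> j \<in> pos_cone \<alpha>"
        using pos_cone_add[OF pos_rootD(2)[OF simple_pos[OF j]] pos_rootD(2)[OF simple_pos[OF j]]] by (simp add: scaleR_2)
      then show "2 *\<^sub>R \<alpha> j \<notin> \<Phi>" using that by (simp add: pos_roots_def)
    qed
    then show "\<forall>i\<in>{\<alpha> j, 2 *\<^sub>R \<alpha> j} - M. of_int (d i) *\<^sub>R i = 0" using simple_pos[OF j] unfolding M_def by auto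
  qed (auto simp: M_def)
  moreover have "\<alpha> j \<noteq> 2 *\<^sub>R \<alpha> j" using nz by (simp add: scaleR_2)
  ultimately have "two_rho = R + (of_int (d (\<alpha> j)) *\<^sub>R \<alpha> j + of_int (d (2 *\<^sub>R \<alpha> j)) *\<^sub>R (2 *\<^sub>R \<alpha> j))" by simp
  then show ?thesis using R coroot_inner_self[OF nz] by (simp add: inner_add_left)
qed

text \<open>The coordinates of \<open>two_rho\<close> solve a linear system given by the Cartan matrix, so they can be computed
  from the Dynkin diagram without listing the roots.\<close>

lemma two_rho_system:
  assumes j: "j \<in> {1..DIM('a)}"
  shows "(\<Sum>i\<in>{1..DIM('a)}. (\<omega> i \<bullet> two_rho) * (\<alpha> i \<bullet> coroot (\<alpha> j))) = 2 * of_int (d (\<alpha> j) + 2 * d (2 *\<^sub>R \<alpha> j))"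
  using two_rho_cartan[OF j] inner_via_coordinates[of two_rho "coroot (\<alpha> j)"] by simp

end

section \<open>The linear systems of the Cartan matrices\<close>

lemma chain_edge: "\<tau> \<in> {Ty_B, Ty_C, Ty_F, Ty_G} \<Longrightarrow> dynkin_edge \<tau> n i j \<longleftrightarrow> j = i + 1"
  by auto

lemma cartan_int_diag: "cartan_int \<tau> n j j = 2"
  by (simp add: cartan_int_def)

text \<open>The diagrams of these types are chains, so an equation of the system involves at most three
  consecutive unknowns.\<close>

lemma cartan_sum_chain:
  fixes c :: "nat \<Rightarrow> real"
  assumes "\<tau> \<in> {Ty_B, Ty_C, Ty_F, Ty_G}" and j: "j \<in> {1..n}"
  shows "(\<Sum>i\<in>{1..n}. c i * of_int (cartan_int \<tau> n i j)) =
    2 * c j + (if 1 < j then c (j - 1) * of_int (cartan_int \<tau> n (j - 1) j) else 0)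
            + (if j < n then c (j + 1) * of_int (cartan_int \<tau> n (j + 1) j) else 0)"
proof -
  have "c i * of_int (cartan_int \<tau> n i j) =
      (if i = j then 2 * c j else 0) +
      (if i = j - 1 then (if 1 < j then c (j - 1) * of_int (cartan_int \<tau> n (j - 1) j) else 0) else 0) +
      (if i = j + 1 then (if j < n then c (j + 1) * of_int (cartan_int \<tau> n (j + 1) j) else 0) else 0)"
    if ii: "i \<in> {1..n}" for i
  proof -
    consider "i = j" | "i = j - 1" "1 < j" | "i = j + 1" "j < n" | "i \<noteq> j" "i \<noteq> j - 1" "i \<noteq> j + 1" "j \<noteq> i + 1"
      using ii j by force
    then show ?thesis
    proof cases
      case 4
      then have "max i j \<noteq> min i j + 1" by (auto simp: max_def min_def)
      moreover have "\<not> (i = n - 1 \<and> j = n)" "\<not> (i = n \<and> j = n - 1)" "\<not> (i = 2 \<and> j = 3)" "\<not> (i = 2 \<and> j = 1)"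
        using 4 ii j by auto
      ultimately have "cartan_int \<tau> n i j = 0"
        unfolding cartan_int_def chain_edge[OF assms(1)] prod.inject using 4(1) by simp
      then show ?thesis using 4 by simp
    qed (use j in \<open>auto simp: cartan_int_diag\<close>)
  qed
  then have "(\<Sum>i\<in>{1..n}. c i * of_int (cartan_int \<tau> n i j)) = (\<Sum>i\<in>{1..n}.
      (if i = j then 2 * c j else 0) +
      (if i = j - 1 then (if 1 < j then c (j - 1) * of_int (cartan_int \<tau> n (j - 1) j) else 0) else 0) +
      (if i = j + 1 then (if j < n then c (j + 1) * of_int (cartan_int \<tau> n (j + 1) j) else 0) else 0))"
    by (intro sum.cong refl) simp
  moreover have "1 < j \<Longrightarrow> j - 1 \<in> {1..n}" "j < n \<Longrightarrow> j + 1 \<in> {1..n}" using j by auto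
  ultimately show ?thesis using j by (simp only: sum.distrib sum.delta finite_atLeastAtMost) simp
qed

text \<open>The equations for \<open>j < n\<close> are a second-order recurrence with constant second difference, which determines
  every unknown from the first one; the last equation fixes the first unknown.  The system also
  covers type \<open>BC\<^sub>n\<close>, whose simple roots have the Cartan matrix of \<open>B\<^sub>n\<close>, and therefore includes \<open>n = 1\<close>.\<close>

lemma B_system_solution:
  fixes c :: "nat \<Rightarrow> real"
  assumes "n \<ge> 1"
    and eq: "\<And>j. j \<in> {1..n} \<Longrightarrow> (\<Sum>i\<in>{1..n}. c i * of_int (cartan_int Ty_B n i j)) = 2 * (if j < n then x else y)"
    and i: "i \<in> {1..n}"
  shows "c i = real i * ((2 * real n - real i - 1) * x + y)"
proof -
  have mid: "c (j + 1) = 2 * c j - (if 1 < j then c (j - 1) else 0) - 2 * x" if "1 \<le> j" "j < n" for j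
  proof -
    have j: "j \<in> {1..n}" using that by auto
    have "cartan_int Ty_B n (j + 1) j = - 1" "1 < j \<Longrightarrow> cartan_int Ty_B n (j - 1) j = - 1"
      using that by (auto simp: cartan_int_def max_def min_def)
    then show ?thesis using eq[OF j] cartan_sum_chain[OF _ j, of Ty_B c] that by (auto split: if_splits)
  qed
  have lin: "c k = real k * c 1 - real k * (real k - 1) * x" if "1 \<le> k" "k \<le> n" for k
    using that
  proof (induction k rule: less_induct)
    case (less k)
    consider "k = 1" | "k = 2" | "k \<ge> 3" using less.prems by linarith
    then show ?case
    proof cases
      case 2 then show ?thesis using mid[of 1] less.prems by simp
    next
      case 3
      have "c k = 2 * c (k - 1) - c (k - 2) - 2 * x"
        using mid[of "k - 1"] 3 less.prems by (simp add: numeral_2_eq_2 One_nat_def)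
      moreover have "c (k - 1) = real (k - 1) * c 1 - real (k - 1) * (real (k - 1) - 1) * x"
        "c (k - 2) = real (k - 2) * c 1 - real (k - 2) * (real (k - 2) - 1) * x"
        using less.IH[of "k - 1"] less.IH[of "k - 2"] 3 less.prems by auto
      moreover have "real (k - 1) = real k - 1" "real (k - 2) = real k - 2" using 3 by (simp_all add: of_nat_diff)
      ultimately show ?thesis by (simp add: algebra_simps)
    qed simp
  qed
  have c1: "c 1 = 2 * (real n - 1) * x + y"
  proof (cases "n = 1")
    case True
    have "cartan_int Ty_B n 1 1 = 2" by (simp add: cartan_int_def)
    then show ?thesis using eq[of 1] True by simp
  next
    case False
    have n: "n \<in> {1..n}" using assms(1) by auto
    have "cartan_int Ty_B n (n - 1) n = - 2" using assms(1) by (auto simp: cartan_int_def)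
    then have "2 * c n - 2 * c (n - 1) = 2 * y" using eq[OF n] cartan_sum_chain[OF _ n, of Ty_B c] False assms(1) by simp
    moreover have "c n = real n * c 1 - real n * (real n - 1) * x"
      "c (n - 1) = real (n - 1) * c 1 - real (n - 1) * (real (n - 1) - 1) * x"
      using lin[of n] lin[of "n - 1"] False assms(1) by auto
    moreover have "real (n - 1) = real n - 1" using assms(1) by (simp add: of_nat_diff)
    ultimately show ?thesis by (simp add: algebra_simps)
  qed
  then show ?thesis using lin[of i] i unfolding c1 by (simp add: algebra_simps)
qed

text \<open>Doubling the last unknown turns the Cartan matrix of \<open>C\<^sub>n\<close> into that of \<open>B\<^sub>n\<close>.\<close>

lemma C_system_solution:
  fixes c :: "nat \<Rightarrow> real"
  assumes "n \<ge> 2"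
    and eq: "\<And>j. j \<in> {1..n} \<Longrightarrow> (\<Sum>i\<in>{1..n}. c i * of_int (cartan_int Ty_C n i j)) = 2 * (if j < n then x else y)"
    and i: "i \<in> {1..n}"
  shows "(if i < n then c i else 2 * c i) = real i * ((2 * real n - real i - 1) * x + 2 * y)"
proof -
  \<comment> \<open>The unknown rescaled so as to satisfy the system of \<open>B\<^sub>n\<close>.\<close>
  define c' where "c' i = (if i < n then c i else 2 * c i)" for i
  have "c' i = real i * ((2 * real n - real i - 1) * x + 2 * y)"
  proof (rule B_system_solution[OF _ _ i])
    show "n \<ge> 1" using assms(1) by simp
    fix j assume j: "j \<in> {1..n}"
    consider "j = n" | "j = n - 1" "j < n" | "j + 1 < n" using j by force
    then show "(\<Sum>i\<in>{1..n}. c' i * of_int (cartan_int Ty_B n i j)) = 2 * (if j < n then x else 2 * y)"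
    proof cases
      case 1
      have "cartan_int Ty_B n (n - 1) n = - 2" "cartan_int Ty_C n (n - 1) n = - 1"
        using assms(1) by (auto simp: cartan_int_def max_def min_def)
      then show ?thesis
        using eq[OF j] cartan_sum_chain[OF _ j, of Ty_C c] cartan_sum_chain[OF _ j, of Ty_B c'] 1 assms(1) by (simp add: c'_def)
    next
      case 2
      have "cartan_int Ty_B n (j + 1) j = - 1" "cartan_int Ty_C n (j + 1) j = - 2"
          "1 < j \<Longrightarrow> cartan_int Ty_B n (j - 1) j = - 1" "1 < j \<Longrightarrow> cartan_int Ty_C n (j - 1) j = - 1"
        using 2 assms(1) by (auto simp: cartan_int_def max_def min_def)
      then show ?thesis
        using eq[OF j] cartan_sum_chain[OF _ j, of Ty_C c] cartan_sum_chain[OF _ j, of Ty_B c'] 2 assms(1)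
        by (auto simp: c'_def split: if_splits)
    next
      case 3
      have "cartan_int Ty_B n (j + 1) j = - 1" "cartan_int Ty_C n (j + 1) j = - 1"
          "1 < j \<Longrightarrow> cartan_int Ty_B n (j - 1) j = - 1" "1 < j \<Longrightarrow> cartan_int Ty_C n (j - 1) j = - 1"
        using 3 j by (auto simp: cartan_int_def max_def min_def)
      then show ?thesis
        using eq[OF j] cartan_sum_chain[OF _ j, of Ty_C c] cartan_sum_chain[OF _ j, of Ty_B c'] 3 assms(1)
        by (auto simp: c'_def split: if_splits)
    qed
  qed
  then show ?thesis by (simp add: c'_def)
qed

lemma F_system_solution:
  fixes c :: "nat \<Rightarrow> real"
  assumes eq: "\<And>j. j \<in> {1..4} \<Longrightarrow> (\<Sum>i\<in>{1..4}. c i * of_int (cartan_int Ty_F 4 i j)) = 2 * (if j \<ge> 3 then x else y)"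
  shows "c 1 = 6 * x + 10 * y" "c 2 = 12 * x + 18 * y" "c 3 = 18 * x + 24 * y" "c 4 = 10 * x + 12 * y"
proof -
  have e: "2 * c 1 - c 2 = 2 * y" "2 * c 2 - c 1 - c 3 = 2 * y" "2 * c 3 - 2 * c 2 - c 4 = 2 * x" "2 * c 4 - c 3 = 2 * x"
    using trans[OF sym[OF eq[of 1]] cartan_sum_chain[of Ty_F 1 4 c]] trans[OF sym[OF eq[of 2]] cartan_sum_chain[of Ty_F 2 4 c]]
      trans[OF sym[OF eq[of 3]] cartan_sum_chain[of Ty_F 3 4 c]] trans[OF sym[OF eq[of 4]] cartan_sum_chain[of Ty_F 4 4 c]]
    by (simp_all add: cartan_int_def One_nat_def[symmetric])
  from e show "c 1 = 6 * x + 10 * y" "c 2 = 12 * x + 18 * y" "c 3 = 18 * x + 24 * y" "c 4 = 10 * x + 12 * y"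
    by linarith+
qed

lemma G_system_solution:
  fixes c :: "nat \<Rightarrow> real"
  assumes eq: "\<And>j. j \<in> {1..2} \<Longrightarrow> (\<Sum>i\<in>{1..2}. c i * of_int (cartan_int Ty_G 2 i j)) = 2 * (if j = 1 then x else y)"
  shows "c 1 = 4 * x + 6 * y" "c 2 = 2 * x + 4 * y"
proof -
  have e: "2 * c 1 - 3 * c 2 = 2 * x" "2 * c 2 - c 1 = 2 * y"
    using trans[OF sym[OF eq[of 1]] cartan_sum_chain[of Ty_G 1 2 c]] trans[OF sym[OF eq[of 2]] cartan_sum_chain[of Ty_G 2 2 c]]
    by (simp_all add: cartan_int_def One_nat_def[symmetric])
  from e show "c 1 = 4 * x + 6 * y" "c 2 = 2 * x + 4 * y" by linarith+
qed

text \<open>The coefficient \<open>2 n - i - 1\<close> runs from \<open>2 n - 2\<close> down to \<open>n - 1\<close>, so the extreme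
  values of \<open>i\<close> decide.\<close>

lemma B_nonpos_iff:
  assumes "n \<ge> 1"
  shows "(\<forall>i\<in>{1..n}. real i * ((2 * real n - real i - 1) * x + y) \<le> 0) \<longleftrightarrow>
    2 * (real n - 1) * x + y \<le> 0 \<and> (real n - 1) * x + y \<le> 0"
proof
  assume a: "\<forall>i\<in>{1..n}. real i * ((2 * real n - real i - 1) * x + y) \<le> 0"
  have "(2 * real n - real i - 1) * x + y \<le> 0" if "i \<in> {1..n}" for i
    using a that by (force simp: mult_le_0_iff)
  from this[of 1] this[of n] show "2 * (real n - 1) * x + y \<le> 0 \<and> (real n - 1) * x + y \<le> 0"
    using assms by (simp add: algebra_simps)
next
  assume b: "2 * (real n - 1) * x + y \<le> 0 \<and> (real n - 1) * x + y \<le> 0"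
  show "\<forall>i\<in>{1..n}. real i * ((2 * real n - real i - 1) * x + y) \<le> 0"
  proof
    fix i assume i: "i \<in> {1..n}"
    have "(2 * real n - real i - 1) * x + y \<le> 0"
    proof (cases "0 \<le> x")
      case True
      have "(2 * real n - real i - 1) * x \<le> (2 * (real n - 1)) * x" using i True by (intro mult_right_mono) auto
      then show ?thesis using b by linarith
    next
      case False
      have "(2 * real n - real i - 1) * x \<le> (real n - 1) * x" using i False by (intro mult_right_mono_neg) auto
      then show ?thesis using b by linarith
    qed
    then show "real i * ((2 * real n - real i - 1) * x + y) \<le> 0" by (simp add: mult_nonneg_nonpos)
  qed
qed

section \<open>Weighted parameter systems\<close>

lemma qpow_neq_minus: "qpow k \<noteq> - qpow l" "- qpow l \<noteq> qpow k"
proof -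
  have *: "qpow k \<noteq> - qpow l"
  proof
    assume eq: "qpow k = - qpow l"
    then have "k = l" using ldeg_qpow by metis
    then have "Poly_Mapping.lookup (qpow k) k = - Poly_Mapping.lookup (qpow k) k" using eq by (metis lookup_uminus)
    then show False by (simp add: qpow_def lookup_single)
  qed
  from * show "qpow k \<noteq> - qpow l" .
  from * show "- qpow l \<noteq> qpow k" by metis
qed

locale weighted_hecke_algebra = hecke_algebra \<Phi> \<alpha> L H T
  for \<Phi> :: "'a::euclidean_space set" and \<alpha> L and H :: "(laurent, 'h) module" and T +
  fixes \<tau> :: root_type
  assumes labelled: "bourbaki_labelled \<tau> \<Phi> \<alpha>"
    and weight: "positive_weight_function \<tau> \<Phi> \<alpha> L"
begin

lemma s_neq_id: "i \<in> {0..DIM('a)} \<Longrightarrow> s i \<noteq> id"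
  using wlen_generator[of i] wlen_stab[OF id_stab] by auto

lemma s_affine_weyl: assumes "i \<in> {0..DIM('a)}" shows "s i \<in> affine_weyl \<Phi> \<alpha>"
proof (cases "i = 0")
  case True
  have "coroot \<theta> \<in> Q" using Q_coroot[OF highest_root(1), of 1] by simp
  then show ?thesis unfolding True s_zero affine_weyl_def using W0_refl_root[OF highest_root(1)] by blast
next
  case False
  then have i: "i \<in> {1..DIM('a)}" using assms by auto
  have "s i = transl 0 \<circ> refl (\<alpha> i)" by (auto simp: gen_refl_node[OF i] transl_def fun_eq_iff)
  then show ?thesis unfolding affine_weyl_def using Q_zero W0_simple[OF i] by blast
qed

lemma L_pos: "i \<in> {0..DIM('a)} \<Longrightarrow> 0 < L (s i)"
  using weight s_affine_weyl s_neq_id unfolding positive_weight_function_def by blast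

lemma L_conjugate:
  assumes "i \<in> {0..DIM('a)}" "j \<in> {0..DIM('a)}" and t: "t \<in> We" "s i \<circ> t = t \<circ> s j"
  shows "L (s i) = L (s j)"
proof -
  have "t \<circ> Hilbert_Choice.inv t = id" using bij_is_surj[OF We_bij[OF t(1)]] by (simp add: surj_iff)
  then have "s i = t \<circ> s j \<circ> Hilbert_Choice.inv t" unfolding t(2)[symmetric] by (simp add: comp_assoc)
  then have "\<exists>g\<in>We. s i = g \<circ> s j \<circ> Hilbert_Choice.inv g" using t(1) by blast
  then show ?thesis using weight assms(1,2) unfolding positive_weight_function_def by blast
qed

lemma L_simple_conjugate:
  assumes i: "i \<in> {1..DIM('a)}" and j: "j \<in> {1..DIM('a)}" and g: "g \<in> W0" "g (\<alpha> j) = \<alpha> i"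
  shows "L (s i) = L (s j)"
proof (rule L_conjugate[OF _ _ W0_We[OF g(1)]])
  show "s i \<circ> g = g \<circ> s j"
    using refl_conj[OF g(1), of "\<alpha> j"] g(2) by (auto simp: gen_refl_node[OF i] gen_refl_node[OF j] fun_eq_iff)
qed (use i j in auto)

lemma L_equal_norm:
  assumes "i \<in> {1..DIM('a)}" "j \<in> {1..DIM('a)}" "norm (\<alpha> i) = norm (\<alpha> j)"
  shows "L (s i) = L (s j)"
  using equal_norm_conjugate[OF simple_root[OF assms(2)] simple_root[OF assms(1)]] assms L_simple_conjugate by metis

text \<open>Some coweight in the orbit of \<open>\<omega> j\<close> has product \<open>1\<close> with \<open>\<theta>\<close>.  Translating by it carries the hyperplane of
  \<open>\<theta>\<close> at level \<open>0\<close> to level \<open>1\<close>, so \<open>s 0\<close> and \<open>s j\<close> are conjugate in the extended group.\<close>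

lemma L_affine:
  assumes j: "j \<in> {1..DIM('a)}" and g: "g \<in> W0" "\<theta> = g (\<alpha> j)"
  shows "L (s 0) = L (s j)"
proof -
  let ?\<mu> = "g (\<omega> j)"
  have t: "transl ?\<mu> \<circ> g \<in> We" by (rule We_I[OF P_W0[OF fund_coweight_P g(1)] g(1)])
  have "s 0 \<circ> (transl ?\<mu> \<circ> g) = (transl ?\<mu> \<circ> g) \<circ> s j"
  proof
    fix x
    have "(g x + ?\<mu>) \<bullet> \<theta> - 1 = x \<bullet> \<alpha> j"
      using fund_coweight_simple[OF j, of j] by (simp add: g(2) inner_add_left W0_isometry[OF g(1)])
    then show "(s 0 \<circ> (transl ?\<mu> \<circ> g)) x = ((transl ?\<mu> \<circ> g) \<circ> s j) x"
      unfolding gen_refl_node[OF j] by (simp add: gen_refl_def aff_refl_def transl_def W0_coroot[OF g(1), symmetric] g(2)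
          linear_diff[OF W0_linear[OF g(1)]] linear_cmul[OF W0_linear[OF g(1)]])
  qed
  then show ?thesis using L_conjugate[OF _ _ t] j by simp
qed

lemma rank_pos: "1 \<in> {1..DIM('a)}" "DIM('a) \<in> {1..DIM('a)}"
  by (simp_all add: Suc_le_eq One_nat_def)

lemma reduced_conjugate:
  assumes "reduced_roots \<Phi>" "\<beta> \<in> \<Phi>"
  shows "\<exists>g\<in>W0. \<exists>j\<in>{1..DIM('a)}. \<beta> = g (\<alpha> j)"
proof -
  obtain g j c where g: "g \<in> W0" "j \<in> {1..DIM('a)}" "c = 1 \<or> c = 2" "\<beta> = g (c *\<^sub>R \<alpha> j)"
    using root_conjugate_simple[OF assms(2)] by blast
  have "c *\<^sub>R \<alpha> j \<in> \<Phi>" using W0_root_iff[OF g(1)] assms(2) g(4) by blast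
  then have "c = 1 \<or> c = - 1" using assms(1) simple_root[OF g(2)] unfolding reduced_roots_def by blast
  then have "\<beta> = g (\<alpha> j)" using g(3,4) by auto
  then show ?thesis using g(1,2) by blast
qed

lemma reduced_double: "reduced_roots \<Phi> \<Longrightarrow> \<beta> \<in> \<Phi> \<Longrightarrow> 2 *\<^sub>R \<beta> \<notin> \<Phi>"
  unfolding reduced_roots_def by force

text \<open>Replace \<open>\<beta>\<close> by its dominant conjugate.  Then \<open>\<theta> + \<beta>\<close> is dominant and \<open>\<theta> - \<beta>\<close> lies in the
  positive cone, and their inner product is the difference of the square lengths.\<close>

lemma highest_root_norm: assumes b: "\<beta> \<in> \<Phi>" shows "norm \<beta> \<le> norm \<theta>"
proof -
  obtain g where g: "g \<in> W0" "dominant (g \<beta>)" using W0_dominant by blast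
  have "dominant (\<theta> + g \<beta>)"
    unfolding dominant_def
  proof
    fix i assume i: "i \<in> {1..DIM('a)}"
    have "0 \<le> g \<beta> \<bullet> \<alpha> i" using g(2) i unfolding dominant_def by blast
    moreover have "0 \<le> \<theta> \<bullet> \<alpha> i" using maximal_root_dominant[OF highest_root_maximal i] by (simp add: inner_commute)
    ultimately show "0 \<le> (\<theta> + g \<beta>) \<bullet> \<alpha> i" by (simp add: inner_add_left)
  qed
  then have "0 \<le> (\<theta> + g \<beta>) \<bullet> (\<theta> - g \<beta>)" by (rule dominant_pos_cone[OF _ highest_root(2)[OF W0_root[OF g(1) b]]])
  then have "\<beta> \<bullet> \<beta> \<le> \<theta> \<bullet> \<theta>" 
    by (simp add: inner_diff_right inner_add_left inner_commute[of "g \<beta>" \<theta>] W0_isometry[OF g(1)])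
  then show ?thesis by (simp add: norm_le)
qed

subsection \<open>The non-reduced model\<close>

text \<open>The highest root has the length of \<open>2 \<alpha>\<^sub>n\<close> and is therefore conjugate to it, which identifies
  the parameter of \<open>T\<^sub>0\<close>.  The Cartan integers of the simple roots are those of type \<open>B\<^sub>n\<close>.\<close>

lemma BC_facts:
  assumes "\<tau> = Ty_BC"
  shows "2 *\<^sub>R \<alpha> DIM('a) \<in> \<Phi>" "\<not> reduced_roots \<Phi>"
    "j \<in> {1..<DIM('a)} \<Longrightarrow> 2 *\<^sub>R \<alpha> j \<notin> \<Phi>"
    "norm \<theta> = norm (2 *\<^sub>R \<alpha> DIM('a))"
    "\<And>i j. i \<in> {1..DIM('a)} \<Longrightarrow> j \<in> {1..DIM('a)} \<Longrightarrow>
      \<alpha> i \<bullet> coroot (\<alpha> j) = of_int (cartan_int Ty_B DIM('a) i j)"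
    "\<And>i j. i \<in> {1..<DIM('a)} \<Longrightarrow> j \<in> {1..<DIM('a)} \<Longrightarrow> norm (\<alpha> i) = norm (\<alpha> j)"
proof -
  let ?n = "DIM('a)"
  have "BC_model \<Phi> \<alpha>" using labelled assms by (simp add: bourbaki_labelled_def)
  then obtain e :: "nat \<Rightarrow> 'a" where
    on: "\<forall>i\<in>{1..?n}. \<forall>j\<in>{1..?n}. e i \<bullet> e j = (if i = j then 1 else 0)"
    and sim0: "\<forall>j\<in>{1..<?n}. \<alpha> j = e j - e (j + 1)" and last: "\<alpha> ?n = e ?n"
    and ps: "pos = {e i - e j | i j. 1 \<le> i \<and> i < j \<and> j \<le> ?n} \<union> {e i + e j | i j. 1 \<le> i \<and> i < j \<and> j \<le> ?n}
      \<union> {e k | k. 1 \<le> k \<and> k \<le> ?n} \<union> {2 *\<^sub>R e k | k. 1 \<le> k \<and> k \<le> ?n}"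
    unfolding BC_model_def by (elim exE conjE) (rule that; assumption)
  have sim: "\<alpha> j = e j - e (j + 1)" if "j \<in> {1..<?n}" for j using sim0 that by blast
  have n: "1 \<le> ?n" using rank_pos(2) by simp
  have "2 *\<^sub>R e ?n \<in> pos" unfolding ps using n by blast
  then show dbl: "2 *\<^sub>R \<alpha> ?n \<in> \<Phi>" using last pos_rootD by simp
  then show "\<not> reduced_roots \<Phi>" using reduced_double simple_root[OF rank_pos(2)] by blast
  have on': "e i \<bullet> e j = (if i = j then 1 else 0)" if "1 \<le> i" "i \<le> ?n" "1 \<le> j" "j \<le> ?n" for i j using on that by simp
  show "2 *\<^sub>R \<alpha> j \<notin> \<Phi>" if j: "j \<in> {1..<?n}" for j
  proof
    assume r: "2 *\<^sub>R \<alpha> j \<in> \<Phi>"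
    have ji: "j \<in> {1..?n}" using j by auto
    have mem: "2 *\<^sub>R \<alpha> j \<in> pos"
      using r pos_cone_add[OF pos_rootD(2)[OF simple_pos[OF ji]] pos_rootD(2)[OF simple_pos[OF ji]]] by (simp add: pos_roots_def scaleR_2)
    have bd: "- 2 < x \<bullet> e k" if "x \<in> pos" "1 \<le> k" "k \<le> ?n" for x k
      using that unfolding ps by (auto simp: inner_diff_left inner_add_left on')
    have "1 \<le> j + 1" "j + 1 \<le> ?n" using j by auto
    from bd[OF mem this] have "- 2 < (2 *\<^sub>R \<alpha> j) \<bullet> e (j + 1)" .
    then show False using j by (simp add: sim inner_diff_left on')
  qed
  have "norm x \<le> 2" if "x \<in> pos" for x
  proof -
    have "x \<bullet> x \<le> 2 * 2" using that unfolding ps by (auto simp: inner_diff_left inner_add_left inner_diff_right inner_add_right on')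
    then show ?thesis using norm_le_square[of x 2] by (simp add: power2_eq_square)
  qed
  then have "norm \<theta> \<le> 2" using highest_root_pos by blast
  moreover have "norm (2 *\<^sub>R \<alpha> ?n) = 2" using n by (simp add: last norm_eq_sqrt_inner on')
  ultimately show "norm \<theta> = norm (2 *\<^sub>R \<alpha> ?n)" using highest_root_norm[OF dbl] by simp
  have self: "\<alpha> j \<bullet> \<alpha> j = (if j < ?n then 2 else 1)" if "j \<in> {1..?n}" for j
    using that last by (cases "j < ?n") (auto simp: sim inner_diff_left inner_diff_right on')
  show "\<alpha> i \<bullet> coroot (\<alpha> j) = of_int (cartan_int Ty_B ?n i j)" if i: "i \<in> {1..?n}" and j: "j \<in> {1..?n}" for i j
  proof -
    have "\<alpha> i \<bullet> coroot (\<alpha> j) = (if j < ?n then 1 else 2) * (\<alpha> i \<bullet> \<alpha> j)" by (simp add: coroot_def self[OF j])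
    also have "\<alpha> i \<bullet> \<alpha> j = (if i = j then (if j < ?n then 2 else 1) else if i = j + 1 \<or> j = i + 1 then - 1 else 0)"
    proof (cases "i < ?n"; cases "j < ?n")
      assume "i < ?n" "j < ?n" then show ?thesis using i j by (auto simp: sim inner_diff_left inner_diff_right on')
    next
      assume "i < ?n" "\<not> j < ?n"
      then have "j = ?n" using j by simp
      then show ?thesis using i \<open>i < ?n\<close> by (auto simp: sim last inner_diff_left inner_diff_right on')
    next
      assume "\<not> i < ?n" "j < ?n"
      then have "i = ?n" using i by simp
      then show ?thesis using j \<open>j < ?n\<close> by (auto simp: sim last inner_diff_left inner_diff_right on')
    next
      assume "\<not> i < ?n" "\<not> j < ?n"
      then have "i = ?n" "j = ?n" using i j by simp_all
      then show ?thesis using n by (simp add: last on')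
    qed
    finally show ?thesis using i j by (auto simp: cartan_int_def max_def min_def split: if_splits)
  qed
  show "norm (\<alpha> i) = norm (\<alpha> j)" if "i \<in> {1..<?n}" "j \<in> {1..<?n}" for i j
    using self[of i] self[of j] that by (auto simp: norm_eq)
qed

lemma reduced_iff: "reduced_roots \<Phi> \<longleftrightarrow> \<tau> \<noteq> Ty_BC"
  using BC_facts(2) labelled by (auto simp: bourbaki_labelled_def)

lemma reduced_cartan:
  "\<tau> \<noteq> Ty_BC \<Longrightarrow> i \<in> {1..DIM('a)} \<Longrightarrow> j \<in> {1..DIM('a)} \<Longrightarrow> \<alpha> i \<bullet> coroot (\<alpha> j) = of_int (cartan_int \<tau> DIM('a) i j)"
  using labelled by (simp add: bourbaki_labelled_def)

lemma monomial_pm: "x \<in> {qpow k, - qpow l} \<Longrightarrow> monomial x"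
  by (auto simp: monomial_def)

text \<open>A weighted parameter system prescribes values on simple roots and on \<open>2 \<alpha>\<^sub>n\<close> only.  Conjugacy spreads them to
  all roots, and the highest root is conjugate to one of these, in such a way that
  \<open>v\<close> at \<open>\<theta>\<close> fits the weight of \<open>s 0\<close>.\<close>

lemma weighted_monomial_character:
  assumes v: "weighted_parameter_system \<tau> \<Phi> \<alpha> L v"
  shows "monomial_character \<Phi> \<alpha> L H T v"
proof
  have u: "\<And>\<beta>. \<beta> \<in> \<Phi> \<Longrightarrow> v \<beta> \<in> Units laurent_ring" and nr: "\<And>\<beta>. \<beta> \<notin> \<Phi> \<Longrightarrow> v \<beta> = 1"
    and inv: "\<And>g \<beta>. g \<in> W0 \<Longrightarrow> \<beta> \<in> \<Phi> \<Longrightarrow> v (g \<beta>) = v \<beta>"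
    and red: "\<And>j. j \<in> {1..DIM('a)} \<Longrightarrow> 2 *\<^sub>R \<alpha> j \<notin> \<Phi> \<Longrightarrow> v (\<alpha> j) \<in> {qpow (int (L (s j))), - qpow (- int (L (s j)))}"
    and bc: "\<tau> = Ty_BC \<Longrightarrow> v (2 *\<^sub>R \<alpha> DIM('a)) \<in> {qpow (int (L (s 0))), - qpow (- int (L (s 0)))}"
      "\<tau> = Ty_BC \<Longrightarrow> v (\<alpha> DIM('a)) * v (2 *\<^sub>R \<alpha> DIM('a)) \<in> {qpow (int (L (s DIM('a)))), - qpow (- int (L (s DIM('a))))}"
    using v unfolding weighted_parameter_system_def by blast+
  show "v \<beta> \<in> Units laurent_ring" if "\<beta> \<in> \<Phi>" for \<beta> using u[OF that] .
  show "v \<beta> = 1" if "\<beta> \<notin> \<Phi>" for \<beta> using nr[OF that] .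
  show W: "v (g \<beta>) = v \<beta>" if "g \<in> W0" for g \<beta>
    using inv[OF that, of \<beta>] nr[of \<beta>] nr[of "g \<beta>"] W0_root_iff[OF that, of \<beta>] by (cases "\<beta> \<in> \<Phi>") auto
  have neg: "v (- \<beta>) = v \<beta>" if "\<beta> \<in> \<Phi>" for \<beta>
    using W[OF W0_refl_root[OF that], of \<beta>] refl_self[OF root_nonzero[OF that]] by simp
  have node: "v (\<alpha> j) * v (2 *\<^sub>R \<alpha> j) \<in> {qpow (int (L (s j))), - qpow (- int (L (s j)))}" if j: "j \<in> {1..DIM('a)}" for j
  proof (cases "2 *\<^sub>R \<alpha> j \<in> \<Phi>")
    case False then show ?thesis using red[OF j False] nr[OF False] by simp
  next
    case True
    then have "\<tau> = Ty_BC" using reduced_double[OF _ simple_root[OF j]] reduced_iff by blast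
    moreover then have "j = DIM('a)" using BC_facts(3)[of j] True j by force
    ultimately show ?thesis using bc(2) by simp
  qed
  show "v (wall_root i) * v (2 *\<^sub>R wall_root i) \<in> {qpow (int (L (s i))), - qpow (- int (L (s i)))}" if i: "i \<in> {0..DIM('a)}" for i
  proof (cases "i = 0")
    case False
    then have j: "i \<in> {1..DIM('a)}" using i by auto
    have "v (2 *\<^sub>R (- \<alpha> i)) = v (2 *\<^sub>R \<alpha> i)"
      using W[OF W0_simple[OF j], of "2 *\<^sub>R \<alpha> i"] refl_self[OF root_nonzero[OF simple_root[OF j]]]
      by (simp add: linear_cmul[OF refl_linear])
    then show ?thesis using node[OF j] neg[OF simple_root[OF j]] False by (simp add: wall_root_def)
  next
    case True
    have "v \<theta> \<in> {qpow (int (L (s 0))), - qpow (- int (L (s 0)))}"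
    proof (cases "\<tau> = Ty_BC")
      case True
      obtain g where "g \<in> W0" "g (2 *\<^sub>R \<alpha> DIM('a)) = \<theta>"
        using equal_norm_conjugate[OF BC_facts(1)[OF True] highest_root(1)] BC_facts(4)[OF True] by auto
      then show ?thesis using W bc(1)[OF True] by metis
    next
      case False
      then obtain g j where g: "g \<in> W0" "j \<in> {1..DIM('a)}" "\<theta> = g (\<alpha> j)"
        using reduced_conjugate[OF _ highest_root(1)] reduced_iff by blast
      have "2 *\<^sub>R \<alpha> j \<notin> \<Phi>" using reduced_double[OF _ simple_root[OF g(2)]] reduced_iff False by blast
      then show ?thesis using red[OF g(2)] L_affine[OF g(2,1,3)] W[OF g(1), of "\<alpha> j"] g(3) by simp
    qed
    then show ?thesis using True nr[OF double_highest_root] by (simp add: wall_root_def)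
  qed
  show "monomial (v \<beta>)" if b: "\<beta> \<in> \<Phi>" for \<beta>
  proof -
    obtain g j c where g: "g \<in> W0" "j \<in> {1..DIM('a)}" "c = 1 \<or> c = 2" "\<beta> = g (c *\<^sub>R \<alpha> j)"
      using root_conjugate_simple[OF b] by blast
    have e: "v \<beta> = v (c *\<^sub>R \<alpha> j)" using W[OF g(1)] g(4) by simp
    have r: "c *\<^sub>R \<alpha> j \<in> \<Phi>" using W0_root_iff[OF g(1)] b g(4) by blast
    show ?thesis
    proof (cases "2 *\<^sub>R \<alpha> j \<in> \<Phi>")
      case False
      then have "c = 1" using r g(3) by auto
      then show ?thesis using e monomial_pm[OF red[OF g(2) False]] by simp
    next
      case True
      then have t: "\<tau> = Ty_BC" using reduced_double[OF _ simple_root[OF g(2)]] reduced_iff by blast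
      then have j: "j = DIM('a)" using BC_facts(3)[of j] True g(2) by force
      have "monomial (v (2 *\<^sub>R \<alpha> j))" using monomial_pm[OF bc(1)[OF t]] j by simp
      moreover have "monomial (v (\<alpha> j))"
        using monomial_quotient[OF monomial_pm[OF node[OF g(2)]]] calculation .
      ultimately show ?thesis using g(3) e by auto
    qed
  qed
qed

end

section \<open>Comparison with the list\<close>

text \<open>The bounds on the ratio of the weights in the second and in the third line of the list for two root
  lengths.\<close>

definition ratio_bounds :: "root_type \<Rightarrow> real \<Rightarrow> real \<Rightarrow> bool \<times> bool" where
  "ratio_bounds \<tau> n r =
     (\<tau> = Ty_B \<and> r \<le> n - 1 \<or> \<tau> = Ty_C \<and> r \<le> 1 / (n - 1) \<or> \<tau> = Ty_F \<and> r \<le> 6 / 5 \<or> \<tau> = Ty_G \<and> r \<le> 3 / 2,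
      \<tau> = Ty_B \<and> r \<ge> 2 * (n - 1) \<or> \<tau> = Ty_C \<and> r \<ge> 2 / (n - 1) \<or> \<tau> = Ty_F \<and> r \<ge> 5 / 3 \<or> \<tau> = Ty_G \<and> r \<ge> 2)"

text \<open>The eight sign choices in type \<open>BC\<^sub>n\<close> for \<open>n \<ge> 2\<close>: \<open>F\<close>, \<open>G\<close> and \<open>K\<close> say that the values of \<open>T\<^sub>1\<close>,
  \<open>T\<^sub>n\<close> and \<open>T\<^sub>0\<close> have positive degree, and \<open>N\<close> stands for \<open>(n - 1) b\<close>.\<close>

lemma BC_sign_cases:
  fixes a c N :: real
  assumes "0 < a" "0 < c" "c \<le> a" "0 < N"
  shows "(2 * (if F then N else - N) + ((if G then a else - a) + (if K then c else - c)) \<le> 0 \<and>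
      (if F then N else - N) + ((if G then a else - a) + (if K then c else - c)) \<le> 0) \<longleftrightarrow>
    (\<not> F \<and> \<not> G \<and> \<not> K \<or> \<not> F \<and> \<not> G \<and> K \<or>
     (F \<and> \<not> G \<and> \<not> K) \<and> 2 * N \<le> a + c \<or> (F \<and> \<not> G \<and> K) \<and> 2 * N \<le> a - c \<or>
     (\<not> F \<and> G \<and> \<not> K) \<and> a - c \<le> N \<or> (\<not> F \<and> G \<and> K) \<and> a + c \<le> N)"
  using assms by (cases F; cases G; cases K) auto

text \<open>For \<open>n = 1\<close> there are no roots of middle length; the choices are those of \<open>T\<^sub>n\<close> and \<open>T\<^sub>0\<close>.\<close>

lemma BC_sign_cases_rank_one:
  fixes a c :: real
  assumes "0 < a" "0 < c" "c \<le> a"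
  shows "(0 + ((if G then a else - a) + (if K then c else - c)) \<le> 0) \<longleftrightarrow>
    (\<not> G \<and> \<not> K \<or> \<not> G \<and> K \<or> (\<not> G \<and> \<not> K) \<and> 0 \<le> a + c \<or> (\<not> G \<and> K) \<and> 0 \<le> a - c \<or>
     (G \<and> \<not> K) \<and> a - c \<le> 0 \<or> (G \<and> K) \<and> a + c \<le> 0)"
  using assms by (cases G; cases K) auto

context weighted_hecke_algebra
begin

lemma cartan_norm:
  assumes "i \<in> {1..DIM('a)}" "j \<in> {1..DIM('a)}"
  shows "(\<alpha> i \<bullet> coroot (\<alpha> j)) * (\<alpha> j \<bullet> \<alpha> j) = (\<alpha> j \<bullet> coroot (\<alpha> i)) * (\<alpha> i \<bullet> \<alpha> i)"
  using root_nonzero[OF simple_root[OF assms(1)]] root_nonzero[OF simple_root[OF assms(2)]]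
  by (simp add: coroot_def inner_commute)

lemma cartan_norm_int:
  assumes "\<tau> \<noteq> Ty_BC" "i \<in> {1..DIM('a)}" "j \<in> {1..DIM('a)}"
  shows "of_int (cartan_int \<tau> DIM('a) i j) * (\<alpha> j \<bullet> \<alpha> j) = of_int (cartan_int \<tau> DIM('a) j i) * (\<alpha> i \<bullet> \<alpha> i)"
  using cartan_norm[OF assms(2,3)] reduced_cartan[OF assms(1)] assms by simp

text \<open>A symmetric Cartan matrix forces adjacent simple roots to have equal length; connectedness of the
  diagram spreads this to all simple roots, and conjugacy to all roots.\<close>

lemma ADE_simply_laced:
  assumes t: "\<tau> \<in> {Ty_A, Ty_D, Ty_E}" shows "simply_laced \<Phi>"
proof -
  have nbc: "\<tau> \<noteq> Ty_BC" using t by auto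
  then have red: "reduced_roots \<Phi>" using reduced_iff by simp
  define K where "K = {i \<in> {1..DIM('a)}. \<alpha> i \<bullet> \<alpha> i = \<alpha> 1 \<bullet> \<alpha> 1}"
  have "K = {1..DIM('a)}"
  proof (rule nodes_connected)
    show "K \<subseteq> {1..DIM('a)}" "K \<noteq> {}" using rank_pos(1) by (auto simp: K_def)
    fix i j assume ij: "i \<in> K" "j \<in> {1..DIM('a)} - K"
    then have i: "i \<in> {1..DIM('a)}" and j: "j \<in> {1..DIM('a)}" and ne: "\<alpha> i \<bullet> \<alpha> i \<noteq> \<alpha> j \<bullet> \<alpha> j"
      by (auto simp: K_def)
    have "cartan_int \<tau> DIM('a) j i = cartan_int \<tau> DIM('a) i j"
      using t by (auto simp: cartan_int_def min.commute max.commute)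
    then have "cartan_int \<tau> DIM('a) i j = 0" using cartan_norm_int[OF nbc i j] ne by simp
    then have "\<alpha> i \<bullet> coroot (\<alpha> j) = 0" using reduced_cartan[OF nbc i j] by simp
    then show "\<alpha> i \<bullet> \<alpha> j = 0" using root_nonzero[OF simple_root[OF j]] by (simp add: coroot_def)
  qed
  then have eq: "\<alpha> i \<bullet> \<alpha> i = \<alpha> 1 \<bullet> \<alpha> 1" if "i \<in> {1..DIM('a)}" for i using that unfolding K_def by blast
  have "\<beta> \<bullet> \<beta> = \<alpha> 1 \<bullet> \<alpha> 1" if b: "\<beta> \<in> \<Phi>" for \<beta>
  proof -
    obtain g j where g: "g \<in> W0" "j \<in> {1..DIM('a)}" "\<beta> = g (\<alpha> j)" using reduced_conjugate[OF red b] by blast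
    then show ?thesis using eq[OF g(2)] W0_isometry[OF g(1)] by simp
  qed
  then show ?thesis unfolding simply_laced_def norm_eq using red by simp
qed

context
  fixes v :: "'a \<Rightarrow> laurent"
  assumes v: "weighted_parameter_system \<tau> \<Phi> \<alpha> L v"
begin

interpretation C: monomial_character \<Phi> \<alpha> L H T v
  by (rule weighted_monomial_character[OF v])

lemma v_equal_norm: "\<beta> \<in> \<Phi> \<Longrightarrow> \<gamma> \<in> \<Phi> \<Longrightarrow> norm \<beta> = norm \<gamma> \<Longrightarrow> v \<beta> = v \<gamma>"
  using equal_norm_conjugate C.v_W0 by metis

lemma v_simple:
  "j \<in> {1..DIM('a)} \<Longrightarrow> 2 *\<^sub>R \<alpha> j \<notin> \<Phi> \<Longrightarrow> v (\<alpha> j) \<in> {qpow (int (L (s j))), - qpow (- int (L (s j)))}"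
  using v unfolding weighted_parameter_system_def by blast

text \<open>All roots are conjugate, so all degrees are equal and every coordinate of \<open>two_rho\<close> is a positive
  multiple of this common degree.\<close>

lemma simply_laced_case:
  assumes sl: "simply_laced \<Phi>"
  shows "bounded_rep \<Phi> \<alpha> T (psi \<Phi> \<alpha> H T v) \<longleftrightarrow> in_list_simply_laced \<Phi> \<alpha> L v"
proof -
  have red: "reduced_roots \<Phi>" and nrm: "\<And>\<beta> \<gamma>. \<beta> \<in> \<Phi> \<Longrightarrow> \<gamma> \<in> \<Phi> \<Longrightarrow> norm \<beta> = norm \<gamma>"
    using sl unfolding simply_laced_def by blast+
  have one: "1 \<in> {1..DIM('a)}" "1 \<in> {0..DIM('a)}" using rank_pos by auto
  define b where "b = L (s 1)"
  have b: "0 < b" unfolding b_def by (rule L_pos[OF one(2)])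
  have Lb: "L (s i) = b" if "i \<in> {1..DIM('a)}" for i
    unfolding b_def using L_equal_norm[OF that one(1)] nrm[OF simple_root[OF that] simple_root[OF one(1)]] by blast
  have vv: "v \<beta> = v (\<alpha> 1)" if "\<beta> \<in> \<Phi>" for \<beta>
    using v_equal_norm[OF that simple_root[OF one(1)]] nrm[OF that simple_root[OF one(1)]] by blast
  have v1: "v (\<alpha> 1) = qpow (int b) \<or> v (\<alpha> 1) = - qpow (- int b)"
    using v_simple[OF one(1) reduced_double[OF red simple_root[OF one(1)]]] by (simp add: b_def)
  have list: "in_list_simply_laced \<Phi> \<alpha> L v \<longleftrightarrow> v (\<alpha> 1) = - qpow (- int b)"
  proof
    assume "in_list_simply_laced \<Phi> \<alpha> L v"
    then show "v (\<alpha> 1) = - qpow (- int b)" unfolding in_list_simply_laced_def b_def using one(1) simple_root[OF one(1)] by blast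
  next
    assume "v (\<alpha> 1) = - qpow (- int b)"
    then show "in_list_simply_laced \<Phi> \<alpha> L v" unfolding in_list_simply_laced_def using vv Lb by simp
  qed
  define k where "k = real_of_int (C.d (\<alpha> 1))"
  have dk: "of_int (C.d \<beta>) = k" if "\<beta> \<in> \<Phi>" for \<beta> unfolding k_def C.d_def using vv[OF that] by simp
  have coef: "\<omega> i \<bullet> C.two_rho = k * (\<Sum>\<beta>\<in>pos. \<omega> i \<bullet> \<beta>)" for i
    unfolding C.two_rho_def inner_sum_right sum_distrib_left
    by (rule sum.cong) (simp_all add: dk pos_rootD)
  have gt: "0 < (\<Sum>\<beta>\<in>pos. \<omega> i \<bullet> \<beta>)" if i: "i \<in> {1..DIM('a)}" for i
  proof (rule sum_pos2[OF finite_pos simple_pos[OF i]])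
    show "0 < \<omega> i \<bullet> \<alpha> i" using fund_coweight_simple[OF i] by simp
  qed (use pos_cone_nonneg[OF pos_rootD(2)] i in blast)
  have "(\<forall>i\<in>{1..DIM('a)}. \<omega> i \<bullet> C.two_rho \<le> 0) \<longleftrightarrow> k \<le> 0"
  proof
    assume "\<forall>i\<in>{1..DIM('a)}. \<omega> i \<bullet> C.two_rho \<le> 0"
    then have "k * (\<Sum>\<beta>\<in>pos. \<omega> 1 \<bullet> \<beta>) \<le> 0" using one(1) coef by metis
    then show "k \<le> 0" using gt[OF one(1)] by (simp add: mult_le_0_iff)
  next
    assume "k \<le> 0"
    then show "\<forall>i\<in>{1..DIM('a)}. \<omega> i \<bullet> C.two_rho \<le> 0" unfolding coef using gt by (intro ballI mult_nonpos_nonneg) (auto intro: less_imp_le)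
  qed
  moreover have "k \<le> 0 \<longleftrightarrow> v (\<alpha> 1) = - qpow (- int b)"
    using v1 b by (auto simp: k_def C.d_def qpow_neq_minus)
  ultimately show ?thesis unfolding C.bounded_iff list by simp
qed

lemma reduced_system:
  assumes "\<tau> \<noteq> Ty_BC" and j: "j \<in> {1..DIM('a)}"
  shows "(\<Sum>i\<in>{1..DIM('a)}. (\<omega> i \<bullet> C.two_rho) * of_int (cartan_int \<tau> DIM('a) i j)) = 2 * of_int (ldeg (v (\<alpha> j)))"
proof -
  have "2 *\<^sub>R \<alpha> j \<notin> \<Phi>" using reduced_double[OF _ simple_root[OF j]] assms(1) reduced_iff by blast
  then have "(\<Sum>i\<in>{1..DIM('a)}. (\<omega> i \<bullet> C.two_rho) * (\<alpha> i \<bullet> coroot (\<alpha> j))) = 2 * of_int (ldeg (v (\<alpha> j)))"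
    using C.two_rho_system[OF j] C.d_nonroot by (simp add: C.d_def)
  moreover have "(\<Sum>i\<in>{1..DIM('a)}. (\<omega> i \<bullet> C.two_rho) * (\<alpha> i \<bullet> coroot (\<alpha> j))) =
      (\<Sum>i\<in>{1..DIM('a)}. (\<omega> i \<bullet> C.two_rho) * of_int (cartan_int \<tau> DIM('a) i j))"
    by (rule sum.cong) (simp_all only: reduced_cartan[OF assms(1) _ j])
  ultimately show ?thesis by simp
qed

text \<open>The comparison with the list depends only on the set \<open>S\<close> of nodes with short simple roots and on the
  ratio \<open>r\<close> of the square lengths.  It reduces the list to conditions on the value \<open>x\<close> at the short roots,
  the value \<open>y\<close> at the long roots, and the two weights.\<close>

lemma two_length_data:
  assumes nbc: "\<tau> \<noteq> Ty_BC" and S: "S \<subseteq> {1..DIM('a)}" "i0 \<in> S" "j0 \<in> {1..DIM('a)}" "j0 \<notin> S" and r: "r > (1::real)"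
    and len: "\<And>j. j \<in> {1..DIM('a)} \<Longrightarrow> \<alpha> j \<bullet> \<alpha> j = (if j \<in> S then m else r * m)"
  obtains a b x y where "0 < a" "0 < b"
    "x = qpow (int a) \<or> x = - qpow (- int a)" "y = qpow (int b) \<or> y = - qpow (- int b)"
    "\<And>j. j \<in> {1..DIM('a)} \<Longrightarrow> v (\<alpha> j) = (if j \<in> S then x else y)"
    "\<not> simply_laced \<Phi>"
    "in_list_two_lengths \<tau> \<Phi> \<alpha> L v \<longleftrightarrow>
       (x = - qpow (- int a) \<and> y = - qpow (- int b) \<and> \<tau> \<in> {Ty_B, Ty_C, Ty_F, Ty_G}) \<or>
       (x = qpow (int a) \<and> y = - qpow (- int b) \<and> fst (ratio_bounds \<tau> (real DIM('a)) (real a / real b))) \<or>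
       (x = - qpow (- int a) \<and> y = qpow (int b) \<and> snd (ratio_bounds \<tau> (real DIM('a)) (real a / real b)))"
proof -
  have red: "reduced_roots \<Phi>" using nbc reduced_iff by simp
  have i0: "i0 \<in> {1..DIM('a)}" using S by blast
  have m: "0 < m" using len[OF i0] S(2) root_nonzero[OF simple_root[OF i0]] by (metis inner_gt_zero_iff)
  have rm: "m < r * m" using r m by simp
  define x y a b where "x = v (\<alpha> i0)" "y = v (\<alpha> j0)" "a = L (s i0)" "b = L (s j0)"
  note defs = this
  have nrm: "norm (\<alpha> j) = norm (\<alpha> (if j \<in> S then i0 else j0))" if j: "j \<in> {1..DIM('a)}" for j
    using len[OF j] len[OF i0] len[OF S(3)] S(2,4) by (simp add: norm_eq)
  have L: "L (s j) = (if j \<in> S then a else b)" if j: "j \<in> {1..DIM('a)}" for j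
    using nrm[OF j] L_equal_norm[OF j i0] L_equal_norm[OF j S(3)] by (auto simp: defs)
  have vj: "v (\<alpha> j) = (if j \<in> S then x else y)" if j: "j \<in> {1..DIM('a)}" for j
    using nrm[OF j] v_equal_norm[OF simple_root[OF j] simple_root[OF i0]] v_equal_norm[OF simple_root[OF j] simple_root[OF S(3)]]
    by (auto simp: defs)
  have x: "x = qpow (int a) \<or> x = - qpow (- int a)"
    using v_simple[OF i0 reduced_double[OF red simple_root[OF i0]]] by (simp add: defs)
  have y: "y = qpow (int b) \<or> y = - qpow (- int b)"
    using v_simple[OF S(3) reduced_double[OF red simple_root[OF S(3)]]] by (simp add: defs)
  have ab: "0 < a" "0 < b" using L_pos[of i0] L_pos[of j0] i0 S(3) by (auto simp: defs)
  have len_root: "\<beta> \<bullet> \<beta> = m \<or> \<beta> \<bullet> \<beta> = r * m" if b: "\<beta> \<in> \<Phi>" for \<beta>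
  proof -
    obtain g j where g: "g \<in> W0" "j \<in> {1..DIM('a)}" "\<beta> = g (\<alpha> j)" using reduced_conjugate[OF red b] by blast
    then show ?thesis using len[OF g(2)] W0_isometry[OF g(1)] by auto
  qed
  have short: "short_root \<Phi> \<beta> \<longleftrightarrow> \<beta> \<bullet> \<beta> = m" if b: "\<beta> \<in> \<Phi>" for \<beta>
  proof
    assume "short_root \<Phi> \<beta>"
    then have "norm \<beta> \<le> norm (\<alpha> i0)" using simple_root[OF i0] unfolding short_root_def by blast
    then have "\<beta> \<bullet> \<beta> \<le> m" using len[OF i0] S(2) by (simp add: norm_le)
    then show "\<beta> \<bullet> \<beta> = m" using len_root[OF b] rm by auto
  next
    assume "\<beta> \<bullet> \<beta> = m"
    then show "short_root \<Phi> \<beta>" unfolding short_root_def norm_le using b len_root rm by (metis less_imp_le order.refl)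
  qed
  have short_simple: "short_root \<Phi> (\<alpha> j) \<longleftrightarrow> j \<in> S" if j: "j \<in> {1..DIM('a)}" for j
    using short[OF simple_root[OF j]] len[OF j] rm by auto
  have vall: "v \<beta> = (if short_root \<Phi> \<beta> then x else y)" if b: "\<beta> \<in> \<Phi>" for \<beta>
  proof -
    obtain g j where g: "g \<in> W0" "j \<in> {1..DIM('a)}" "\<beta> = g (\<alpha> j)" using reduced_conjugate[OF red b] by blast
    have "short_root \<Phi> \<beta> \<longleftrightarrow> j \<in> S"
      using short[OF b] short_simple[OF g(2)] short[OF simple_root[OF g(2)]] W0_isometry[OF g(1)] g(3) by simp
    then show ?thesis using vj[OF g(2)] C.v_W0[OF g(1)] g(3) by simp
  qed
  have slv: "short_long_values \<Phi> v x' y' \<longleftrightarrow> x = x' \<and> y = y'" for x' y'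
  proof
    assume "short_long_values \<Phi> v x' y'"
    then have "v (\<alpha> i0) = x'" "v (\<alpha> j0) = y'"
      unfolding short_long_values_def using simple_root[OF i0] simple_root[OF S(3)] short_simple[OF i0] short_simple[OF S(3)] S(2,4) by auto
    then show "x = x' \<and> y = y'" by (simp add: defs)
  next
    assume "x = x' \<and> y = y'"
    then show "short_long_values \<Phi> v x' y'" unfolding short_long_values_def using vall by blast
  qed
  have Lab: "(\<forall>j\<in>{1..DIM('a)}. L (s j) = (if short_root \<Phi> (\<alpha> j) then a' else b')) \<longleftrightarrow> a' = a \<and> b' = b" for a' b'
  proof
    assume A: "\<forall>j\<in>{1..DIM('a)}. L (s j) = (if short_root \<Phi> (\<alpha> j) then a' else b')"
    show "a' = a \<and> b' = b"
      using A[rule_format, OF i0] A[rule_format, OF S(3)] short_simple[OF i0] short_simple[OF S(3)] S(2,4) by (simp add: defs)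
  next
    assume "a' = a \<and> b' = b"
    then show "\<forall>j\<in>{1..DIM('a)}. L (s j) = (if short_root \<Phi> (\<alpha> j) then a' else b')" using L short_simple by simp
  qed
  have nsl: "\<not> simply_laced \<Phi>"
  proof
    assume "simply_laced \<Phi>"
    then have "norm (\<alpha> i0) = norm (\<alpha> j0)" using simple_root[OF i0] simple_root[OF S(3)] unfolding simply_laced_def by blast
    then show False using len[OF i0] len[OF S(3)] S(2,4) m r by (simp add: norm_eq)
  qed
  have list: "in_list_two_lengths \<tau> \<Phi> \<alpha> L v \<longleftrightarrow>
       (x = - qpow (- int a) \<and> y = - qpow (- int b) \<and> \<tau> \<in> {Ty_B, Ty_C, Ty_F, Ty_G}) \<or>
       (x = qpow (int a) \<and> y = - qpow (- int b) \<and> fst (ratio_bounds \<tau> (real DIM('a)) (real a / real b))) \<or>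
       (x = - qpow (- int a) \<and> y = qpow (int b) \<and> snd (ratio_bounds \<tau> (real DIM('a)) (real a / real b)))"
    unfolding in_list_two_lengths_def Lab slv Let_def ratio_bounds_def fst_conv snd_conv using ab by auto
  show thesis by (rule that[OF ab x y _ nsl list]) (rule vj)
qed

lemma norm_step:
  assumes nbc: "\<tau> \<noteq> Ty_BC" and "i \<in> {1..DIM('a)}" "j \<in> {1..DIM('a)}"
    and "cartan_int \<tau> DIM('a) i j = - k" "cartan_int \<tau> DIM('a) j i = - 1"
  shows "\<alpha> i \<bullet> \<alpha> i = of_int k * (\<alpha> j \<bullet> \<alpha> j)"
  using cartan_norm_int[OF assms(1-3)] assms(4,5) by simp

lemma rank_type: "type_rank \<tau> DIM('a)"
  using labelled by (simp add: bourbaki_labelled_def)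

lemma chain_norms:
  assumes t: "\<tau> = Ty_B \<or> \<tau> = Ty_C" and j: "j \<in> {1..<DIM('a)}"
  shows "\<alpha> j \<bullet> \<alpha> j = \<alpha> (DIM('a) - 1) \<bullet> \<alpha> (DIM('a) - 1)"
proof -
  have "j \<le> DIM('a) - 1" using j by auto
  then show ?thesis
  proof (induction j rule: inc_induct)
    case base show ?case ..
  next
    case (step k)
    have k: "1 \<le> k" "Suc k < DIM('a)" using step.hyps j by auto
    have "\<alpha> k \<bullet> \<alpha> k = of_int 1 * (\<alpha> (Suc k) \<bullet> \<alpha> (Suc k))"
      by (rule norm_step) (use t k in \<open>auto simp: cartan_int_def max_def min_def\<close>)
    then show ?case using step.IH by simp
  qed
qed

lemma B_case:
  assumes t: "\<tau> = Ty_B"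
  shows "\<not> simply_laced \<Phi>" "bounded_rep \<Phi> \<alpha> T (psi \<Phi> \<alpha> H T v) \<longleftrightarrow> in_list_two_lengths \<tau> \<Phi> \<alpha> L v"
proof -
  let ?n = "DIM('a)"
  have n: "?n \<ge> 2" using rank_type t by simp
  have nbc: "\<tau> \<noteq> Ty_BC" using t by simp
  have "\<alpha> (?n - 1) \<bullet> \<alpha> (?n - 1) = of_int 2 * (\<alpha> ?n \<bullet> \<alpha> ?n)"
    by (rule norm_step[OF nbc]) (use t n in \<open>auto simp: cartan_int_def max_def min_def\<close>)
  then have len: "\<alpha> j \<bullet> \<alpha> j = (if j \<in> {?n} then \<alpha> ?n \<bullet> \<alpha> ?n else 2 * (\<alpha> ?n \<bullet> \<alpha> ?n))" if "j \<in> {1..?n}" for j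
    using chain_norms[of j] that t by (cases "j = ?n") auto
  obtain a b x y where ab: "0 < a" "0 < b"
    and x: "x = qpow (int a) \<or> x = - qpow (- int a)" and y: "y = qpow (int b) \<or> y = - qpow (- int b)"
    and vj: "\<And>j. j \<in> {1..?n} \<Longrightarrow> v (\<alpha> j) = (if j \<in> {?n} then x else y)"
    and nsl: "\<not> simply_laced \<Phi>"
    and list: "in_list_two_lengths \<tau> \<Phi> \<alpha> L v \<longleftrightarrow>
       (x = - qpow (- int a) \<and> y = - qpow (- int b) \<and> \<tau> \<in> {Ty_B, Ty_C, Ty_F, Ty_G}) \<or>
       (x = qpow (int a) \<and> y = - qpow (- int b) \<and> fst (ratio_bounds \<tau> (real DIM('a)) (real a / real b))) \<or>
       (x = - qpow (- int a) \<and> y = qpow (int b) \<and> snd (ratio_bounds \<tau> (real DIM('a)) (real a / real b)))"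
    by (rule two_length_data[OF nbc, of "{?n}" ?n 1 2 "\<alpha> ?n \<bullet> \<alpha> ?n"]) (use n len in auto)
  show "\<not> simply_laced \<Phi>" by (rule nsl)
  let ?x = "real_of_int (ldeg x)" and ?y = "real_of_int (ldeg y)"
  have sol: "\<omega> i \<bullet> C.two_rho = real i * ((2 * real ?n - real i - 1) * ?y + ?x)" if i: "i \<in> {1..?n}" for i
    by (rule B_system_solution[OF _ _ i]) (use n reduced_system[OF nbc] vj t in auto)
  have "(\<forall>i\<in>{1..?n}. \<omega> i \<bullet> C.two_rho \<le> 0) \<longleftrightarrow> 2 * (real ?n - 1) * ?y + ?x \<le> 0 \<and> (real ?n - 1) * ?y + ?x \<le> 0"
    using B_nonpos_iff[of ?n ?y ?x] sol n by simp
  moreover have "\<dots> \<longleftrightarrow> in_list_two_lengths \<tau> \<Phi> \<alpha> L v"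
  proof -
    define N where "N = (real ?n - 1) * real b"
    have N: "real b \<le> N" using n ab by (simp add: N_def)
    have rb0: "0 < real b" using ab by simp
    have c: "real a / real b \<le> real ?n - 1 \<longleftrightarrow> real a \<le> N" "2 * (real ?n - 1) \<le> real a / real b \<longleftrightarrow> 2 * N \<le> real a"
      unfolding pos_divide_le_eq[OF rb0] pos_le_divide_eq[OF rb0] N_def mult.assoc by (rule refl)+
    have rb: "fst (ratio_bounds \<tau> (real DIM('a)) (real a / real b)) \<longleftrightarrow> real a \<le> N" "snd (ratio_bounds \<tau> (real DIM('a)) (real a / real b)) \<longleftrightarrow> 2 * N \<le> real a"
      unfolding ratio_bounds_def fst_conv snd_conv c by (simp_all add: t)
    have M: "(real ?n - 1) * ?y = (if y = qpow (int b) then N else - N)"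
      using y by (auto simp: N_def qpow_neq_minus)
    show ?thesis unfolding list rb mult.assoc[of 2] M using x y ab N t by (auto simp: qpow_neq_minus)
  qed
  ultimately show "bounded_rep \<Phi> \<alpha> T (psi \<Phi> \<alpha> H T v) \<longleftrightarrow> in_list_two_lengths \<tau> \<Phi> \<alpha> L v"
    unfolding C.bounded_iff by simp
qed

lemma C_case:
  assumes t: "\<tau> = Ty_C"
  shows "\<not> simply_laced \<Phi>" "bounded_rep \<Phi> \<alpha> T (psi \<Phi> \<alpha> H T v) \<longleftrightarrow> in_list_two_lengths \<tau> \<Phi> \<alpha> L v"
proof -
  let ?n = "DIM('a)"
  have n: "?n \<ge> 2" using rank_type t by simp
  have nbc: "\<tau> \<noteq> Ty_BC" using t by simp
  have "\<alpha> ?n \<bullet> \<alpha> ?n = of_int 2 * (\<alpha> (?n - 1) \<bullet> \<alpha> (?n - 1))"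
    by (rule norm_step[OF nbc]) (use t n in \<open>auto simp: cartan_int_def max_def min_def\<close>)
  then have len: "\<alpha> j \<bullet> \<alpha> j = (if j \<in> {1..<?n} then \<alpha> (?n - 1) \<bullet> \<alpha> (?n - 1) else 2 * (\<alpha> (?n - 1) \<bullet> \<alpha> (?n - 1)))"
    if "j \<in> {1..?n}" for j
    using chain_norms[of j] that t by (cases "j = ?n") auto
  obtain a b x y where ab: "0 < a" "0 < b"
    and x: "x = qpow (int a) \<or> x = - qpow (- int a)" and y: "y = qpow (int b) \<or> y = - qpow (- int b)"
    and vj: "\<And>j. j \<in> {1..?n} \<Longrightarrow> v (\<alpha> j) = (if j \<in> {1..<?n} then x else y)"
    and nsl: "\<not> simply_laced \<Phi>"
    and list: "in_list_two_lengths \<tau> \<Phi> \<alpha> L v \<longleftrightarrow>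
       (x = - qpow (- int a) \<and> y = - qpow (- int b) \<and> \<tau> \<in> {Ty_B, Ty_C, Ty_F, Ty_G}) \<or>
       (x = qpow (int a) \<and> y = - qpow (- int b) \<and> fst (ratio_bounds \<tau> (real DIM('a)) (real a / real b))) \<or>
       (x = - qpow (- int a) \<and> y = qpow (int b) \<and> snd (ratio_bounds \<tau> (real DIM('a)) (real a / real b)))"
    by (rule two_length_data[OF nbc, of "{1..<?n}" 1 ?n 2 "\<alpha> (?n - 1) \<bullet> \<alpha> (?n - 1)"]) (use n len in auto)
  show "\<not> simply_laced \<Phi>" by (rule nsl)
  let ?x = "real_of_int (ldeg x)" and ?y = "real_of_int (ldeg y)"
  have sol: "(if i < ?n then \<omega> i \<bullet> C.two_rho else 2 * (\<omega> i \<bullet> C.two_rho)) = real i * ((2 * real ?n - real i - 1) * ?x + 2 * ?y)"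
    if i: "i \<in> {1..?n}" for i
    by (rule C_system_solution[OF n _ i]) (use n reduced_system[OF nbc] vj t in auto)
  have "\<omega> i \<bullet> C.two_rho \<le> 0 \<longleftrightarrow> real i * ((2 * real ?n - real i - 1) * ?x + 2 * ?y) \<le> 0" if "i \<in> {1..?n}" for i
    unfolding sol[OF that, symmetric] by simp
  then have "(\<forall>i\<in>{1..?n}. \<omega> i \<bullet> C.two_rho \<le> 0) \<longleftrightarrow> 2 * (real ?n - 1) * ?x + 2 * ?y \<le> 0 \<and> (real ?n - 1) * ?x + 2 * ?y \<le> 0"
    using B_nonpos_iff[of ?n ?x "2 * ?y"] n by simp
  moreover have "\<dots> \<longleftrightarrow> in_list_two_lengths \<tau> \<Phi> \<alpha> L v"
  proof -
    define N where "N = (real ?n - 1) * real a"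
    have N: "real a \<le> N" using n ab by (simp add: N_def)
    have rb0: "0 < real b" and n0: "0 < real ?n - 1" using ab n by simp_all
    have c: "real a / real b \<le> 1 / (real ?n - 1) \<longleftrightarrow> N \<le> real b" "2 / (real ?n - 1) \<le> real a / real b \<longleftrightarrow> 2 * real b \<le> N"
      unfolding pos_divide_le_eq[OF rb0] pos_divide_le_eq[OF n0] times_divide_eq_left pos_le_divide_eq[OF n0] pos_le_divide_eq[OF rb0]
      by (simp_all add: N_def mult.commute)
    have rb: "fst (ratio_bounds \<tau> (real DIM('a)) (real a / real b)) \<longleftrightarrow> N \<le> real b" "snd (ratio_bounds \<tau> (real DIM('a)) (real a / real b)) \<longleftrightarrow> 2 * real b \<le> N"
      unfolding ratio_bounds_def fst_conv snd_conv c by (simp_all add: t)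
    have M: "(real ?n - 1) * ?x = (if x = qpow (int a) then N else - N)"
      using x by (auto simp: N_def qpow_neq_minus)
    show ?thesis unfolding list rb mult.assoc[of 2] M using x y ab N t by (auto simp: qpow_neq_minus)
  qed
  ultimately show "bounded_rep \<Phi> \<alpha> T (psi \<Phi> \<alpha> H T v) \<longleftrightarrow> in_list_two_lengths \<tau> \<Phi> \<alpha> L v"
    unfolding C.bounded_iff by simp
qed

lemma F_case:
  assumes t: "\<tau> = Ty_F"
  shows "\<not> simply_laced \<Phi>" "bounded_rep \<Phi> \<alpha> T (psi \<Phi> \<alpha> H T v) \<longleftrightarrow> in_list_two_lengths \<tau> \<Phi> \<alpha> L v"
proof -
  have n: "DIM('a) = 4" using rank_type t by simp
  have nbc: "\<tau> \<noteq> Ty_BC" using t by simp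
  have I: "{1..DIM('a)} = {1, 2, 3, 4}" unfolding n by auto
  have "\<alpha> 1 \<bullet> \<alpha> 1 = of_int 1 * (\<alpha> 2 \<bullet> \<alpha> 2)" "\<alpha> 2 \<bullet> \<alpha> 2 = of_int 2 * (\<alpha> 3 \<bullet> \<alpha> 3)" "\<alpha> 3 \<bullet> \<alpha> 3 = of_int 1 * (\<alpha> 4 \<bullet> \<alpha> 4)"
    by (rule norm_step[OF nbc]; use t n in \<open>auto simp: cartan_int_def max_def min_def\<close>)+
  then have len: "\<alpha> j \<bullet> \<alpha> j = (if j \<in> {3, 4} then \<alpha> 3 \<bullet> \<alpha> 3 else 2 * (\<alpha> 3 \<bullet> \<alpha> 3))" if "j \<in> {1..DIM('a)}" for j
    using that unfolding I by auto
  obtain a b x y where ab: "0 < a" "0 < b"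
    and x: "x = qpow (int a) \<or> x = - qpow (- int a)" and y: "y = qpow (int b) \<or> y = - qpow (- int b)"
    and vj: "\<And>j. j \<in> {1..DIM('a)} \<Longrightarrow> v (\<alpha> j) = (if j \<in> {3, 4} then x else y)"
    and nsl: "\<not> simply_laced \<Phi>"
    and list: "in_list_two_lengths \<tau> \<Phi> \<alpha> L v \<longleftrightarrow>
       (x = - qpow (- int a) \<and> y = - qpow (- int b) \<and> \<tau> \<in> {Ty_B, Ty_C, Ty_F, Ty_G}) \<or>
       (x = qpow (int a) \<and> y = - qpow (- int b) \<and> fst (ratio_bounds \<tau> (real DIM('a)) (real a / real b))) \<or>
       (x = - qpow (- int a) \<and> y = qpow (int b) \<and> snd (ratio_bounds \<tau> (real DIM('a)) (real a / real b)))"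
    by (rule two_length_data[OF nbc, of "{3, 4}" 3 1 2 "\<alpha> 3 \<bullet> \<alpha> 3"]) (use n len in auto)
  show "\<not> simply_laced \<Phi>" by (rule nsl)
  let ?x = "real_of_int (ldeg x)" and ?y = "real_of_int (ldeg y)"
  have sys: "(\<Sum>i\<in>{1..4}. (\<omega> i \<bullet> C.two_rho) * of_int (cartan_int Ty_F 4 i j)) = 2 * (if j \<ge> 3 then ?x else ?y)" if "j \<in> {1..4}" for j
    using reduced_system[OF nbc, of j] vj[of j] that unfolding n t by auto
  have "(\<forall>i\<in>{1..DIM('a)}. \<omega> i \<bullet> C.two_rho \<le> 0) \<longleftrightarrow>
      6 * ?x + 10 * ?y \<le> 0 \<and> 12 * ?x + 18 * ?y \<le> 0 \<and> 18 * ?x + 24 * ?y \<le> 0 \<and> 10 * ?x + 12 * ?y \<le> 0"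
    unfolding I using F_system_solution[of "\<lambda>i. \<omega> i \<bullet> C.two_rho", OF sys] by simp
  moreover have "\<dots> \<longleftrightarrow> in_list_two_lengths \<tau> \<Phi> \<alpha> L v"
  proof -
    have rb0: "0 < real b" using ab by simp
    have c: "real a / real b \<le> 6 / 5 \<longleftrightarrow> 5 * real a \<le> 6 * real b" "5 / 3 \<le> real a / real b \<longleftrightarrow> 5 * real b \<le> 3 * real a"
      unfolding pos_divide_le_eq[OF rb0] pos_le_divide_eq[OF rb0] by linarith+
    have rb: "fst (ratio_bounds \<tau> (real DIM('a)) (real a / real b)) \<longleftrightarrow> 5 * real a \<le> 6 * real b"
        "snd (ratio_bounds \<tau> (real DIM('a)) (real a / real b)) \<longleftrightarrow> 5 * real b \<le> 3 * real a"
      unfolding ratio_bounds_def fst_conv snd_conv c by (simp_all add: t)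
    show ?thesis unfolding list rb using x y ab t by (auto simp: qpow_neq_minus)
  qed
  ultimately show "bounded_rep \<Phi> \<alpha> T (psi \<Phi> \<alpha> H T v) \<longleftrightarrow> in_list_two_lengths \<tau> \<Phi> \<alpha> L v"
    unfolding C.bounded_iff by simp
qed

lemma G_case:
  assumes t: "\<tau> = Ty_G"
  shows "\<not> simply_laced \<Phi>" "bounded_rep \<Phi> \<alpha> T (psi \<Phi> \<alpha> H T v) \<longleftrightarrow> in_list_two_lengths \<tau> \<Phi> \<alpha> L v"
proof -
  have n: "DIM('a) = 2" using rank_type t by simp
  have nbc: "\<tau> \<noteq> Ty_BC" using t by simp
  have I: "{1..DIM('a)} = {1, 2}" unfolding n by auto
  have "\<alpha> 2 \<bullet> \<alpha> 2 = of_int 3 * (\<alpha> 1 \<bullet> \<alpha> 1)"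
    by (rule norm_step[OF nbc]) (use t n in \<open>auto simp: cartan_int_def max_def min_def\<close>)
  then have len: "\<alpha> j \<bullet> \<alpha> j = (if j \<in> {1} then \<alpha> 1 \<bullet> \<alpha> 1 else 3 * (\<alpha> 1 \<bullet> \<alpha> 1))" if "j \<in> {1..DIM('a)}" for j
    using that unfolding I by auto
  obtain a b x y where ab: "0 < a" "0 < b"
    and x: "x = qpow (int a) \<or> x = - qpow (- int a)" and y: "y = qpow (int b) \<or> y = - qpow (- int b)"
    and vj: "\<And>j. j \<in> {1..DIM('a)} \<Longrightarrow> v (\<alpha> j) = (if j \<in> {1} then x else y)"
    and nsl: "\<not> simply_laced \<Phi>"
    and list: "in_list_two_lengths \<tau> \<Phi> \<alpha> L v \<longleftrightarrow>
       (x = - qpow (- int a) \<and> y = - qpow (- int b) \<and> \<tau> \<in> {Ty_B, Ty_C, Ty_F, Ty_G}) \<or>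
       (x = qpow (int a) \<and> y = - qpow (- int b) \<and> fst (ratio_bounds \<tau> (real DIM('a)) (real a / real b))) \<or>
       (x = - qpow (- int a) \<and> y = qpow (int b) \<and> snd (ratio_bounds \<tau> (real DIM('a)) (real a / real b)))"
    by (rule two_length_data[OF nbc, of "{1}" 1 2 3 "\<alpha> 1 \<bullet> \<alpha> 1"]) (use n len in auto)
  show "\<not> simply_laced \<Phi>" by (rule nsl)
  let ?x = "real_of_int (ldeg x)" and ?y = "real_of_int (ldeg y)"
  have sys: "(\<Sum>i\<in>{1..2}. (\<omega> i \<bullet> C.two_rho) * of_int (cartan_int Ty_G 2 i j)) = 2 * (if j = 1 then ?x else ?y)" if "j \<in> {1..2}" for j
    using reduced_system[OF nbc, of j] vj[of j] that unfolding n t by auto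
  have "(\<forall>i\<in>{1..DIM('a)}. \<omega> i \<bullet> C.two_rho \<le> 0) \<longleftrightarrow> 4 * ?x + 6 * ?y \<le> 0 \<and> 2 * ?x + 4 * ?y \<le> 0"
    unfolding I using G_system_solution[of "\<lambda>i. \<omega> i \<bullet> C.two_rho", OF sys] by simp
  moreover have "\<dots> \<longleftrightarrow> in_list_two_lengths \<tau> \<Phi> \<alpha> L v"
  proof -
    have rb0: "0 < real b" using ab by simp
    have c: "real a / real b \<le> 3 / 2 \<longleftrightarrow> 2 * real a \<le> 3 * real b" "2 \<le> real a / real b \<longleftrightarrow> 2 * real b \<le> real a"
      unfolding pos_divide_le_eq[OF rb0] pos_le_divide_eq[OF rb0] by linarith+
    have rb: "fst (ratio_bounds \<tau> (real DIM('a)) (real a / real b)) \<longleftrightarrow> 2 * real a \<le> 3 * real b"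
        "snd (ratio_bounds \<tau> (real DIM('a)) (real a / real b)) \<longleftrightarrow> 2 * real b \<le> real a"
      unfolding ratio_bounds_def fst_conv snd_conv c by (simp_all add: t)
    show ?thesis unfolding list rb using x y ab t by (auto simp: qpow_neq_minus)
  qed
  ultimately show "bounded_rep \<Phi> \<alpha> T (psi \<Phi> \<alpha> H T v) \<longleftrightarrow> in_list_two_lengths \<tau> \<Phi> \<alpha> L v"
    unfolding C.bounded_iff by simp
qed

lemma BC_case:
  assumes t: "\<tau> = Ty_BC"
  shows "bounded_rep \<Phi> \<alpha> T (psi \<Phi> \<alpha> H T v) \<longleftrightarrow> in_list_BC \<Phi> \<alpha> L v"
proof -
  let ?n = "DIM('a)"
  define a b c where "a = L (s ?n)" "b = L (s 1)" "c = L (s 0)"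
  note abc = this
  define x y z where "x = v (\<alpha> 1)" "y = v (\<alpha> ?n) * v (2 *\<^sub>R \<alpha> ?n)" "z = v (2 *\<^sub>R \<alpha> ?n)"
  note xyz = this
  have n: "1 \<le> ?n" using rank_pos(2) by simp
  have gt: "0 < a" "0 < b" "0 < c" using L_pos n by (auto simp: abc)
  have ac: "c \<le> a" using weight t by (simp add: positive_weight_function_def abc)
  have z: "z = qpow (int c) \<or> z = - qpow (- int c)" and y: "y = qpow (int a) \<or> y = - qpow (- int a)"
    using v t by (auto simp: weighted_parameter_system_def xyz abc)
  have x: "x = qpow (int b) \<or> x = - qpow (- int b)" if "?n \<ge> 2"
    using v_simple[OF rank_pos(1) BC_facts(3)[OF t]] that by (simp add: xyz abc)
  let ?x = "real_of_int (ldeg x)" and ?w = "real_of_int (ldeg y) + real_of_int (ldeg z)"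
  have last: "2 *\<^sub>R \<alpha> ?n \<in> \<Phi>" by (rule BC_facts(1)[OF t])
  have "ldeg y = C.d (\<alpha> ?n) + ldeg z"
    unfolding xyz C.d_def by (rule monomial_mult(2)[OF C.v_monomial[OF simple_root[OF rank_pos(2)]] C.v_monomial[OF last]])
  then have top: "real_of_int (C.d (\<alpha> ?n) + 2 * C.d (2 *\<^sub>R \<alpha> ?n)) = ?w" by (simp add: C.d_def xyz)
  have "(\<Sum>i\<in>{1..?n}. (\<omega> i \<bullet> C.two_rho) * of_int (cartan_int Ty_B ?n i j)) = 2 * (if j < ?n then ?x else ?w)"
    if j: "j \<in> {1..?n}" for j
  proof -
    have "of_int (C.d (\<alpha> j) + 2 * C.d (2 *\<^sub>R \<alpha> j)) = (if j < ?n then ?x else ?w)"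
    proof (cases "j < ?n")
      case True
      then have jj: "j \<in> {1..<?n}" and one: "1 \<in> {1..<?n}" using j by auto
      have "C.d (2 *\<^sub>R \<alpha> j) = 0" by (rule C.d_nonroot[OF BC_facts(3)[OF t jj]])
      moreover have "v (\<alpha> j) = x"
        unfolding xyz by (rule v_equal_norm[OF simple_root[OF j] simple_root[OF rank_pos(1)] BC_facts(6)[OF t jj one]])
      ultimately show ?thesis using True by (simp add: C.d_def)
    next
      case False
      then have "j = ?n" using j by simp
      then show ?thesis using top by simp
    qed
    moreover have "(\<Sum>i\<in>{1..?n}. (\<omega> i \<bullet> C.two_rho) * of_int (cartan_int Ty_B ?n i j)) = (\<Sum>i\<in>{1..?n}. (\<omega> i \<bullet> C.two_rho) * (\<alpha> i \<bullet> coroot (\<alpha> j)))"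
      by (rule sum.cong) (simp_all only: BC_facts(5)[OF t _ j])
    ultimately show ?thesis using C.two_rho_system[OF j] by simp
  qed
  then have sol: "\<omega> i \<bullet> C.two_rho = real i * ((2 * real ?n - real i - 1) * ?x + ?w)" if i: "i \<in> {1..?n}" for i
    by (rule B_system_solution[OF n _ i])
  have "(\<forall>i\<in>{1..?n}. \<omega> i \<bullet> C.two_rho \<le> 0) \<longleftrightarrow> 2 * (real ?n - 1) * ?x + ?w \<le> 0 \<and> (real ?n - 1) * ?x + ?w \<le> 0"
    using B_nonpos_iff[OF n, of ?x ?w] sol by simp
  moreover have "\<dots> \<longleftrightarrow> in_list_BC \<Phi> \<alpha> L v"
  proof -
    define N where "N = (real ?n - 1) * real b"
    have rb0: "0 < real b" using gt by simp
    have conv: "real a / real b + real c / real b \<ge> 2 * (real ?n - 1) \<longleftrightarrow> 2 * N \<le> real a + real c"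
      "real a / real b - real c / real b \<ge> 2 * (real ?n - 1) \<longleftrightarrow> 2 * N \<le> real a - real c"
      "real a / real b - real c / real b \<le> real ?n - 1 \<longleftrightarrow> real a - real c \<le> N"
      "real a / real b + real c / real b \<le> real ?n - 1 \<longleftrightarrow> real a + real c \<le> N"
      unfolding add_divide_distrib[symmetric] diff_divide_distrib[symmetric] pos_divide_le_eq[OF rb0] pos_le_divide_eq[OF rb0]
        N_def mult.assoc by (rule refl)+
    have BV: "BC_values \<alpha> v X' Y' Z' \<longleftrightarrow> (?n \<ge> 2 \<longrightarrow> x = X') \<and> y = Y' \<and> z = Z'" for X' Y' Z'
      by (simp only: BC_values_def xyz)
    have ge: "(1 \<le> a) = True" "(1 \<le> b) = True" "(1 \<le> c) = True" using gt by auto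
    have list: "in_list_BC \<Phi> \<alpha> L v \<longleftrightarrow>
      ((?n \<ge> 2 \<longrightarrow> x = - qpow (- int b)) \<and> y = - qpow (- int a) \<and> z = - qpow (- int c) \<or>
       (?n \<ge> 2 \<longrightarrow> x = - qpow (- int b)) \<and> y = - qpow (- int a) \<and> z = qpow (int c) \<or>
       ((?n \<ge> 2 \<longrightarrow> x = qpow (int b)) \<and> y = - qpow (- int a) \<and> z = - qpow (- int c)) \<and> 2 * N \<le> real a + real c \<or>
       ((?n \<ge> 2 \<longrightarrow> x = qpow (int b)) \<and> y = - qpow (- int a) \<and> z = qpow (int c)) \<and> 2 * N \<le> real a - real c \<or>
       ((?n \<ge> 2 \<longrightarrow> x = - qpow (- int b)) \<and> y = qpow (int a) \<and> z = - qpow (- int c)) \<and> real a - real c \<le> N \<or>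
       ((?n \<ge> 2 \<longrightarrow> x = - qpow (- int b)) \<and> y = qpow (int a) \<and> z = qpow (int c)) \<and> real a + real c \<le> N)"
      unfolding in_list_BC_def Let_def abc[symmetric] BV conv by (simp only: ge simp_thms)
    have sg: "x' = - qpow (- int k) \<longleftrightarrow> x' \<noteq> qpow (int k)" "real_of_int (ldeg x') = (if x' = qpow (int k) then real k else - real k)"
      if "x' = qpow (int k) \<or> x' = - qpow (- int k)" for x' k
      using that by (auto simp: qpow_neq_minus)
    note sgy = sg[OF y] and sgz = sg[OF z]
    show ?thesis
    proof (cases "?n \<ge> 2")
      case True
      note sgx = sg[OF x[OF True]]
      have N: "real b \<le> N" using True gt by (simp add: N_def)
      have M: "(real ?n - 1) * ?x = (if x = qpow (int b) then N else - N)"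
        unfolding sgx(2) by (simp add: N_def)
      have n2: "(2 \<le> ?n) = True" using True by simp
      show ?thesis unfolding list mult.assoc[of 2] M sgx(1) sgy sgz n2 simp_thms
        by (rule BC_sign_cases) (use gt ac N in auto)
    next
      case False
      then have n1: "real ?n - 1 = 0" "(2 \<le> ?n) = False" using n by simp_all
      have N: "N = 0" by (simp only: N_def n1 mult_zero_left)
      show ?thesis unfolding list N mult.assoc[of 2] n1 sgy sgz simp_thms mult_zero_left mult_zero_right
        by (rule BC_sign_cases_rank_one) (use gt ac in auto)
    qed
  qed
  ultimately show ?thesis unfolding C.bounded_iff by simp
qed

lemma bounded_iff_in_list:
  "bounded_rep \<Phi> \<alpha> T (psi \<Phi> \<alpha> H T v) \<longleftrightarrow> in_list \<tau> \<Phi> \<alpha> L v"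
proof (cases \<tau>)
  case Ty_A
  then have sl: "simply_laced \<Phi>" by (intro ADE_simply_laced) simp
  then show ?thesis using simply_laced_case[OF sl] Ty_A unfolding in_list_def by simp
next
  case Ty_B
  then have "reduced_roots \<Phi>" using reduced_iff by simp
  then show ?thesis using B_case[OF Ty_B] Ty_B unfolding in_list_def by simp
next
  case Ty_C
  then have "reduced_roots \<Phi>" using reduced_iff by simp
  then show ?thesis using C_case[OF Ty_C] Ty_C unfolding in_list_def by simp
next
  case Ty_D
  then have sl: "simply_laced \<Phi>" by (intro ADE_simply_laced) simp
  then show ?thesis using simply_laced_case[OF sl] Ty_D unfolding in_list_def by simp
next
  case Ty_E
  then have sl: "simply_laced \<Phi>" by (intro ADE_simply_laced) simp
  then show ?thesis using simply_laced_case[OF sl] Ty_E unfolding in_list_def by simp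
next
  case Ty_F
  then have "reduced_roots \<Phi>" using reduced_iff by simp
  then show ?thesis using F_case[OF Ty_F] Ty_F unfolding in_list_def by simp
next
  case Ty_G
  then have "reduced_roots \<Phi>" using reduced_iff by simp
  then show ?thesis using G_case[OF Ty_G] Ty_G unfolding in_list_def by simp
next
  case Ty_BC
  then have nr: "\<not> reduced_roots \<Phi>" using reduced_iff by simp
  then have "\<not> simply_laced \<Phi>" unfolding simply_laced_def by blast
  then show ?thesis using nr BC_case[OF Ty_BC] Ty_BC unfolding in_list_def by simp
qed

end
end

theorem proposition6p10:
  fixes \<tau> :: root_type
    and \<Phi> :: "'a::euclidean_space set"
    and \<alpha> :: "nat \<Rightarrow> 'a"
    and L :: "('a \<Rightarrow> 'a) \<Rightarrow> nat"
    and H :: "(laurent, 'h) module"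
    and T :: "('a \<Rightarrow> 'a) \<Rightarrow> 'h"
  assumes "crystallographic_root_system \<Phi>"
    and "irreducible_roots \<Phi>"
    and "simple_system \<Phi> \<alpha>"
    and "bourbaki_labelled \<tau> \<Phi> \<alpha>"
    and "positive_weight_function \<tau> \<Phi> \<alpha> L"
    and "affine_hecke_algebra \<Phi> \<alpha> L H T"
  shows "{\<psi> \<in> one_dim_reps \<tau> \<Phi> \<alpha> L H T. bounded_rep \<Phi> \<alpha> T \<psi>} =
         {psi \<Phi> \<alpha> H T v | v. weighted_parameter_system \<tau> \<Phi> \<alpha> L v \<and> in_list \<tau> \<Phi> \<alpha> L v}"
proof -
  interpret weighted_hecke_algebra \<Phi> \<alpha> L H T \<tau>
    by unfold_locales (fact assms)+
  show ?thesis unfolding one_dim_reps_def using bounded_iff_in_list by blast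
qed

end
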